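(* $\mathrm{Nash} \leq_2 \lceil \langle \mathrm{rDiv} \rangle^z \rceil_{z \in \mathbb{N}}$; that is, finding a Nash equilibrium of a bi-matrix game of arbitrary size is reducible to the supremum over $z$ of the $z$-fold products of robust division.
   Context: Representation of reals. Fix a bijection $\nu:\mathbb{N}\to\mathbb{Q}$ with $\nu(0)=0$ such that the usual operations on $\mathbb{Q}$ are computable with respect to $\nu$. A sequence $w\in\mathbb{N}^{\mathbb{N}}$ is a $\rho$-name of $x\in\mathbb{R}$, written $\rho(w)=x$, if $|\nu(w(i))-x|\le 2^{-i}$ for all $i\in\mathbb{N}$. Problems and reducibility. $\mathbb{N}^{\mathbb{N}}$ carries its usual (Baire) topology, countable sets such as $\mathbb{N}$ or finite sets are discrete, products carry the product topology. A problem (multi-valued function) $P$ has a domain $\mathrm{dom}(P)$ of inputs (names) and assigns to each input a nonempty set of admissible outputs (names); $P$ is identified with the set of its choice functions, i.e. all functions $f$ on $\mathrm{dom}(P)$ with $f(w)$ admissible for every $w$. $P\le_2 Q$ holds iff there are continuous partial functions $F,G$ such that for each $g\in Q$ the function $w\mapsto F(w,g(G(w)))$ belongs to $P$ (in particular is defined on $\mathrm{dom}(P)$). Products and suprema. $\langle P,Q\rangle$ is the problem with inputs $(x,u)\in \mathrm{dom}(P)\times\mathrm{dom}(Q)$ and admissible outputs all pairs $(y,v)$ with $y$ admissible for $x$ in $P$ and $v$ admissible for $u$ in $Q$; $\langle P\rangle^1=P$, $\langle P\rangle^{z+1}=\langle P,\langle P\rangle^z\rangle$, $z\ge1$. For a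 countable family $(P_i)$, $\lceil P_i\rceil_i$ denotes its supremum with respect to $\le_2$, realized by the problem with inputs $(i,w)$, $w\in\mathrm{dom}(P_i)$, and the admissible outputs of $P_i$ on $w$. Robust division. $\mathrm{rDiv}$ is the set of functions $d$ defined on $\{(u,v)\mid 0\le\rho(u)\le\rho(v)\}$ (pairs of $\rho$-names), whose values are $\rho$-names of real numbers, satisfying $\rho(d(u,v))=\rho(u)/\rho(v)$ whenever $\rho(v)>0$ (the value is an arbitrary real if $\rho(v)=0$). Games. An $n\times m$ bi-matrix game is a pair $(A,B)$ of real $n\times m$ matrices. $S^k$ is the set of vectors in $\mathbb{R}^k$ with non-negative entries summing to $1$. A Nash equilibrium is $(\hat x,\hat y)\in S^n\times S^m$ with $\hat x^TA\hat y\ge x^TA\hat y$ for all $x\in S^n$ and $\hat x^TB\hat y\ge\hat x^TBy$ for all $y\in S^m$. A name of a game consists of the size $(n,m)$ followed by $\rho$-names of all entries of $A$ and $B$ (combined by standard tupling of sequences); a name of a Nash equilibrium consists of $\rho$-names of all its entries. $\mathrm{Nash}_{nm}$ is the problem: given a name of an $n\times m$ game, produce a name of some Nash equilibrium; $\mathrm{Nash}$ is the version without fixed size, i.e. the supremum $\lceil\mathrm{Nash}_{nm}\rceil_{n,m\ge1}$. *)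

theory Defs
  imports
    "HOL-Analysis.Function_Topology"
    "HOL-Library.Countable"
    "Jordan_Normal_Form.Matrix"
begin

section \<open>Computable numberings of the rationals\<close>

text \<open>
  Recursive functions of a given arity, on argument lists. Minimisation is only applied to regular
  functions, which yields exactly the total recursive functions. The values on lists whose length
  differs from the arity are irrelevant.
\<close>

inductive recursive :: "nat \<Rightarrow> (nat list \<Rightarrow> nat) \<Rightarrow> bool" where
  zero: "recursive k (\<lambda>xs. 0)"
| succ: "recursive 1 (\<lambda>xs. Suc (hd xs))"
| proj: "i < k \<Longrightarrow> recursive k (\<lambda>xs. xs ! i)"
| comp: "recursive (length gs) f \<Longrightarrow> (\<forall>g\<in>set gs. recursive k g)
    \<Longrightarrow> recursive k (\<lambda>xs. f (map (\<lambda>g. g xs) gs))"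
| prim: "recursive k f \<Longrightarrow> recursive (k + 2) g
    \<Longrightarrow> recursive (k + 1) (\<lambda>xs. rec_nat (f (tl xs)) (\<lambda>i r. g (i # r # tl xs)) (hd xs))"
| minim: "recursive (k + 1) f \<Longrightarrow> (\<forall>xs. length xs = k \<longrightarrow> (\<exists>y. f (y # xs) = 0))
    \<Longrightarrow> recursive k (\<lambda>xs. LEAST y. f (y # xs) = 0)"

definition computable_wrt :: "(nat \<Rightarrow> rat) \<Rightarrow> (rat \<Rightarrow> rat \<Rightarrow> rat) \<Rightarrow> bool" where
  "computable_wrt \<nu> h \<longleftrightarrow>
    (\<exists>f. recursive 2 f \<and> (\<forall>a b. \<nu> (f [a, b]) = h (\<nu> a) (\<nu> b)))"

text \<open>
  Division is total, with value \<open>0\<close> for the divisor \<open>0\<close>; since \<open>\<nu>\<close> is bijective this does not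
  affect computability. Computability of the order follows from that of the arithmetic operations.
\<close>

definition computable_numbering :: "(nat \<Rightarrow> rat) \<Rightarrow> bool" where
  "computable_numbering \<nu> \<longleftrightarrow> bij \<nu> \<and> \<nu> 0 = 0 \<and>
    computable_wrt \<nu> (+) \<and> computable_wrt \<nu> (-) \<and>
    computable_wrt \<nu> (*) \<and> computable_wrt \<nu> (/)"


section \<open>Baire space, tupling, and names of reals\<close>

text \<open>
  The type \<open>nat \<Rightarrow> nat\<close> carries the product topology of the discrete topology on \<open>nat\<close>. All names
  are points of this one space: a pair of names is interleaved, and an element of a countable
  discrete set is put in front of a sequence. Both codings are homeomorphisms onto their images,
  so that products and suprema over families can be formed without changing the type.
\<close>

type_synonym baire = "nat \<Rightarrow> nat"

definition bpair :: "baire \<Rightarrow> baire \<Rightarrow> baire" where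
  "bpair u v = (\<lambda>k. if even k then u (k div 2) else v (k div 2))"

abbreviation bcons :: "nat \<Rightarrow> baire \<Rightarrow> baire"  (infixr \<open>##\<close> 65) where
  "i ## w \<equiv> case_nat i w"

text \<open>Only nonempty lists are ever tupled.\<close>

fun btuple :: "baire list \<Rightarrow> baire" where
  "btuple [] = (\<lambda>_. 0)"
| "btuple [w] = w"
| "btuple (w # w' # ws) = bpair w (btuple (w' # ws))"

definition rho_name :: "(nat \<Rightarrow> rat) \<Rightarrow> baire \<Rightarrow> real \<Rightarrow> bool" where
  "rho_name \<nu> w x \<longleftrightarrow> (\<forall>i. \<bar>of_rat (\<nu> (w i)) - x\<bar> \<le> (1 / 2) ^ i)"

lemma ex_rho_name:
  assumes "surj \<nu>"
  shows "\<exists>w. rho_name \<nu> w x"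
proof -
  have "\<exists>k. \<bar>of_rat (\<nu> k) - x\<bar> \<le> (1 / 2) ^ i" for i :: nat
  proof -
    have "x < x + (1 / 2) ^ i" by simp
    then obtain q :: rat where q: "x < of_rat q" "of_rat q < x + (1 / 2) ^ i"
      using of_rat_dense by blast
    obtain k where "\<nu> k = q" using assms by (metis surjD)
    with q show ?thesis by (intro exI[of _ k]) auto
  qed
  then obtain w where "\<forall>i. \<bar>of_rat (\<nu> (w i)) - x\<bar> \<le> (1 / 2) ^ i" by metis
  then show ?thesis by (auto simp: rho_name_def)
qed

definition rho_names :: "(nat \<Rightarrow> rat) \<Rightarrow> baire \<Rightarrow> real list \<Rightarrow> bool" where
  "rho_names \<nu> w xs \<longleftrightarrow> (\<exists>ws. list_all2 (rho_name \<nu>) ws xs \<and> w = btuple ws)"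


section \<open>Problems and reducibility\<close>

text \<open>
  \<open>outputs P w\<close> is only meaningful for \<open>w \<in> inputs P\<close>, where it is meant to be nonempty. This is
  not built into the type: for games it is the existence of equilibria.
\<close>

record problem =
  inputs :: "baire set"
  outputs :: "baire \<Rightarrow> baire set"

definition choice_functions :: "problem \<Rightarrow> (baire \<rightharpoonup> baire) set" where
  "choice_functions P = {f. dom f = inputs P \<and> (\<forall>w\<in>inputs P. the (f w) \<in> outputs P w)}"

definition continuous_partial ::
    "('a::topological_space \<rightharpoonup> 'b::topological_space) \<Rightarrow> bool" where
  "continuous_partial f \<longleftrightarrow> continuous_on (dom f) (the \<circ> f)"

text \<open>
  The partial function \<open>w \<mapsto> F (w, g (G w))\<close> is required to have exactly the domain \<open>inputs P\<close>.
  Allowing a larger domain gives the same relation, since \<open>G\<close> may be restricted to \<open>inputs P\<close>.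
\<close>

definition reducible2 :: "problem \<Rightarrow> problem \<Rightarrow> bool"  (infix \<open>\<le>\<^sub>2\<close> 50) where
  "P \<le>\<^sub>2 Q \<longleftrightarrow>
    (\<exists>(F :: baire \<times> baire \<rightharpoonup> baire) (G :: baire \<rightharpoonup> baire).
      continuous_partial F \<and> continuous_partial G \<and>
      (\<forall>g\<in>choice_functions Q.
        (\<lambda>w. Option.bind (G w) (\<lambda>u. Option.bind (g u) (\<lambda>v. F (w, v)))) \<in> choice_functions P))"

definition prod_problem :: "problem \<Rightarrow> problem \<Rightarrow> problem" where
  "prod_problem P Q =
    \<lparr>inputs = {bpair x u | x u. x \<in> inputs P \<and> u \<in> inputs Q},
     outputs = (\<lambda>w. {bpair y v | y v.
       \<exists>x u. w = bpair x u \<and> y \<in> outputs P x \<and> v \<in> outputs Q u})\<rparr>"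

text \<open>The power with exponent \<open>0\<close> is left unspecified.\<close>

fun power_problem :: "problem \<Rightarrow> nat \<Rightarrow> problem" where
  "power_problem P (Suc 0) = P"
| "power_problem P (Suc (Suc z)) = prod_problem P (power_problem P (Suc z))"

definition sup_problem :: "'i::countable set \<Rightarrow> ('i \<Rightarrow> problem) \<Rightarrow> problem" where
  "sup_problem I P =
    \<lparr>inputs = {to_nat i ## w | i w. i \<in> I \<and> w \<in> inputs (P i)},
     outputs = (\<lambda>w'. {v. \<exists>i\<in>I. \<exists>w. w' = to_nat i ## w \<and> v \<in> outputs (P i) w})\<rparr>"


section \<open>Robust division\<close>

definition rDiv :: "(nat \<Rightarrow> rat) \<Rightarrow> problem" where
  "rDiv \<nu> =
    \<lparr>inputs = {bpair u v | u v. \<exists>x y. rho_name \<nu> u x \<and> rho_name \<nu> v y \<and> 0 \<le> x \<and> x \<le> y},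
     outputs = (\<lambda>w. {d. \<exists>u v x y q. w = bpair u v \<and> rho_name \<nu> u x \<and> rho_name \<nu> v y \<and>
       rho_name \<nu> d q \<and> (y > 0 \<longrightarrow> q = x / y)})\<rparr>"

text \<open>The problems on the right-hand side of the reduction do have admissible outputs everywhere.\<close>

lemma rDiv_outputs_nonempty:
  assumes "surj \<nu>" "w \<in> inputs (rDiv \<nu>)"
  shows "outputs (rDiv \<nu>) w \<noteq> {}"
proof -
  obtain u v x y where uv: "w = bpair u v" "rho_name \<nu> u x" "rho_name \<nu> v y"
    using assms(2) by (auto simp: rDiv_def)
  obtain d where "rho_name \<nu> d (x / y)" using ex_rho_name[OF assms(1)] by blast
  with uv have "d \<in> outputs (rDiv \<nu>) w"
    unfolding rDiv_def problem.simps by blast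
  then show ?thesis by blast
qed

lemma power_problem_outputs_nonempty:
  assumes "\<And>w. w \<in> inputs P \<Longrightarrow> outputs P w \<noteq> {}" "z \<ge> 1"
    "w \<in> inputs (power_problem P z)"
  shows "outputs (power_problem P z) w \<noteq> {}"
proof -
  have "\<forall>w\<in>inputs (power_problem P (Suc k)). outputs (power_problem P (Suc k)) w \<noteq> {}" for k
  proof (induction k)
    case (Suc k)
    then show ?case using assms(1) by (fastforce simp: prod_problem_def)
  qed (use assms(1) in simp)
  then show ?thesis using assms(2,3) by (metis Suc_le_D One_nat_def)
qed

lemma ex_choice_function_sup_power_rDiv:
  assumes "surj \<nu>"
  shows "choice_functions (sup_problem {1..} (\<lambda>z::nat. power_problem (rDiv \<nu>) z)) \<noteq> {}"
proof -
  let ?S = "sup_problem {1..} (\<lambda>z::nat. power_problem (rDiv \<nu>) z)"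
  have "outputs ?S w \<noteq> {}" if "w \<in> inputs ?S" for w
    using that power_problem_outputs_nonempty[OF rDiv_outputs_nonempty[OF assms]]
    by (fastforce simp: sup_problem_def)
  then have "\<forall>w\<in>inputs ?S. \<exists>v. v \<in> outputs ?S w"
    by blast
  then obtain c where "\<forall>w\<in>inputs ?S. c w \<in> outputs ?S w"
    unfolding bchoice_iff by blast
  then have "(\<lambda>w. if w \<in> inputs ?S then Some (c w) else None) \<in> choice_functions ?S"
    by (auto simp: choice_functions_def dom_def)
  then show ?thesis by blast
qed


section \<open>Bi-matrix games\<close>

definition mixed_strategies :: "nat \<Rightarrow> real vec set" where
  "mixed_strategies k =
    {x \<in> carrier_vec k. (\<forall>i<k. vec_index x i \<ge> 0) \<and> (\<Sum>i<k. vec_index x i) = 1}"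

definition nash_equilibrium ::
    "nat \<Rightarrow> nat \<Rightarrow> real mat \<Rightarrow> real mat \<Rightarrow> real vec \<Rightarrow> real vec \<Rightarrow> bool" where
  "nash_equilibrium n m A B x y \<longleftrightarrow>
    x \<in> mixed_strategies n \<and> y \<in> mixed_strategies m \<and>
    (\<forall>x'\<in>mixed_strategies n. scalar_prod x (A *\<^sub>v y) \<ge> scalar_prod x' (A *\<^sub>v y)) \<and>
    (\<forall>y'\<in>mixed_strategies m. scalar_prod x (B *\<^sub>v y) \<ge> scalar_prod x (B *\<^sub>v y'))"

definition game_name ::
    "(nat \<Rightarrow> rat) \<Rightarrow> nat \<Rightarrow> nat \<Rightarrow> baire \<Rightarrow> real mat \<Rightarrow> real mat \<Rightarrow> bool" where
  "game_name \<nu> n m w A B \<longleftrightarrow> A \<in> carrier_mat n m \<and> B \<in> carrier_mat n m \<and>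
    (\<exists>w'. rho_names \<nu> w' (concat (mat_to_list A) @ concat (mat_to_list B)) \<and>
      w = n ## m ## w')"

definition Nash_nm :: "(nat \<Rightarrow> rat) \<Rightarrow> nat \<Rightarrow> nat \<Rightarrow> problem" where
  "Nash_nm \<nu> n m =
    \<lparr>inputs = {w. \<exists>A B. game_name \<nu> n m w A B},
     outputs = (\<lambda>w. {v. \<exists>A B x y. game_name \<nu> n m w A B \<and> nash_equilibrium n m A B x y \<and>
       rho_names \<nu> v (list_of_vec x @ list_of_vec y)})\<rparr>"

definition Nash :: "(nat \<Rightarrow> rat) \<Rightarrow> problem" where
  "Nash \<nu> = sup_problem ({1..} \<times> {1..}) (\<lambda>(n, m). Nash_nm \<nu> n m)"

end

(*
  The inputs of Nash are names, so the reduction lives on a zero-dimensional space, and the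
  robust quotient of x and y amounts to an oracle for an arbitrary continuous [0,1]-valued
  function on an arbitrary open set (where y > 0) that answers arbitrarily elsewhere.

  For fixed supports the equilibria form a polytope that depends on the game, and the games for
  which it is nonempty form a closed set. Finitely many closed sets are told apart by one oracle
  call each. For one support, intersecting with half-spaces one by one
  (double description) yields a finite stratification of the games, with closed unions of lower
  strata, such that on each stratum the polytope is the hull of continuously moving points. The
  generators on the l-th stratum extend continuously to the open set of games on strata >= l, together
  with a bound eta for the distance from the polytopes there to the extended hull, where eta
  vanishes on the l-th stratum. All these data come from one parallel round of oracle calls; on the
  l-th stratum only those of the levels above l are arbitrary. Starting anywhere, one now pulls a
  point to within eta of the hull of level D, then D - 1, ..., then 0. Level l puts it
  into the polytope, and the lower levels do not move it any more.
*)
theory Submission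
  imports Defs "HOL-Analysis.Function_Metric" "HOL-Analysis.Brouwer_Fixpoint"
begin

text \<open>The factors of a power of \<open>rDiv\<close> receive their inputs together. So every
  query must be a function of the name alone, total on all names of games, and the final solver must
  be continuous on all admissible answers, the meaningless ones included. Zero-dimensionality makes
  this affordable: a nonempty closed set of names is a retract, so data given on a closed part can
  be requested everywhere; and an open set is the positivity set of a continuous function, whose
  product with a continuous function into the unit interval extends by 0. Supports are fixed because
  the set of all equilibria need not be convex. Projecting onto the hulls in turn would fail: below
  the stratum of the game the extended hull only approximates the polytope, and a projection would
  leave the polytope again. Hence the tolerance eta. It has to be continuous and to vanish on its
  own stratum, and this is where upper semicontinuity of the polytopes enters. The number of queries
  is fixed for each size of games, so one power serves all games of that size.\<close>

section \<open>Prefixes and the topology of Baire space\<close>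

definition agree :: "nat \<Rightarrow> baire \<Rightarrow> baire \<Rightarrow> bool" where
  "agree k u v \<longleftrightarrow> (\<forall>i<k. u i = v i)"

lemma agree_refl [simp]: "agree k u u" by (simp add: agree_def)
lemma agree_sym: "agree k u v \<Longrightarrow> agree k v u" by (simp add: agree_def)
lemma agree_trans: "agree k u v \<Longrightarrow> agree k v w \<Longrightarrow> agree k u w" by (simp add: agree_def)
lemma agree_mono: "agree k u v \<Longrightarrow> j \<le> k \<Longrightarrow> agree j u v" by (simp add: agree_def)

lemma open_agree: "open {v. agree k u v}"
proof -
  have "{v. agree k u v} = (\<Pi>\<^sub>E i\<in>UNIV. if i < k then {u i} else UNIV)"
    by (force simp: agree_def PiE_iff split: if_splits)
  moreover have "open \<dots>"
    by (rule open_PiE) (auto simp: open_discrete intro: finite_subset[of _ "{..<k}"])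
  ultimately show ?thesis by simp
qed

lemma open_contains_agree:
  assumes "open S" "(u::baire) \<in> S"
  shows "\<exists>k. \<forall>v. agree k u v \<longrightarrow> v \<in> S"
proof -
  have "openin (product_topology (\<lambda>i. euclidean) UNIV) S"
    using assms(1) by (simp add: open_fun_def)
  from product_topology_open_contains_basis[OF this assms(2)] obtain X :: "nat \<Rightarrow> nat set"
    where X: "u \<in> (\<Pi>\<^sub>E i\<in>UNIV. X i)" "finite {i. X i \<noteq> UNIV}" "(\<Pi>\<^sub>E i\<in>UNIV. X i) \<subseteq> S"
    by auto
  obtain k where k: "\<And>i. X i \<noteq> UNIV \<Longrightarrow> i < k"
    using X(2) by (metis (mono_tags, lifting) finite_nat_set_iff_bounded mem_Collect_eq)
  have "v \<in> S" if "agree k u v" for v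
  proof -
    have "v i \<in> X i" for i
    proof (cases "X i = UNIV")
      case False
      then have "u i = v i" using k that by (simp add: agree_def)
      moreover have "u i \<in> X i" using X(1) by (simp add: PiE_iff)
      ultimately show ?thesis by simp
    qed simp
    then show ?thesis using X(3) by (auto simp: PiE_iff)
  qed
  then show ?thesis by blast
qed

text \<open>Cylinders form a neighbourhood base, which turns topological statements about names into
  statements about prefixes.\<close>

lemma eventually_nhds_agree:
  "eventually P (nhds (u::baire)) \<longleftrightarrow> (\<exists>k. \<forall>v. agree k u v \<longrightarrow> P v)"
proof
  assume "eventually P (nhds u)"
  then obtain S where "open S" "u \<in> S" "\<forall>v\<in>S. P v"
    by (auto simp: eventually_nhds)
  then show "\<exists>k. \<forall>v. agree k u v \<longrightarrow> P v"
    using open_contains_agree by metis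
next
  assume "\<exists>k. \<forall>v. agree k u v \<longrightarrow> P v"
  then obtain k where "\<forall>v. agree k u v \<longrightarrow> P v" ..
  then show "eventually P (nhds u)"
    unfolding eventually_nhds using open_agree[of k u]
    by (intro exI[of _ "{v. agree k u v}"]) auto
qed

text \<open>Since \<open>P\<close> holds at \<open>u\<close>, the point that \<open>at\<close>
  removes may be put back.\<close>

lemma eventually_at_agree:
  assumes "(u::baire) \<in> X" "P u"
  shows "eventually P (at u within X) \<longleftrightarrow> (\<exists>k. \<forall>v\<in>X. agree k u v \<longrightarrow> P v)"
  unfolding eventually_at_filter eventually_nhds_agree using assms by blast

lemma continuous_on_discrete:
  fixes f :: "'a::topological_space \<Rightarrow> 'b::discrete_topology"
  shows "continuous_on S f \<longleftrightarrow> (\<forall>x\<in>S. eventually (\<lambda>y. f y = f x) (at x within S))"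
  by (simp add: continuous_on_def tendsto_discrete)

lemma continuous_on_agree_real:
  fixes f :: "baire \<Rightarrow> real"
  shows "continuous_on X f \<longleftrightarrow>
    (\<forall>u\<in>X. \<forall>e>0. \<exists>k. \<forall>v\<in>X. agree k u v \<longrightarrow> \<bar>f v - f u\<bar> < e)" (is "?L = ?R")
proof -
  have "?L = (\<forall>u\<in>X. \<forall>e>0. eventually (\<lambda>v. \<bar>f v - f u\<bar> < e) (at u within X))"
    unfolding continuous_on_def tendsto_iff dist_real_def by blast
  also have "\<dots> = ?R"
    by (intro ball_cong refl all_cong1 imp_cong) (subst eventually_at_agree, auto)
  finally show ?thesis .
qed

section \<open>Names of reals and realizers\<close>

lemma rho_name_unique:
  assumes "rho_name \<nu> w x" "rho_name \<nu> w y"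
  shows "x = y"
proof (rule ccontr)
  assume "x \<noteq> y"
  then have "\<bar>x - y\<bar> / 2 > 0" by simp
  then obtain i where i: "(1/2::real) ^ i < \<bar>x - y\<bar> / 2"
    using real_arch_pow_inv[of "\<bar>x - y\<bar> / 2" "1/2"] by auto
  have "\<bar>of_rat (\<nu> (w i)) - x\<bar> \<le> (1/2) ^ i" "\<bar>of_rat (\<nu> (w i)) - y\<bar> \<le> (1/2) ^ i"
    using assms by (auto simp: rho_name_def)
  then show False using i by (simp add: abs_if split: if_splits)
qed

definition named_real :: "(nat \<Rightarrow> rat) \<Rightarrow> baire \<Rightarrow> real" where
  "named_real \<nu> w = (THE x. rho_name \<nu> w x)"

lemma named_real_eq: "rho_name \<nu> w x \<Longrightarrow> named_real \<nu> w = x"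
  unfolding named_real_def using rho_name_unique by blast

text \<open>The digit \<open>i\<close> alone fixes the real up to \<open>2 * (1/2) ^ i\<close>, so a
  prefix of length \<open>Suc i\<close> suffices.\<close>

lemma continuous_on_named_real: "continuous_on {w. \<exists>x. rho_name \<nu> w x} (named_real \<nu>)"
  unfolding continuous_on_agree_real
proof (intro ballI allI impI)
  fix u :: baire and e :: real
  assume u: "u \<in> {w. \<exists>x. rho_name \<nu> w x}" and "e > 0"
  then obtain i where i: "(1/2::real) ^ i < e / 2"
    using real_arch_pow_inv[of "e / 2" "1/2"] by auto
  show "\<exists>k. \<forall>v\<in>{w. \<exists>x. rho_name \<nu> w x}. agree k u v \<longrightarrow> \<bar>named_real \<nu> v - named_real \<nu> u\<bar> < e"
  proof (intro exI[of _ "Suc i"] ballI impI)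
    fix v assume v: "v \<in> {w. \<exists>x. rho_name \<nu> w x}" and "agree (Suc i) u v"
    then have "v i = u i" by (simp add: agree_def)
    obtain x y where xy: "rho_name \<nu> u x" "rho_name \<nu> v y" using u v by auto
    then have "\<bar>of_rat (\<nu> (u i)) - x\<bar> \<le> (1/2) ^ i" "\<bar>of_rat (\<nu> (u i)) - y\<bar> \<le> (1/2) ^ i"
      using \<open>v i = u i\<close> unfolding rho_name_def by metis+
    then show "\<bar>named_real \<nu> v - named_real \<nu> u\<bar> < e"
      using i xy by (simp add: named_real_eq)
  qed
qed

lemma half_pow: "(1/2::real) ^ Suc i = (1/2) ^ i / 2"
  by simp

text \<open>The realizer is not extensional: its \<open>i\<close>-th digit depends on the shortest prefix of the
  argument that fixes the value of \<open>f\<close> up to \<open>2 ^ -i\<close>.\<close>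

lemma ex_realizer_baire:
  fixes f :: "baire \<Rightarrow> real"
  assumes "surj \<nu>" "continuous_on S f"
  shows "\<exists>F. continuous_on S F \<and> (\<forall>u\<in>S. rho_name \<nu> (F u) (f u))"
proof -
  \<comment> \<open>A digit that is correct for all points of \<open>S\<close> in a cylinder. The
    shortest such cylinder, and the digit chosen for it, depend on that cylinder only and not on the
    point in it.\<close>
  define ok where "ok i k u q \<longleftrightarrow> (\<forall>v\<in>S. agree k u v \<longrightarrow> \<bar>of_rat (\<nu> q) - f v\<bar> \<le> (1/2) ^ i)"
    for i k u q
  define len where "len i u = (LEAST k. \<exists>q. ok i k u q)" for i u
  define F where "F u i = (SOME q. ok i (len i u) u q)" for u i
  have ex: "\<exists>k q. ok i k u q" if "u \<in> S" for i u
  proof -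
    have "\<forall>e>0. \<exists>k. \<forall>v\<in>S. agree k u v \<longrightarrow> \<bar>f v - f u\<bar> < e"
      using assms(2) that by (simp add: continuous_on_agree_real)
    from this[rule_format, of "(1/2::real) ^ i / 2"]
    obtain k where k: "\<forall>v\<in>S. agree k u v \<longrightarrow> \<bar>f v - f u\<bar> < (1/2::real) ^ i / 2"
      by auto
    obtain w where w: "rho_name \<nu> w (f u)" using ex_rho_name[OF assms(1)] by blast
    \<comment> \<open>The name is read one digit further, which leaves half of the tolerance for the
      oscillation of \<open>f\<close>.\<close>
    then have w': "\<bar>of_rat (\<nu> (w (Suc i))) - f u\<bar> \<le> (1/2::real) ^ i / 2"
      unfolding rho_name_def by (metis (no_types) half_pow)
    have "ok i k u (w (Suc i))" unfolding ok_def
    proof (intro ballI impI)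
      fix v assume "v \<in> S" "agree k u v"
      then have "\<bar>f v - f u\<bar> < (1/2::real) ^ i / 2" using k by blast
      then show "\<bar>of_rat (\<nu> (w (Suc i))) - f v\<bar> \<le> (1/2) ^ i" using w' by linarith
    qed
    then show ?thesis by blast
  qed
  have okF: "ok i (len i u) u (F u i)" if u: "u \<in> S" for u i
  proof -
    have "\<exists>q. ok i (len i u) u q" unfolding len_def using ex[OF u] by (rule LeastI_ex)
    then show ?thesis unfolding F_def by (rule someI_ex)
  qed
  have ok_agree: "ok i k u = ok i k v" if "agree k u v" for i k u v
    unfolding ok_def using that agree_sym agree_trans by blast
  \<comment> \<open>A certificate for \<open>u\<close> also serves \<open>v\<close>, and the
    possibly shorter one of \<open>v\<close> in turn serves \<open>u\<close>; minimality makes the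
    lengths equal.\<close>
  have F_eq: "F v i = F u i" if u: "u \<in> S" and uv: "agree (len i u) u v" for u v i
  proof -
    have "\<exists>q. ok i (len i u) u q" using okF u by blast
    then have exv: "\<exists>q. ok i (len i u) v q" using ok_agree[OF uv] by simp
    then have le: "len i v \<le> len i u" unfolding len_def[of i v] by (rule Least_le)
    have "\<exists>q. ok i (len i v) v q" unfolding len_def[of i v] using exv by (rule LeastI)
    then have "\<exists>q. ok i (len i v) u q" using ok_agree agree_mono[OF uv le] by metis
    then have "len i u \<le> len i v" unfolding len_def[of i u] by (rule Least_le)
    with le have "len i u = len i v" by simp
    then show ?thesis unfolding F_def using ok_agree[OF uv] by simp
  qed
  have "continuous_on S F"
  proof (rule continuous_on_coordinatewise_then_product)
    fix i
    show "continuous_on S (\<lambda>u. F u i)"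
      unfolding continuous_on_discrete
    proof
      fix u assume u: "u \<in> S"
      have "\<forall>v\<in>S. agree (len i u) u v \<longrightarrow> F v i = F u i"
        using F_eq[OF u] by blast
      then show "eventually (\<lambda>v. F v i = F u i) (at u within S)"
        unfolding eventually_at_agree[of u S "\<lambda>v. F v i = F u i", OF u refl] by blast
    qed
  qed
  moreover have "rho_name \<nu> (F u) (f u)" if "u \<in> S" for u
    unfolding rho_name_def using okF[OF that] that by (auto simp: ok_def)
  ultimately show ?thesis by blast
qed

section \<open>Pairing, tupling and gluing\<close>

definition bfst :: "baire \<Rightarrow> baire" where "bfst w = (\<lambda>k. w (2 * k))"
definition bsnd :: "baire \<Rightarrow> baire" where "bsnd w = (\<lambda>k. w (Suc (2 * k)))"

lemma bfst_bpair [simp]: "bfst (bpair u v) = u" by (simp add: bfst_def bpair_def)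
lemma bsnd_bpair [simp]: "bsnd (bpair u v) = v" by (simp add: bsnd_def bpair_def)
lemma bpair_inject [simp]: "bpair u v = bpair u' v' \<longleftrightarrow> u = u' \<and> v = v'"
  by (metis bfst_bpair bsnd_bpair)

lemma continuous_on_apply:
  fixes f :: "'a::topological_space \<Rightarrow> 'b \<Rightarrow> 'c::topological_space"
  shows "continuous_on S f \<Longrightarrow> continuous_on S (\<lambda>x. f x i)"
  by (rule continuous_on_product_then_coordinatewise)

lemma continuous_on_bfst: "continuous_on S f \<Longrightarrow> continuous_on S (\<lambda>x. bfst (f x))"
  unfolding bfst_def by (rule continuous_on_coordinatewise_then_product, erule continuous_on_apply)
lemma continuous_on_bsnd: "continuous_on S f \<Longrightarrow> continuous_on S (\<lambda>x. bsnd (f x))"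
  unfolding bsnd_def by (rule continuous_on_coordinatewise_then_product, erule continuous_on_apply)
lemma continuous_on_bpair:
  assumes "continuous_on S f" "continuous_on S g"
  shows "continuous_on S (\<lambda>x. bpair (f x) (g x))"
proof (rule continuous_on_coordinatewise_then_product)
  show "continuous_on S (\<lambda>x. bpair (f x) (g x) i)" for i
    using assms by (cases "even i") (simp_all add: bpair_def continuous_on_apply)
qed

lemma continuous_on_bcons:
  assumes "continuous_on S f"
  shows "continuous_on S (\<lambda>x. i ## f x)"
proof (rule continuous_on_coordinatewise_then_product)
  show "continuous_on S (\<lambda>x. (i ## f x) k)" for k
    using assms by (cases k) (simp_all add: continuous_on_apply)
qed

text \<open>A tuple has no end mark, its last component is stored unpaired. The number
  \<open>L\<close> of components tells when to stop.\<close>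

fun btuple_nth :: "nat \<Rightarrow> nat \<Rightarrow> baire \<Rightarrow> baire" where
  "btuple_nth L 0 w = (if L \<le> 1 then w else bfst w)"
| "btuple_nth L (Suc k) w = btuple_nth (L - 1) k (bsnd w)"

lemma btuple_nth_btuple: "k < length ws \<Longrightarrow> btuple_nth (length ws) k (btuple ws) = ws ! k"
proof (induction ws arbitrary: k rule: btuple.induct)
  case (2 w)
  then show ?case by simp
next
  case (3 w w' ws)
  then show ?case by (cases k) auto
qed simp

lemma continuous_on_btuple_nth:
  "continuous_on S f \<Longrightarrow> continuous_on S (\<lambda>x. btuple_nth L k (f x))"
proof (induction k arbitrary: L f)
  case 0
  then show ?case by (cases "L \<le> 1") (simp_all add: continuous_on_bfst)
next
  case (Suc k)
  then show ?case using Suc.IH[OF continuous_on_bsnd[OF Suc.prems]] by simp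
qed

lemma continuous_on_btuple:
  assumes "\<And>f. f \<in> set fs \<Longrightarrow> continuous_on S f"
  shows "continuous_on S (\<lambda>x. btuple (map (\<lambda>f. f x) fs))"
  using assms
proof (induction fs rule: induct_list012)
  case (3 f g fs)
  have "continuous_on S (\<lambda>x. bpair (f x) (btuple (map (\<lambda>f. f x) (g # fs))))"
    by (intro continuous_on_bpair 3) (use 3 in auto)
  then show ?case by simp
qed auto

text \<open>\<open>bpair\<close> embeds the product into Baire space, where realizers are already
  available.\<close>

lemma ex_realizer_pair:
  fixes f :: "baire \<times> baire \<Rightarrow> real"
  assumes "surj \<nu>" "continuous_on S f"
  shows "\<exists>F. continuous_on S F \<and> (\<forall>u\<in>S. rho_name \<nu> (F u) (f u))"
proof -
  let ?h = "\<lambda>p. bpair (fst p) (snd p)" and ?g = "\<lambda>w. (bfst w, bsnd w)"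
  have g: "continuous_on (?h ` S) ?g"
    by (intro continuous_on_Pair continuous_on_bfst continuous_on_bsnd continuous_on_id)
  have "continuous_on (?h ` S) (\<lambda>w. f (?g w))"
    by (rule continuous_on_compose2[OF assms(2) g]) auto
  from ex_realizer_baire[OF assms(1) this] obtain F
    where F: "continuous_on (?h ` S) F" "\<forall>u\<in>?h ` S. rho_name \<nu> (F u) (f (?g u))" by blast
  have h: "continuous_on S ?h"
    by (intro continuous_on_bpair continuous_on_fst continuous_on_snd continuous_on_id)
  have "continuous_on S (\<lambda>u. F (?h u))"
    by (rule continuous_on_compose2[OF F(1) h]) auto
  moreover have "\<forall>u\<in>S. rho_name \<nu> (F (?h u)) (f u)" using F(2) by auto
  ultimately show ?thesis by blast
qed

text \<open>The fibres of a continuous map into a discrete space are relatively open, so continuity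
  may be checked on each of them.\<close>

lemma continuous_on_fibres:
  fixes h :: "'a::topological_space \<Rightarrow> 'd::discrete_topology"
    and f :: "'a \<Rightarrow> 'b::topological_space"
  assumes h: "continuous_on S h" and f: "\<And>n. continuous_on {x \<in> S. h x = n} f"
  shows "continuous_on S f"
  unfolding continuous_on_def
proof
  fix x assume x: "x \<in> S"
  have 1: "eventually (\<lambda>y. y \<noteq> x \<longrightarrow> y \<in> S \<longrightarrow> h y = h x) (nhds x)"
    using h x by (auto simp: continuous_on_discrete eventually_at_filter)
  have 2: "(f \<longlongrightarrow> f x) (at x within {y \<in> S. h y = h x})"
    using f x by (simp add: continuous_on_def)
  show "(f \<longlongrightarrow> f x) (at x within S)"
  proof (rule topological_tendstoI)
    fix B assume B: "open B" "f x \<in> B"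
    have "eventually (\<lambda>y. y \<noteq> x \<longrightarrow> y \<in> {y \<in> S. h y = h x} \<longrightarrow> f y \<in> B) (nhds x)"
      using topological_tendstoD[OF 2 B] by (simp add: eventually_at_filter)
    with 1 show "eventually (\<lambda>y. f y \<in> B) (at x within S)"
      unfolding eventually_at_filter by eventually_elim auto
  qed
qed

subsection \<open>Products and suprema\<close>

lemma btuple_in_inputs_power:
  assumes "length ws = Suc z" "\<And>w. w \<in> set ws \<Longrightarrow> w \<in> inputs P"
  shows "btuple ws \<in> inputs (power_problem P (Suc z))"
  using assms
proof (induction z arbitrary: ws)
  case 0
  then show ?case by (cases ws) auto
next
  case (Suc z)
  then obtain w w' ws' where ws: "ws = w # w' # ws'" by (metis length_Suc_conv)
  have "btuple (w' # ws') \<in> inputs (power_problem P (Suc z))"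
    by (rule Suc.IH) (use Suc.prems ws in auto)
  moreover have "w \<in> inputs P" using Suc.prems ws by simp
  ultimately show ?case unfolding ws by (auto simp: prod_problem_def)
qed

text \<open>\<open>bpair\<close> is injective, so an input splits in one way only and each answer
  belongs to its own query.\<close>

lemma outputs_power_btuple:
  assumes "v \<in> outputs (power_problem P (Suc z)) (btuple ws)" "length ws = Suc z"
  shows "\<exists>vs. length vs = Suc z \<and> v = btuple vs \<and> (\<forall>k<Suc z. vs ! k \<in> outputs P (ws ! k))"
  using assms
proof (induction z arbitrary: ws v)
  case 0
  then obtain w where "ws = [w]" by (metis length_0_conv length_Suc_conv)
  with 0 show ?case by (intro exI[of _ "[v]"]) auto
next
  case (Suc z)
  then obtain w w' ws' where ws: "ws = w # w' # ws'" by (metis length_Suc_conv)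
  obtain y u where v: "v = bpair y u" "y \<in> outputs P w"
    "u \<in> outputs (power_problem P (Suc z)) (btuple (w' # ws'))"
    using Suc.prems(1) unfolding ws by (auto simp: prod_problem_def)
  obtain vs where vs: "length vs = Suc z" "u = btuple vs"
    "\<forall>k<Suc z. vs ! k \<in> outputs P ((w' # ws') ! k)"
    using Suc.IH[OF v(3)] Suc.prems(2) ws by auto
  obtain v' vs' where "vs = v' # vs'" using vs(1) by (metis length_Suc_conv)
  then have "v = btuple (y # vs)" using v(1) vs(2) by simp
  moreover have "(y # vs) ! k \<in> outputs P (ws ! k)" if "k < Suc (Suc z)" for k
    using that v(2) vs(3) ws by (cases k) auto
  ultimately show ?case using vs(1) by (intro exI[of _ "y # vs"]) auto
qed

lemma bcons_inject: "i ## u = j ## v \<longleftrightarrow> i = j \<and> u = v"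
proof
  assume eq: "i ## u = j ## v"
  have "i = j" using fun_cong[OF eq, of 0] by simp
  moreover have "u k = v k" for k using fun_cong[OF eq, of "Suc k"] by simp
  ultimately show "i = j \<and> u = v" by auto
qed simp

text \<open>The leading digit of the input selects the reduction. It is a discrete value, so the
  glued maps are continuous fibre by fibre; the outer map also sees the original input and hence the
  index.\<close>

lemma sup_problem_reducible:
  assumes "\<And>i. i \<in> I \<Longrightarrow> P i \<le>\<^sub>2 Q"
  shows "sup_problem I P \<le>\<^sub>2 Q"
proof -
  define red where "red R F G \<longleftrightarrow> continuous_partial F \<and> continuous_partial G \<and>
      (\<forall>g\<in>choice_functions Q.
        (\<lambda>w. Option.bind (G w) (\<lambda>u. Option.bind (g u) (\<lambda>v. F (w, v)))) \<in> choice_functions R)"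
    for R :: problem and F :: "baire \<times> baire \<rightharpoonup> baire" and G :: "baire \<rightharpoonup> baire"
  have "\<forall>i\<in>I. \<exists>F G. red (P i) F G"
    using assms unfolding reducible2_def red_def by blast
  then obtain F where "\<forall>i\<in>I. \<exists>G. red (P i) (F i) G" by metis
  then obtain G where FG: "\<And>i. i \<in> I \<Longrightarrow> red (P i) (F i) (G i)" by metis
  define tail :: "baire \<Rightarrow> baire" where "tail w = (\<lambda>k. w (Suc k))" for w
  have tail [simp]: "tail (j ## w) = w" for j w by (simp add: tail_def)
  have cons_tail: "w 0 ## tail w = w" for w by (auto simp: tail_def fun_eq_iff split: nat.split)
  have cont_tail: "continuous_on S f \<Longrightarrow> continuous_on S (\<lambda>x. tail (f x))"
    for S and f :: "'c::topological_space \<Rightarrow> baire"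
    unfolding tail_def by (rule continuous_on_coordinatewise_then_product, erule continuous_on_apply)
  define ix where "ix = (from_nat :: nat \<Rightarrow> 'a)"
  \<comment> \<open>\<open>from_nat\<close> is total, so inputs whose leading digit codes no element
    of \<open>I\<close> have to be excluded explicitly.\<close>
  define G' where "G' w = (if w 0 \<in> to_nat ` I then G (ix (w 0)) (tail w) else None)" for w
  define F' where "F' p = (if fst p 0 \<in> to_nat ` I then F (ix (fst p 0)) (tail (fst p), snd p) else None)"
    for p
  have ixI: "ix n \<in> I" if "n \<in> to_nat ` I" for n using that by (auto simp: ix_def)
  have "continuous_partial G'"
    unfolding continuous_partial_def
  proof (rule continuous_on_fibres)
    show "continuous_on (dom G') (\<lambda>w. w 0)" by (rule continuous_on_apply) (rule continuous_on_id)
    fix n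
    show "continuous_on {w \<in> dom G'. w 0 = n} (the \<circ> G')"
    proof (cases "n \<in> to_nat ` I")
      case True
      have c: "continuous_on (dom (G (ix n))) (the \<circ> G (ix n))"
        using FG[OF ixI[OF True]] by (simp add: red_def continuous_partial_def)
      have "continuous_on {w \<in> dom G'. w 0 = n} (\<lambda>w. (the \<circ> G (ix n)) (tail w))"
        by (rule continuous_on_compose2[OF c cont_tail[OF continuous_on_id]])
           (use True in \<open>auto simp: G'_def dom_def\<close>)
      then show ?thesis by (rule continuous_on_eq) (use True in \<open>auto simp: G'_def\<close>)
    next
      case False
      then have "{w \<in> dom G'. w 0 = n} = {}" by (auto simp: G'_def dom_def)
      then show ?thesis by (metis continuous_on_empty)
    qed
  qed
  moreover have "continuous_partial F'"
    unfolding continuous_partial_def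
  proof (rule continuous_on_fibres)
    show "continuous_on (dom F') (\<lambda>p. fst p 0)"
      by (rule continuous_on_apply) (intro continuous_on_fst continuous_on_id)
    fix n
    show "continuous_on {p \<in> dom F'. fst p 0 = n} (the \<circ> F')"
    proof (cases "n \<in> to_nat ` I")
      case True
      have c: "continuous_on (dom (F (ix n))) (the \<circ> F (ix n))"
        using FG[OF ixI[OF True]] by (simp add: red_def continuous_partial_def)
      have "continuous_on {p \<in> dom F'. fst p 0 = n} (\<lambda>p. (the \<circ> F (ix n)) (tail (fst p), snd p))"
        by (rule continuous_on_compose2[OF c continuous_on_Pair[OF cont_tail[OF continuous_on_fst[OF continuous_on_id]] continuous_on_snd[OF continuous_on_id]]])
           (use True in \<open>auto simp: F'_def dom_def\<close>)
      then show ?thesis by (rule continuous_on_eq) (use True in \<open>auto simp: F'_def\<close>)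
    next
      case False
      then have "{p \<in> dom F'. fst p 0 = n} = {}" by (auto simp: F'_def dom_def)
      then show ?thesis by (metis continuous_on_empty)
    qed
  qed
  moreover have "(\<lambda>w. Option.bind (G' w) (\<lambda>u. Option.bind (g u) (\<lambda>v. F' (w, v))))
      \<in> choice_functions (sup_problem I P)" (is "?f \<in> _") if g: "g \<in> choice_functions Q" for g
  proof -
    define fi where "fi i w = Option.bind (G i w) (\<lambda>u. Option.bind (g u) (\<lambda>v. F i (w, v)))" for i w
    have fi: "dom (fi i) = inputs (P i)" "\<And>w. w \<in> inputs (P i) \<Longrightarrow> the (fi i w) \<in> outputs (P i) w"
      if "i \<in> I" for i
      using FG[OF that] g by (auto simp: red_def fi_def[abs_def] choice_functions_def)
    have f: "?f w = (if w 0 \<in> to_nat ` I then fi (ix (w 0)) (tail w) else None)" for w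
      by (auto simp: G'_def F'_def fi_def)
    have "dom ?f = inputs (sup_problem I P)"
    proof -
      have "w \<in> dom ?f \<longleftrightarrow> w \<in> inputs (sup_problem I P)" for w
      proof
        assume "w \<in> dom ?f"
        then have w0: "w 0 \<in> to_nat ` I" and "tail w \<in> dom (fi (ix (w 0)))"
          unfolding dom_def f by (auto split: if_splits)
        then have "tail w \<in> inputs (P (ix (w 0)))" using fi ixI by auto
        moreover have "w = to_nat (ix (w 0)) ## tail w" using w0 cons_tail[of w] by (auto simp: ix_def)
        ultimately show "w \<in> inputs (sup_problem I P)"
          using ixI[OF w0] by (auto simp: sup_problem_def)
      next
        assume "w \<in> inputs (sup_problem I P)"
        then obtain i u where w: "w = to_nat i ## u" "i \<in> I" "u \<in> inputs (P i)"
          by (auto simp: sup_problem_def)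
        then have "u \<in> dom (fi i)" using fi by simp
        then show "w \<in> dom ?f" unfolding dom_def f using w by (auto simp: ix_def)
      qed
      then show ?thesis by blast
    qed
    moreover have "the (?f w) \<in> outputs (sup_problem I P) w" if win: "w \<in> inputs (sup_problem I P)" for w
    proof -
      obtain i u where w: "w = to_nat i ## u" "i \<in> I" "u \<in> inputs (P i)"
        using win by (auto simp: sup_problem_def)
      then have "?f w = fi i u" unfolding f by (auto simp: ix_def)
      then show ?thesis using fi(2)[OF w(2,3)] w by (auto simp: sup_problem_def)
    qed
    ultimately show ?thesis by (simp add: choice_functions_def)
  qed
  ultimately show ?thesis unfolding reducible2_def by blast
qed

subsection \<open>Solving a problem with finitely many partial advices\<close>

text \<open>Robust division seen abstractly: \<open>s k\<close> plays the role of the quotient and \<open>U k\<close> that of the set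
  where the divisor is positive; elsewhere the answer is an arbitrary real.\<close>

definition answers ::
  "(nat \<Rightarrow> rat) \<Rightarrow> baire set \<Rightarrow> 'k set \<Rightarrow> ('k \<Rightarrow> baire set) \<Rightarrow> ('k \<Rightarrow> baire \<Rightarrow> real) \<Rightarrow> (baire \<times> ('k \<Rightarrow> baire)) set"
  where "answers \<nu> X K U s =
    {(w, d). w \<in> X \<and> (\<forall>k\<in>K. \<exists>q. rho_name \<nu> (d k) q \<and> (w \<in> U k \<longrightarrow> q = s k w))}"

text \<open>This is what robust division can evaluate: the relatively open \<open>U k\<close>
  becomes the positivity set of a divisor, and the bound by 1 keeps the numerator below the
  divisor.\<close>

definition advice :: "baire set \<Rightarrow> 'k set \<Rightarrow> ('k \<Rightarrow> baire set) \<Rightarrow> ('k \<Rightarrow> baire \<Rightarrow> real) \<Rightarrow> bool" where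
  "advice X K U s \<longleftrightarrow> (\<forall>k\<in>K. openin (top_of_set X) (U k) \<and> continuous_on (U k) (s k) \<and>
    s k ` U k \<subseteq> {0..1})"

text \<open>\<open>H\<close> reads the names of the answers and not their values, which permits case
  distinctions on a digit. Its continuity is also demanded where answers carry no
  information.\<close>

definition solves ::
  "(baire \<times> ('k \<Rightarrow> baire) \<Rightarrow> nat \<Rightarrow> real) \<Rightarrow> (baire \<times> ('k \<Rightarrow> baire)) set \<Rightarrow> (baire \<Rightarrow> (nat \<Rightarrow> real) set) \<Rightarrow> bool"
  where "solves H Y \<Phi> \<longleftrightarrow> (\<forall>c. continuous_on Y (\<lambda>p. H p c)) \<and> (\<forall>p\<in>Y. H p \<in> \<Phi> (fst p))"

definition solvable :: "(nat \<Rightarrow> rat) \<Rightarrow> baire set \<Rightarrow> (baire \<Rightarrow> (nat \<Rightarrow> real) set) \<Rightarrow> bool" where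
  "solvable \<nu> X \<Phi> \<longleftrightarrow> (\<exists>(z::nat) U s H. advice X {..<z} U s \<and> solves H (answers \<nu> X {..<z} U s) \<Phi>)"

lemma solvableI:
  fixes K :: "'k::countable set"
  assumes K: "finite K" and adv: "advice X K U s" and sol: "solves H (answers \<nu> X K U s) \<Phi>"
  shows "solvable \<nu> X \<Phi>"
proof -
  obtain z where z: "\<And>k. k \<in> K \<Longrightarrow> to_nat k < z"
    using finite_imageI[OF K, of to_nat] by (auto simp: finite_nat_set_iff_bounded)
  \<comment> \<open>Numbers that code no element of \<open>K\<close> get the empty set, so that any
    named real is a valid answer there.\<close>
  define U' where "U' n = (if n \<in> to_nat ` K then U (from_nat n) else {})" for n
  define s' where "s' n = s (from_nat n)" for n
  define T where "T p = (fst p, \<lambda>k::'k. snd p (to_nat k))" for p :: "baire \<times> (nat \<Rightarrow> baire)"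
  let ?Y = "answers \<nu> X {..<z} U' s'"
  have "advice X {..<z} U' s'"
    unfolding advice_def
  proof
    fix n assume "n \<in> {..<z}"
    show "openin (top_of_set X) (U' n) \<and> continuous_on (U' n) (s' n) \<and> s' n ` U' n \<subseteq> {0..1}"
    proof (cases "n \<in> to_nat ` K")
      case True
      then obtain k where "k \<in> K" "n = to_nat k" by blast
      then show ?thesis using adv by (simp add: advice_def U'_def s'_def)
    qed (simp add: U'_def)
  qed
  moreover have T: "T p \<in> answers \<nu> X K U s" if "p \<in> ?Y" for p
  proof -
    have "\<exists>q. rho_name \<nu> (snd p (to_nat k)) q \<and> (fst p \<in> U k \<longrightarrow> q = s k (fst p))" if k: "k \<in> K" for k
    proof -
      have "to_nat k < z" using z[OF k] .
      then have "\<exists>q. rho_name \<nu> (snd p (to_nat k)) q \<and> (fst p \<in> U' (to_nat k) \<longrightarrow> q = s' (to_nat k) (fst p))"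
        using \<open>p \<in> ?Y\<close> by (auto simp: answers_def)
      then show ?thesis using k by (simp add: U'_def s'_def)
    qed
    then show ?thesis using \<open>p \<in> ?Y\<close> by (auto simp: answers_def T_def)
  qed
  have contT: "continuous_on ?Y T"
    unfolding T_def
    by (intro continuous_on_Pair continuous_on_fst continuous_on_id,
        rule continuous_on_coordinatewise_then_product, rule continuous_on_apply)
       (intro continuous_on_snd continuous_on_id)
  have "solves (\<lambda>p. H (T p)) ?Y \<Phi>"
    unfolding solves_def
  proof (intro conjI allI ballI)
    fix c
    have c: "continuous_on (answers \<nu> X K U s) (\<lambda>p. H p c)" using sol by (simp add: solves_def)
    show "continuous_on ?Y (\<lambda>p. H (T p) c)"
      by (rule continuous_on_compose2[OF c contT]) (use T in auto)
  next
    fix p assume "p \<in> ?Y"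
    then have "H (T p) \<in> \<Phi> (fst (T p))" using sol T by (simp add: solves_def)
    then show "H (T p) \<in> \<Phi> (fst p)" by (simp add: T_def)
  qed
  ultimately show ?thesis unfolding solvable_def by blast
qed

section \<open>Turning advice into robust divisions\<close>

lemma ex_gauge:
  assumes "openin (top_of_set X) (U :: baire set)"
  shows "\<exists>y::baire \<Rightarrow> real. continuous_on X y \<and> (\<forall>w\<in>X. 0 \<le> y w) \<and> (\<forall>w\<in>X. 0 < y w \<longleftrightarrow> w \<in> U)"
proof -
  define inside where "inside w k \<longleftrightarrow> (\<forall>v\<in>X. agree k w v \<longrightarrow> v \<in> U)" for w k
  define len where "len w = (LEAST k. inside w k)" for w
  \<comment> \<open>The longer the prefix that certifies membership in \<open>U\<close>, the smaller
    the value. On that cylinder the value is constant, and points of \<open>U\<close> close to a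
    point outside \<open>U\<close> need long prefixes, which gives the limit 0 there.\<close>
  define y :: "baire \<Rightarrow> real" where "y w = (if w \<in> U then (1/2) ^ len w else 0)" for w
  obtain S where S: "open S" "U = X \<inter> S" using assms by (auto simp: openin_open)
  have len: "inside w (len w)" if "w \<in> U" for w
    unfolding len_def
  proof (rule LeastI_ex)
    show "\<exists>k. inside w k"
      using open_contains_agree[OF S(1), of w] that S(2) unfolding inside_def by blast
  qed
  have le: "len w \<le> k" if "inside w k" for w k unfolding len_def using that by (rule Least_le)
  have inside_agree: "inside w k \<longleftrightarrow> inside v k" if "agree k w v" for w v k
    unfolding inside_def using that agree_sym agree_trans by blast
  have const: "y v = y w" if w: "w \<in> U" and v: "v \<in> X" "agree (len w) w v" for w v
  proof -
    have vU: "v \<in> U" using len[OF w] v by (auto simp: inside_def)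
    have 1: "len v \<le> len w" using le len[OF w] inside_agree[OF v(2)] by blast
    then have "len w \<le> len v"
      using le len[OF vU] inside_agree[OF agree_mono[OF v(2) 1]] by blast
    with 1 show ?thesis using w vU by (simp add: y_def)
  qed
  have "continuous_on X y"
    unfolding continuous_on_agree_real
  proof (intro ballI allI impI)
    fix w and e :: real assume w: "w \<in> X" and e: "e > 0"
    show "\<exists>k. \<forall>v\<in>X. agree k w v \<longrightarrow> \<bar>y v - y w\<bar> < e"
    proof (cases "w \<in> U")
      case True
      then show ?thesis using const[OF True] e by (intro exI[of _ "len w"]) auto
    next
      case False
      obtain k where k: "(1/2::real) ^ k < e" using real_arch_pow_inv[of e "1/2"] e by auto
      have "\<bar>y v - y w\<bar> < e" if v: "v \<in> X" "agree k w v" for v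
      proof (cases "v \<in> U")
        case True
        have "\<not> len v \<le> k"
          using len[OF True] w False agree_sym[OF v(2)] agree_mono unfolding inside_def by blast
        then have "(1/2::real) ^ len v \<le> (1/2) ^ k" by (intro power_decreasing) auto
        then have "(1/2::real) ^ len v < e" using k by (rule le_less_trans)
        then show ?thesis using False True by (simp add: y_def)
      next
        case f: False
        then show ?thesis using False e by (simp add: y_def)
      qed
      then show ?thesis by blast
    qed
  qed
  moreover have "\<forall>w\<in>X. 0 \<le> y w" "\<forall>w\<in>X. 0 < y w \<longleftrightarrow> w \<in> U" by (auto simp: y_def)
  ultimately show ?thesis by blast
qed

text \<open>Take \<open>x = s * y\<close> for a gauge \<open>y\<close> of \<open>U\<close>. At the
  boundary of \<open>U\<close> the function \<open>s\<close> may oscillate, but \<open>x\<close> is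
  squeezed between 0 and \<open>y\<close>.\<close>

lemma ex_quotient:
  fixes s :: "baire \<Rightarrow> real"
  assumes U: "openin (top_of_set X) U" and s: "continuous_on U s" "s ` U \<subseteq> {0..1}"
  shows "\<exists>x y. continuous_on X x \<and> continuous_on X y \<and> (\<forall>w\<in>X. 0 \<le> x w \<and> x w \<le> y w) \<and>
    (\<forall>w\<in>U. 0 < y w \<and> x w / y w = s w)"
proof -
  obtain y :: "baire \<Rightarrow> real" where y: "continuous_on X y" "\<forall>w\<in>X. 0 \<le> y w" "\<forall>w\<in>X. 0 < y w \<longleftrightarrow> w \<in> U"
    using ex_gauge[OF U] by blast
  define x where "x w = (if w \<in> U then s w * y w else 0)" for w
  have UX: "U \<subseteq> X" using U by (rule openin_imp_subset)
  have s01: "0 \<le> s w" "s w \<le> 1" if "w \<in> U" for w using s(2) that by auto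
  have x: "0 \<le> x w \<and> x w \<le> y w" if "w \<in> X" for w
    using y(2) that s01[of w] mult_right_mono[of "s w" 1 "y w"] by (auto simp: x_def)
  have "continuous_on X x"
    unfolding continuous_on_def
  proof
    fix w assume w: "w \<in> X"
    show "(x \<longlongrightarrow> x w) (at w within X)"
    proof (cases "w \<in> U")
      case True
      have "continuous_on U (\<lambda>w. s w * y w)"
        by (intro continuous_on_mult s(1) continuous_on_subset[OF y(1) UX])
      then have "((\<lambda>w. s w * y w) \<longlongrightarrow> x w) (at w within U)"
        using True by (simp add: continuous_on_def x_def)
      moreover have "at w within X = at w within U"
      proof -
        obtain S where "open S" "U = X \<inter> S" using U by (auto simp: openin_open)
        then show ?thesis using True by (intro at_within_nhd[of w S]) auto
      qed
      moreover have "eventually (\<lambda>v. x v = s v * y v) (at w within U)"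
        by (auto simp: eventually_at_filter x_def)
      ultimately show ?thesis by (simp add: tendsto_cong)
    next
      case False
      then have "y w = 0" using y(2,3) w by (metis less_eq_real_def)
      then have "(y \<longlongrightarrow> 0) (at w within X)" using y(1) w by (metis continuous_on_def)
      moreover have "eventually (\<lambda>v. norm (x v) \<le> y v) (at w within X)"
        using x by (auto simp: eventually_at_filter)
      ultimately have "(x \<longlongrightarrow> 0) (at w within X)" using Lim_null_comparison by blast
      then show ?thesis using False by (simp add: x_def)
    qed
  qed
  moreover have "\<forall>w\<in>U. 0 < y w \<and> x w / y w = s w"
    using y(3) UX by (auto simp: x_def dest!: subsetD)
  ultimately show ?thesis using x y(1) by blast
qed

text \<open>The inner map forms all quotients from \<open>w\<close> at once; the outer map unpacks
  the answers, evaluates \<open>H\<close> and names its first \<open>N\<close> coordinates.\<close>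

lemma solvable_imp_reducible:
  assumes \<nu>: "surj \<nu>" and sol: "solvable \<nu> (inputs P) \<Phi>"
    and out: "\<And>w x v. w \<in> inputs P \<Longrightarrow> x \<in> \<Phi> w \<Longrightarrow> rho_names \<nu> v (map x [0..<N]) \<Longrightarrow> v \<in> outputs P w"
  shows "P \<le>\<^sub>2 sup_problem {1..} (\<lambda>z::nat. power_problem (rDiv \<nu>) z)"
proof -
  let ?Q = "sup_problem {1..} (\<lambda>z::nat. power_problem (rDiv \<nu>) z)" and ?X = "inputs P"
  obtain z :: nat and U s H where adv: "advice ?X {..<z} U s"
    and H: "solves H (answers \<nu> ?X {..<z} U s) \<Phi>"
    using sol unfolding solvable_def by blast
  have "\<exists>x y. continuous_on ?X x \<and> continuous_on ?X y \<and> (\<forall>w\<in>?X. 0 \<le> x w \<and> x w \<le> (y w::real)) \<and>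
    (k < z \<longrightarrow> (\<forall>w\<in>U k. 0 < y w \<and> x w / y w = s k w))" for k
  proof (cases "k < z")
    case True
    then show ?thesis using ex_quotient[of ?X "U k" "s k"] adv unfolding advice_def by auto
  next
    case False
    then show ?thesis
      by (intro exI[of _ "\<lambda>_. 0"]) auto
  qed
  then obtain x y where xy: "\<And>k. continuous_on ?X (x k)" "\<And>k. continuous_on ?X (y k)"
    "\<And>k w. w \<in> ?X \<Longrightarrow> 0 \<le> x k w \<and> x k w \<le> (y k w :: real)"
    "\<And>k w. k < z \<Longrightarrow> w \<in> U k \<Longrightarrow> 0 < y k w \<and> x k w / y k w = s k w"
    by metis
  obtain nx where nx: "\<And>k. continuous_on ?X (nx k)" "\<And>k w. w \<in> ?X \<Longrightarrow> rho_name \<nu> (nx k w) (x k w)"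
    using ex_realizer_baire[OF \<nu> xy(1)] by metis
  obtain ny where ny: "\<And>k. continuous_on ?X (ny k)" "\<And>k w. w \<in> ?X \<Longrightarrow> rho_name \<nu> (ny k w) (y k w)"
    using ex_realizer_baire[OF \<nu> xy(2)] by metis
  \<comment> \<open>One query more than \<open>z\<close>, because exponents start at 1 while
    \<open>z\<close> may be 0; the last query only pads the tuple.\<close>
  define q where "q w = map (\<lambda>k. bpair (nx k w) (ny k w)) [0..<Suc z]" for w
  define G where "G w = (if w \<in> ?X then Some (to_nat (Suc z) ## btuple (q w)) else None)" for w
  define T where "T p = (fst p, \<lambda>k. btuple_nth (Suc z) k (snd p))" for p :: "baire \<times> baire"
  \<comment> \<open>The pairs on which the unpacked tuple consists of admissible answers, which is
    where \<open>H\<close> is known to be continuous.\<close>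
  define S where "S = {p. T p \<in> answers \<nu> ?X {..<z} U s}"
  have contT: "continuous_on S T"
    unfolding T_def
    by (intro continuous_on_Pair continuous_on_fst continuous_on_id,
        rule continuous_on_coordinatewise_then_product)
       (intro continuous_on_btuple_nth continuous_on_snd continuous_on_id)
  have "continuous_on S (\<lambda>p. H (T p) c)" for c
  proof -
    have c: "continuous_on (answers \<nu> ?X {..<z} U s) (\<lambda>p. H p c)" using H by (simp add: solves_def)
    show ?thesis by (rule continuous_on_compose2[OF c contT]) (auto simp: S_def)
  qed
  then have "\<forall>c. \<exists>F. continuous_on S F \<and> (\<forall>p\<in>S. rho_name \<nu> (F p) (H (T p) c))"
    using ex_realizer_pair[OF \<nu>] by blast
  from choice[OF this] obtain R
    where R: "\<And>c. continuous_on S (R c)" "\<And>c p. p \<in> S \<Longrightarrow> rho_name \<nu> (R c p) (H (T p) c)"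
    by blast
  define F where "F p = (if p \<in> S then Some (btuple (map (\<lambda>c. R c p) [0..<N])) else None)" for p
  have domF: "dom F = S" and domG: "dom G = ?X" by (auto simp: F_def G_def dom_def)
  have "continuous_on S (\<lambda>p. btuple (map (\<lambda>f. f p) (map R [0..<N])))"
    by (rule continuous_on_btuple) (use R(1) in auto)
  then have "continuous_on S (\<lambda>p. btuple (map (\<lambda>c. R c p) [0..<N]))"
    by (simp add: comp_def)
  then have "continuous_partial F"
    unfolding continuous_partial_def domF by (rule continuous_on_eq) (simp add: F_def)
  moreover have "continuous_partial G"
  proof -
    have "continuous_on ?X (\<lambda>w. btuple (map (\<lambda>f. f w) (map (\<lambda>k w. bpair (nx k w) (ny k w)) [0..<Suc z])))"
      by (rule continuous_on_btuple) (use nx(1) ny(1) in \<open>auto intro!: continuous_on_bpair\<close>)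
    then have "continuous_on ?X (\<lambda>w. to_nat (Suc z) ## btuple (q w))"
      unfolding q_def by (intro continuous_on_bcons) (simp add: comp_def del: upt_Suc)
    then show ?thesis
      unfolding continuous_partial_def domG by (rule continuous_on_eq) (simp add: G_def)
  qed
  moreover have "(\<lambda>w. Option.bind (G w) (\<lambda>u. Option.bind (g u) (\<lambda>v. F (w, v)))) \<in> choice_functions P"
    (is "?f \<in> _") if g: "g \<in> choice_functions ?Q" for g
  proof -
    have main: "\<exists>v. ?f w = Some v \<and> v \<in> outputs P w" if w: "w \<in> ?X" for w
    proof -
      let ?u = "to_nat (Suc z) ## btuple (q w)"
      have lenq: "length (q w) = Suc z" by (simp add: q_def)
      have qk: "q w ! k = bpair (nx k w) (ny k w)" if "k < Suc z" for k
        using that unfolding q_def by (simp del: upt_Suc)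
      have "btuple (q w) \<in> inputs (power_problem (rDiv \<nu>) (Suc z))"
      proof (rule btuple_in_inputs_power[OF lenq])
        fix u assume "u \<in> set (q w)"
        then obtain k where "u = bpair (nx k w) (ny k w)" unfolding q_def by auto
        then show "u \<in> inputs (rDiv \<nu>)"
          using nx(2)[OF w] ny(2)[OF w] xy(3)[OF w] unfolding rDiv_def problem.simps by blast
      qed
      then have u: "?u \<in> inputs ?Q" unfolding sup_problem_def problem.simps by force
      have "dom g = inputs ?Q" "\<forall>u\<in>inputs ?Q. the (g u) \<in> outputs ?Q u"
        using g unfolding choice_functions_def by blast+
      then obtain v where v: "g ?u = Some v" "v \<in> outputs ?Q ?u"
        using u by (metis domD option.sel)
      then have "v \<in> outputs (power_problem (rDiv \<nu>) (Suc z)) (btuple (q w))"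
        unfolding sup_problem_def problem.simps by (auto simp: bcons_inject)
      then obtain vs where vs: "length vs = Suc z" "v = btuple vs"
        "\<forall>k<Suc z. vs ! k \<in> outputs (rDiv \<nu>) (q w ! k)"
        using outputs_power_btuple lenq by blast
      have "\<exists>r. rho_name \<nu> (btuple_nth (Suc z) k v) r \<and> (w \<in> U k \<longrightarrow> r = s k w)" if k: "k < z" for k
      proof -
        have "vs ! k \<in> outputs (rDiv \<nu>) (bpair (nx k w) (ny k w))" using vs(3) qk k by simp
        then obtain x' y' r where r: "rho_name \<nu> (nx k w) x'" "rho_name \<nu> (ny k w) y'"
          "rho_name \<nu> (vs ! k) r" "y' > 0 \<longrightarrow> r = x' / y'"
          by (auto simp: rDiv_def)
        \<comment> \<open>The oracle may justify its answer by some other reals, but a name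
          determines the real that it names.\<close>
        have "x' = x k w" "y' = y k w"
          using rho_name_unique[OF r(1) nx(2)[OF w]] rho_name_unique[OF r(2) ny(2)[OF w]] by auto
        moreover have "btuple_nth (Suc z) k v = vs ! k"
          using btuple_nth_btuple[of k vs] vs k by simp
        ultimately show ?thesis using r xy(4)[OF k] by (intro exI[of _ r]) auto
      qed
      then have S: "(w, v) \<in> S" using w by (simp add: S_def T_def answers_def)
      then have "H (T (w, v)) \<in> \<Phi> w" using H unfolding S_def solves_def by (auto simp: T_def)
      moreover have "rho_names \<nu> (btuple (map (\<lambda>c. R c (w, v)) [0..<N])) (map (H (T (w, v))) [0..<N])"
        unfolding rho_names_def using R(2)[OF S]
        by (intro exI[of _ "map (\<lambda>c. R c (w, v)) [0..<N]"]) (auto simp: list_all2_conv_all_nth)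
      ultimately have "btuple (map (\<lambda>c. R c (w, v)) [0..<N]) \<in> outputs P w" using out w by blast
      then show ?thesis using w v(1) S by (simp add: G_def F_def)
    qed
    have "dom ?f = ?X"
    proof
      show "dom ?f \<subseteq> ?X" by (auto simp: G_def dom_def split: if_splits)
      show "?X \<subseteq> dom ?f" using main by (auto simp: dom_def)
    qed
    moreover have "\<forall>w\<in>?X. the (?f w) \<in> outputs P w"
    proof
      fix w assume "w \<in> ?X"
      from main[OF this] obtain v where "?f w = Some v" "v \<in> outputs P w" by blast
      then show "the (?f w) \<in> outputs P w" by simp
    qed
    ultimately show ?thesis unfolding choice_functions_def by blast
  qed
  ultimately show ?thesis unfolding reducible2_def by blast
qed

subsection \<open>Retractions and closed covers\<close>

text \<open>Outside \<open>A\<close> the retraction and the number \<open>\<kappa>\<close>, one more than the length of the longest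
  common prefix with an element of \<open>A\<close>, are constant on cylinders.\<close>

lemma ex_retraction:
  fixes A X :: "baire set"
  assumes A: "closedin (top_of_set X) A" "A \<noteq> {}"
  obtains r \<kappa> where "continuous_on X r" "\<And>w. w \<in> X \<Longrightarrow> r w \<in> A" "\<And>a. a \<in> A \<Longrightarrow> r a = a"
    "\<And>w v. w \<in> X \<Longrightarrow> w \<notin> A \<Longrightarrow> v \<in> X \<Longrightarrow> agree (\<kappa> w) w v \<Longrightarrow> v \<notin> A \<and> r v = r w \<and> \<kappa> v = \<kappa> w"
    "\<And>w a K. w \<in> X \<Longrightarrow> a \<in> A \<Longrightarrow> agree K a w \<Longrightarrow> agree K a (r w)"
    "\<And>w a K. w \<in> X \<Longrightarrow> w \<notin> A \<Longrightarrow> a \<in> A \<Longrightarrow> agree K a w \<Longrightarrow> K < \<kappa> w"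
proof -
  define close where "close w K \<longleftrightarrow> (\<exists>a\<in>A. agree K w a)" for w K
  define \<kappa> where "\<kappa> w = (LEAST K. \<not> close w K)" for w
  \<comment> \<open>The choice mentions \<open>w\<close> only through its first
    \<open>\<kappa> w - 1\<close> digits. So all points of the cylinder of length
    \<open>\<kappa> w\<close> around \<open>w\<close> make the same choice.\<close>
  define r where "r w = (if w \<in> A then w else (SOME a. a \<in> A \<and> agree (\<kappa> w - 1) w a))" for w
  obtain C where C: "closed C" "A = X \<inter> C" using A(1) by (auto simp: closedin_closed)
  have mono: "close w j" if "close w k" "j \<le> k" for w j k
    using that agree_mono unfolding close_def by blast
  have far: "\<not> close w (\<kappa> w)" if "w \<in> X" "w \<notin> A" for w
    unfolding \<kappa>_def
  proof (rule LeastI_ex)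
    have "w \<in> - C" "open (- C)" using that C by auto
    then obtain k where "\<forall>v. agree k w v \<longrightarrow> v \<in> - C" using open_contains_agree by blast
    then show "\<exists>K. \<not> close w K" unfolding close_def using C(2) by blast
  qed
  have near: "close w k" if "k < \<kappa> w" for w k
    using not_less_Least[of k "\<lambda>K. \<not> close w K"] that by (simp add: \<kappa>_def)
  have lt: "K < \<kappa> w" if "w \<in> X" "w \<notin> A" "close w K" for w K
    using far[OF that(1,2)] mono[OF that(3), of "\<kappa> w"] by linarith
  have pos: "0 < \<kappa> w" if "w \<in> X" "w \<notin> A" for w
  proof -
    obtain a where "a \<in> A" using A(2) by blast
    then have "close w 0" by (auto simp: close_def agree_def)
    from lt[OF that this] show ?thesis .
  qed
  have r: "r w \<in> A \<and> agree (\<kappa> w - 1) w (r w)" if w: "w \<in> X" "w \<notin> A" for w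
  proof -
    have "close w (\<kappa> w - 1)" using near[of "\<kappa> w - 1" w] pos[OF w] by simp
    then have "\<exists>a. a \<in> A \<and> agree (\<kappa> w - 1) w a" by (auto simp: close_def)
    from someI_ex[OF this] show ?thesis using w(2) by (simp add: r_def)
  qed
  have rA: "r w \<in> A" if "w \<in> X" for w using r[OF that] by (cases "w \<in> A") (auto simp: r_def)
  have rid: "r a = a" if "a \<in> A" for a using that by (simp add: r_def)
  have less: "K < \<kappa> w" if "w \<in> X" "w \<notin> A" "a \<in> A" "agree K a w" for w a K
    using lt[OF that(1,2)] that(3) agree_sym[OF that(4)] by (auto simp: close_def)
  \<comment> \<open>Prefixes shared with points of \<open>A\<close> survive the retraction; this
    gives its continuity at points of \<open>A\<close>.\<close>
  have pref: "agree K a (r w)" if "w \<in> X" "a \<in> A" "agree K a w" for w a K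
  proof (cases "w \<in> A")
    case True
    then show ?thesis using that by (simp add: r_def)
  next
    case False
    have "K < \<kappa> w" by (rule less[OF that(1) False that(2,3)])
    then have "agree K w (r w)" using r[OF that(1) False] agree_mono[of "\<kappa> w - 1" w "r w" K] by simp
    then show ?thesis using that(3) agree_trans by blast
  qed
  have const: "v \<notin> A \<and> r v = r w \<and> \<kappa> v = \<kappa> w"
    if w: "w \<in> X" "w \<notin> A" and v: "v \<in> X" "agree (\<kappa> w) w v" for w v
  proof -
    have eq: "agree j w a \<longleftrightarrow> agree j v a" if "j \<le> \<kappa> w" for j a
      using agree_mono[OF v(2) that] agree_sym agree_trans by blast
    have ceq: "close w j \<longleftrightarrow> close v j" if "j \<le> \<kappa> w" for j
      using eq[OF that] by (simp add: close_def)
    have vA: "v \<notin> A" using far[OF w] v(2) by (auto simp: close_def)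
    have "\<not> close v (\<kappa> w)" using far[OF w] ceq by simp
    then have le: "\<kappa> v \<le> \<kappa> w" unfolding \<kappa>_def[of v] by (rule Least_le)
    moreover have "\<kappa> w \<le> \<kappa> v"
      using far[OF v(1) vA] ceq[OF le] unfolding \<kappa>_def[of w] by (intro Least_le) simp
    ultimately have "\<kappa> v = \<kappa> w" by simp
    moreover have "r v = r w" using vA w(2) eq[of "\<kappa> w - 1"] \<open>\<kappa> v = \<kappa> w\<close> by (simp add: r_def)
    ultimately show ?thesis using vA by blast
  qed
  have "continuous_on X r"
  proof (rule continuous_on_coordinatewise_then_product)
    fix i
    show "continuous_on X (\<lambda>w. r w i)"
      unfolding continuous_on_discrete
    proof
      fix w assume w: "w \<in> X"
      have "\<exists>k. \<forall>v\<in>X. agree k w v \<longrightarrow> r v i = r w i"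
      proof (cases "w \<in> A")
        case True
        have "r v i = r w i" if "v \<in> X" "agree (Suc i) w v" for v
          using pref[OF that(1) True that(2)] rid[OF True] by (simp add: agree_def)
        then show ?thesis by blast
      next
        case False
        then show ?thesis using const[OF w False] by (intro exI[of _ "\<kappa> w"]) simp
      qed
      then show "eventually (\<lambda>v. r v i = r w i) (at w within X)"
        unfolding eventually_at_agree[of w X "\<lambda>v. r v i = r w i", OF w refl] .
    qed
  qed
  then show ?thesis using that rA rid const pref less by blast
qed

lemma ex_continuous_retraction:
  fixes A X :: "baire set"
  assumes "closedin (top_of_set X) A" "A \<noteq> {}"
  shows "\<exists>r. continuous_on X r \<and> (\<forall>w\<in>X. r w \<in> A) \<and> (\<forall>a\<in>A. r a = a)"
  by (rule ex_retraction[OF assms]) blast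

lemma solvable_empty: "solvable \<nu> {} \<Phi>"
  unfolding solvable_def advice_def solves_def answers_def by (intro exI[of _ 0]) auto

text \<open>Queries have to be made on all of \<open>X\<close>. Those for a part \<open>A\<close>
  are pulled back along a map into \<open>A\<close>, in the applications a retraction.\<close>

lemma advice_retract:
  assumes "advice A K U s" "continuous_on X r" "\<And>w. w \<in> X \<Longrightarrow> r w \<in> A"
  shows "advice X K (\<lambda>k. {w \<in> X. r w \<in> U k}) (\<lambda>k w. s k (r w))"
  unfolding advice_def
proof (intro ballI conjI)
  fix k assume "k \<in> K"
  then have k: "openin (top_of_set A) (U k)" "continuous_on (U k) (s k)" "s k ` U k \<subseteq> {0..1}"
    using assms(1) by (auto simp: advice_def)
  obtain S where S: "open S" "U k = A \<inter> S" using k(1) by (auto simp: openin_open)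
  have "{w \<in> X. r w \<in> U k} = X \<inter> r -` S" using S(2) assms(3) by auto
  then show "openin (top_of_set X) {w \<in> X. r w \<in> U k}"
    using assms(2) S(1) by (simp add: continuous_openin_preimage_gen)
  show "continuous_on {w \<in> X. r w \<in> U k} (\<lambda>w. s k (r w))"
    by (rule continuous_on_compose2[OF k(2) continuous_on_subset[OF assms(2)]]) auto
  show "(\<lambda>w. s k (r w)) ` {w \<in> X. r w \<in> U k} \<subseteq> {0..1}" using k(3) by auto
qed

text \<open>\<open>f\<close> places the queries inside a larger index set, so that several solvers
  can share one round of answers. What is solved is the problem at \<open>r w\<close>, which is the
  wanted one only where \<open>r\<close> is the identity.\<close>

lemma solves_retract:
  assumes H: "solves H (answers \<nu> A {..<z} U s) \<Phi>"
    and r: "continuous_on X r" "\<And>w. w \<in> X \<Longrightarrow> r w \<in> A"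
    and K: "\<And>i. i < (z::nat) \<Longrightarrow> f i \<in> K \<and> U' (f i) = {w \<in> X. r w \<in> U i} \<and> s' (f i) = (\<lambda>w. s i (r w))"
  shows "solves (\<lambda>p. H (r (fst p), \<lambda>i. snd p (f i))) (answers \<nu> X K U' s') (\<lambda>w. \<Phi> (r w))"
proof -
  let ?Y = "answers \<nu> X K U' s'"
  define T where "T p = (r (fst p), \<lambda>i. snd p (f i))" for p :: "baire \<times> ('a \<Rightarrow> baire)"
  have X: "fst p \<in> X" if "p \<in> ?Y" for p using that by (auto simp: answers_def)
  have T: "T p \<in> answers \<nu> A {..<z} U s" if p: "p \<in> ?Y" for p
  proof -
    have q: "\<forall>k\<in>K. \<exists>q. rho_name \<nu> (snd p k) q \<and> (fst p \<in> U' k \<longrightarrow> q = s' k (fst p))"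
      using p by (auto simp: answers_def)
    have "\<exists>q. rho_name \<nu> (snd p (f i)) q \<and> (r (fst p) \<in> U i \<longrightarrow> q = s i (r (fst p)))" if "i < z" for i
      using q[rule_format, of "f i"] K[OF that] X[OF p] by auto
    then show ?thesis using r(2)[OF X[OF p]] by (auto simp: answers_def T_def)
  qed
  have "continuous_on ?Y (\<lambda>p. r (fst p))"
    by (rule continuous_on_compose2[OF r(1) continuous_on_fst[OF continuous_on_id]]) (use X in auto)
  moreover have "continuous_on ?Y (\<lambda>p i. snd p (f i))"
    by (rule continuous_on_coordinatewise_then_product, rule continuous_on_apply)
       (intro continuous_on_snd continuous_on_id)
  ultimately have contT: "continuous_on ?Y T" unfolding T_def by (rule continuous_on_Pair)
  have "continuous_on ?Y (\<lambda>p. H (T p) c)" for c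
  proof -
    have "continuous_on (answers \<nu> A {..<z} U s) (\<lambda>p. H p c)" using H by (simp add: solves_def)
    then show ?thesis by (rule continuous_on_compose2[OF _ contT]) (use T in auto)
  qed
  moreover have "H (T p) \<in> \<Phi> (r (fst p))" if "p \<in> ?Y" for p
    using H T[OF that] unfolding solves_def by (auto simp: T_def)
  ultimately show ?thesis unfolding solves_def by (simp add: T_def)
qed

text \<open>One bit of advice, \<open>0\<close> on \<open>A - B\<close> and \<open>1\<close> on \<open>B - A\<close>, decides which part to use; an arbitrary
  answer is harmless on \<open>A \<inter> B\<close>. The decision depends on the name of the answer.\<close>

lemma solvable_Un:
  assumes A: "closedin (top_of_set (A \<union> B)) A" and B: "closedin (top_of_set (A \<union> B)) B"
    and solA: "solvable \<nu> A \<Phi>" and solB: "solvable \<nu> B \<Phi>"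
  shows "solvable \<nu> (A \<union> B) \<Phi>"
proof (cases "A = {} \<or> B = {}")
  case True
  then show ?thesis using solA solB by auto
next
  case False
  let ?X = "A \<union> B"
  obtain ra where ra: "continuous_on ?X ra" "\<And>w. w \<in> ?X \<Longrightarrow> ra w \<in> A" "\<And>a. a \<in> A \<Longrightarrow> ra a = a"
    using ex_continuous_retraction[OF A] False by blast
  obtain rb where rb: "continuous_on ?X rb" "\<And>w. w \<in> ?X \<Longrightarrow> rb w \<in> B" "\<And>a. a \<in> B \<Longrightarrow> rb a = a"
    using ex_continuous_retraction[OF B] False by blast
  obtain za :: nat and Ua sa Ha where a: "advice A {..<za} Ua sa" "solves Ha (answers \<nu> A {..<za} Ua sa) \<Phi>"
    using solA unfolding solvable_def by blast
  obtain zb :: nat and Ub sb Hb where b: "advice B {..<zb} Ub sb" "solves Hb (answers \<nu> B {..<zb} Ub sb) \<Phi>"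
    using solB unfolding solvable_def by blast
  note adva = advice_retract[OF a(1) ra(1,2)] and advb = advice_retract[OF b(1) rb(1,2)]
  \<comment> \<open>\<open>None\<close> stands for the deciding bit. The queries of both solvers are
    asked in the same round, whichever of them is used in the end.\<close>
  define K where "K = Some ` (Inl ` {..<za} \<union> Inr ` {..<zb}) \<union> {None :: (nat + nat) option}"
  define U where "U k = (case k of None \<Rightarrow> ?X - A \<inter> B | Some (Inl i) \<Rightarrow> {w \<in> ?X. ra w \<in> Ua i}
    | Some (Inr i) \<Rightarrow> {w \<in> ?X. rb w \<in> Ub i})" for k :: "(nat + nat) option"
  define s where "s k w = (case k of None \<Rightarrow> if w \<in> A then 0 else 1 | Some (Inl i) \<Rightarrow> sa i (ra w)
    | Some (Inr i) \<Rightarrow> sb i (rb w))" for k :: "(nat + nat) option" and w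
  let ?Y = "answers \<nu> ?X K U s"
  \<comment> \<open>The digit with index 2 is within 1/4 of the answer, so the threshold 1/2
    separates a true 0 from a true 1.\<close>
  define bit where "bit p \<longleftrightarrow> (of_rat (\<nu> (snd p None 2)) :: real) \<le> 1/2" for p :: "baire \<times> ((nat + nat) option \<Rightarrow> baire)"
  define HA where "HA p = Ha (ra (fst p), \<lambda>i. snd p (Some (Inl i)))" for p :: "baire \<times> ((nat + nat) option \<Rightarrow> baire)"
  define HB where "HB p = Hb (rb (fst p), \<lambda>i. snd p (Some (Inr i)))" for p :: "baire \<times> ((nat + nat) option \<Rightarrow> baire)"
  define H where "H p = (if bit p then HA p else HB p)" for p
  have openAB: "openin (top_of_set ?X) (?X - A)" "openin (top_of_set ?X) (?X - B)"
    using openin_diff[OF openin_subtopology_self A] openin_diff[OF openin_subtopology_self B] by simp_all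
  \<comment> \<open>\<open>A - B\<close> and \<open>B - A\<close> are relatively open, so the bit is
    locally constant off the intersection.\<close>
  have contbit: "continuous_on (?X - A \<inter> B) (\<lambda>w. if w \<in> A then 0 else 1 :: real)"
    unfolding continuous_on_def
  proof
    fix w assume w: "w \<in> ?X - A \<inter> B"
    obtain SA where SA: "open SA" "?X - A = ?X \<inter> SA" using openAB(1) by (auto simp: openin_open)
    obtain SB where SB: "open SB" "?X - B = ?X \<inter> SB" using openAB(2) by (auto simp: openin_open)
    define S where "S = (if w \<in> A then SB else SA)"
    have S: "open S" using SA(1) SB(1) by (simp add: S_def)
    have wS: "w \<in> S" using SA(2) SB(2) w unfolding S_def by (cases "w \<in> A") (simp; blast)+
    have same: "v \<in> A \<longleftrightarrow> w \<in> A" if v: "v \<in> S" "v \<in> ?X - A \<inter> B" for v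
    proof (cases "w \<in> A")
      case True
      then have "v \<in> ?X - B" using v SB(2) by (simp add: S_def)
      then show ?thesis using True v(2) by blast
    next
      case False
      then have "v \<in> ?X - A" using v SA(2) by (simp add: S_def)
      then show ?thesis using False by blast
    qed
    have "v \<noteq> w \<longrightarrow> v \<in> ?X - A \<inter> B \<longrightarrow> (if v \<in> A then 0 else 1 :: real) = (if w \<in> A then 0 else 1)"
      if "v \<in> S" for v using same[of v] that by simp
    then have "eventually (\<lambda>v. (if v \<in> A then 0 else 1 :: real) = (if w \<in> A then 0 else 1)) (at w within ?X - A \<inter> B)"
      unfolding eventually_at_filter by (rule eventually_nhds_in_open[OF S wS, THEN eventually_mono])
    then show "((\<lambda>w. if w \<in> A then 0 else 1 :: real) \<longlongrightarrow> (if w \<in> A then 0 else 1)) (at w within ?X - A \<inter> B)"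
      by (rule tendsto_eventually)
  qed
  have "advice ?X K U s"
    unfolding advice_def
  proof
    fix k assume "k \<in> K"
    then consider "k = None" | i where "k = Some (Inl i)" "i < za" | i where "k = Some (Inr i)" "i < zb"
      by (auto simp: K_def)
    then show "openin (top_of_set ?X) (U k) \<and> continuous_on (U k) (s k) \<and> s k ` U k \<subseteq> {0..1}"
    proof cases
      case 1
      have "?X - A \<inter> B = (?X - A) \<union> (?X - B)" by blast
      then have "openin (top_of_set ?X) (?X - A \<inter> B)" using openAB openin_Un by metis
      then show ?thesis using contbit unfolding 1 U_def s_def by auto
    next
      case 2
      then show ?thesis using adva by (simp add: advice_def U_def s_def)
    next
      case 3
      then show ?thesis using advb by (simp add: advice_def U_def s_def)
    qed
  qed
  moreover have "finite K" by (simp add: K_def)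
  moreover have "solves H ?Y \<Phi>"
  proof -
    have HA: "solves HA ?Y (\<lambda>w. \<Phi> (ra w))"
      unfolding HA_def by (rule solves_retract[OF a(2) ra(1,2)]) (auto simp: K_def U_def s_def)
    have HB: "solves HB ?Y (\<lambda>w. \<Phi> (rb w))"
      unfolding HB_def by (rule solves_retract[OF b(2) rb(1,2)]) (auto simp: K_def U_def s_def)
    have contbit': "continuous_on ?Y bit"
    proof -
      have "continuous_on ?Y (\<lambda>p. snd p None 2)" by (rule continuous_on_apply, rule continuous_on_apply) (intro continuous_on_snd continuous_on_id)
      then show ?thesis unfolding continuous_on_discrete bit_def by (auto elim!: eventually_mono dest!: bspec)
    qed
    show ?thesis
      unfolding solves_def
    proof (intro conjI allI ballI)
      fix c
      have c: "continuous_on ?Y (\<lambda>p. HA p c)" "continuous_on ?Y (\<lambda>p. HB p c)"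
        using HA HB by (simp_all add: solves_def)
      show "continuous_on ?Y (\<lambda>p. H p c)"
      proof (rule continuous_on_fibres[OF contbit'])
        fix n
        show "continuous_on {p \<in> ?Y. bit p = n} (\<lambda>p. H p c)"
        proof (cases n)
          case True
          have "continuous_on {p \<in> ?Y. bit p = n} (\<lambda>p. HA p c)" by (rule continuous_on_subset[OF c(1)]) auto
          then show ?thesis by (rule continuous_on_eq) (use True in \<open>auto simp: H_def\<close>)
        next
          case False
          have "continuous_on {p \<in> ?Y. bit p = n} (\<lambda>p. HB p c)" by (rule continuous_on_subset[OF c(2)]) auto
          then show ?thesis by (rule continuous_on_eq) (use False in \<open>auto simp: H_def\<close>)
        qed
      qed
    next
      fix p assume p: "p \<in> ?Y"
      then have X: "fst p \<in> ?X" and "\<exists>q. rho_name \<nu> (snd p None) q \<and> (fst p \<in> U None \<longrightarrow> q = s None (fst p))"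
        by (auto simp: answers_def K_def)
      then obtain q where q: "rho_name \<nu> (snd p None) q" "fst p \<in> ?X - A \<inter> B \<longrightarrow> q = (if fst p \<in> A then 0 else 1)"
        by (auto simp: U_def s_def)
      from q(1)[unfolded rho_name_def, rule_format, of 2]
      have q4: "\<bar>of_rat (\<nu> (snd p None 2)) - q\<bar> \<le> 1/4" by (simp add: power2_eq_square)
      show "H p \<in> \<Phi> (fst p)"
      proof (cases "bit p")
        case True
        have "fst p \<in> A"
        proof (rule ccontr)
          assume n: "fst p \<notin> A"
          then have "q = 1" using q(2) X by auto
          then show False using q4 True unfolding bit_def by linarith
        qed
        then have "ra (fst p) = fst p" by (rule ra(3))
        then show ?thesis using HA p True unfolding solves_def H_def by fastforce
      next
        case False
        have "fst p \<in> B"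
        proof (rule ccontr)
          assume n: "fst p \<notin> B"
          then have "q = 0" using q(2) X by auto
          then show False using q4 False unfolding bit_def by linarith
        qed
        then have "rb (fst p) = fst p" by (rule rb(3))
        then show ?thesis using HB p False unfolding solves_def H_def by fastforce
      qed
    qed
  qed
  ultimately show ?thesis using solvableI by blast
qed

lemma solvable_UN:
  assumes "finite K" "\<And>k. k \<in> K \<Longrightarrow> closedin (top_of_set X) (A k)" "\<And>k. k \<in> K \<Longrightarrow> solvable \<nu> (A k) \<Phi>"
  shows "solvable \<nu> (\<Union>k\<in>K. A k) \<Phi>"
  using assms
proof (induction K rule: finite_induct)
  case empty
  then show ?case by (simp add: solvable_empty)
next
  case (insert k K)
  let ?B = "\<Union>k\<in>K. A k"
  have A: "closedin (top_of_set X) (A k)" using insert.prems by simp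
  have B: "closedin (top_of_set X) ?B"
    using insert.prems insert.hyps(1) by (intro closedin_Union) auto
  have sub: "A k \<union> ?B \<subseteq> X" using closedin_imp_subset[OF A] closedin_imp_subset[OF B] by simp
  have "solvable \<nu> (A k \<union> ?B) \<Phi>"
  proof (rule solvable_Un)
    show "closedin (top_of_set (A k \<union> ?B)) (A k)" by (rule closedin_subset_trans[OF A _ sub]) simp
    show "closedin (top_of_set (A k \<union> ?B)) ?B" by (rule closedin_subset_trans[OF B _ sub]) simp
  qed (use insert in auto)
  then show ?case by simp
qed

section \<open>Compactness of the countable cube and Brouwer's theorem\<close>

lemma compact_unit_cube: "compact (\<Pi>\<^sub>E i\<in>(UNIV :: nat set). {0..1::real})"
proof -
  have "compactin (product_topology (\<lambda>i::nat. euclidean) UNIV) (\<Pi>\<^sub>E i\<in>(UNIV :: nat set). {0..1::real})"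
    by (subst compactin_PiE) auto
  then show ?thesis by (simp add: euclidean_product_topology)
qed

text \<open>Tychonoff, together with the first countability of countable products. A single
  subsequence serves all coordinates, however many are in use.\<close>

lemma cube_subsequence:
  fixes f :: "nat \<Rightarrow> nat \<Rightarrow> real"
  assumes "\<And>k i. 0 \<le> f k i \<and> f k i \<le> 1"
  shows "\<exists>l r. strict_mono (r :: nat \<Rightarrow> nat) \<and> (\<forall>i. 0 \<le> l i \<and> l i \<le> 1) \<and>
    (\<forall>i. (\<lambda>k. f (r k) i) \<longlonglongrightarrow> l i)"
proof -
  let ?C = "\<Pi>\<^sub>E i\<in>(UNIV :: nat set). {0..1::real}"
  have "seq_compact ?C" using compact_unit_cube by (rule compact_imp_seq_compact)
  moreover have "\<forall>k. f k \<in> ?C" using assms by auto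
  ultimately obtain l r where lr: "l \<in> ?C" "strict_mono (r :: nat \<Rightarrow> nat)" "(f \<circ> r) \<longlonglongrightarrow> l"
    by (rule seq_compactE)
  have "(\<lambda>k. f (r k) i) \<longlonglongrightarrow> l i" for i
  proof -
    have "continuous_on UNIV (\<lambda>x::nat \<Rightarrow> real. x i)" by simp
    then have "isCont (\<lambda>x::nat \<Rightarrow> real. x i) l"
      unfolding continuous_on_eq_continuous_at[OF open_UNIV] by blast
    from isCont_tendsto_compose[OF this lr(3)] show ?thesis by simp
  qed
  then show ?thesis using lr(1,2) by (intro exI[of _ l] exI[of _ r]) auto
qed

text \<open>The library has Brouwer's theorem only for Euclidean spaces whose dimension is part of the type,
  whereas the size of a game is a variable.\<close>

lemma brouwer_cube_nat:
  fixes f :: "(nat \<Rightarrow> real) \<Rightarrow> nat \<Rightarrow> real"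
  assumes rng: "\<And>z i. \<forall>j<n. 0 \<le> z j \<and> z j \<le> 1 \<Longrightarrow> i < n \<Longrightarrow> 0 \<le> f z i \<and> f z i \<le> 1"
    and cont: "\<And>u z i. \<forall>j<n. (\<lambda>k. u k j) \<longlonglongrightarrow> z j \<Longrightarrow> i < n \<Longrightarrow> (\<lambda>k. f (u k) i) \<longlonglongrightarrow> f z i"
  shows "\<exists>z. (\<forall>j<n. 0 \<le> z j \<and> z j \<le> 1) \<and> (\<forall>i<n. f z i = z i)"
proof -
  define sc where "sc p x j = real (x j) / real p" for p :: nat and x :: "nat \<Rightarrow> nat" and j :: nat
  \<comment> \<open>Label 0 says that \<open>f\<close> does not decrease the coordinate. The upper
    face is given label 1, as Kuhn's lemma demands; the lower face has label 0 because
    \<open>f\<close> maps into the cube.\<close>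
  define lab where "lab p x i = (if x i \<noteq> p \<and> sc p x i \<le> f (sc p x) i then 0 else 1::nat)" for p x i
  have "\<exists>q. (\<forall>i<n. q i < Suc p) \<and> (\<forall>i<n. \<exists>r s. (\<forall>j<n. q j \<le> r j \<and> r j \<le> q j + 1) \<and>
      (\<forall>j<n. q j \<le> s j \<and> s j \<le> q j + 1) \<and> lab (Suc p) r i \<noteq> lab (Suc p) s i)" for p
  proof (rule kuhn_lemma[of "Suc p" n "lab (Suc p)"])
    show "\<forall>x. (\<forall>i<n. x i \<le> Suc p) \<longrightarrow> (\<forall>i<n. x i = 0 \<longrightarrow> lab (Suc p) x i = 0)"
    proof (intro allI impI)
      fix x i assume x: "\<forall>i<n. x i \<le> Suc p" and i: "i < n" "x i = 0"
      have "\<forall>j<n. 0 \<le> sc (Suc p) x j \<and> sc (Suc p) x j \<le> 1"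
        using x by (auto simp: sc_def)
      from rng[OF this i(1)] have "0 \<le> f (sc (Suc p) x) i" by blast
      moreover have "sc (Suc p) x i = 0" using i(2) by (simp add: sc_def)
      ultimately show "lab (Suc p) x i = 0" using i(2) by (simp add: lab_def)
    qed
  next
    fix q assume "\<forall>i<n. q i < Suc p" "\<forall>i<n. \<exists>r s. (\<forall>j<n. q j \<le> r j \<and> r j \<le> q j + 1) \<and>
      (\<forall>j<n. q j \<le> s j \<and> s j \<le> q j + 1) \<and> lab (Suc p) r i \<noteq> lab (Suc p) s i"
    then show ?thesis by blast
  qed (auto simp: lab_def)
  then have "\<forall>p. \<exists>q. (\<forall>i<n. q i < Suc p) \<and> (\<forall>i<n. \<exists>r s. (\<forall>j<n. q j \<le> r j \<and> r j \<le> q j + 1) \<and>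
      (\<forall>j<n. q j \<le> s j \<and> s j \<le> q j + 1) \<and> lab (Suc p) r i \<noteq> lab (Suc p) s i)"
    by (rule allI)
  from choice[OF this] obtain q where qq: "\<forall>p. (\<forall>i<n. q p i < Suc p) \<and>
      (\<forall>i<n. \<exists>r s. (\<forall>j<n. q p j \<le> r j \<and> r j \<le> q p j + 1) \<and>
      (\<forall>j<n. q p j \<le> s j \<and> s j \<le> q p j + 1) \<and> lab (Suc p) r i \<noteq> lab (Suc p) s i)" ..
  have q: "q p i < Suc p" if "i < n" for p i using spec[OF qq, of p] that by blast
  have qrs: "\<exists>r s. (\<forall>j<n. q p j \<le> r j \<and> r j \<le> q p j + 1) \<and>
      (\<forall>j<n. q p j \<le> s j \<and> s j \<le> q p j + 1) \<and> lab (Suc p) r i \<noteq> lab (Suc p) s i"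
    if "i < n" for p i using conjunct2[OF spec[OF qq, of p]] that by blast
  define nb where "nb p r \<longleftrightarrow> (\<forall>j<n. q p j \<le> r j \<and> r j \<le> q p j + 1)" for p and r :: "nat \<Rightarrow> nat"
  have ex_rs: "\<exists>r s. nb p r \<and> nb p s \<and> lab (Suc p) r i = 0 \<and> lab (Suc p) s i = 1"
    if i: "i < n" for p i
  proof -
    obtain r s where rs: "nb p r" "nb p s" "lab (Suc p) r i \<noteq> lab (Suc p) s i"
      using qrs[OF i, of p] unfolding nb_def by blast
    show ?thesis
    proof (cases "lab (Suc p) r i = 0")
      case True
      then have "lab (Suc p) s i = 1" using rs(3) by (simp add: lab_def split: if_splits)
      then show ?thesis using rs True by blast
    next
      case False
      then have "lab (Suc p) r i = 1" "lab (Suc p) s i = 0"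
        using rs(3) by (simp_all add: lab_def split: if_splits)
      then show ?thesis using rs by blast
    qed
  qed
  \<comment> \<open>Coordinates from \<open>n\<close> on are set to 0, which puts the corners of the
    Kuhn cells into the countable cube.\<close>
  define g where "g p i = (if i < n then sc (Suc p) (q p) i else 0)" for p i
  have "0 \<le> g p i \<and> g p i \<le> 1" for p i
    using q[of i p] by (auto simp: g_def sc_def)
  from cube_subsequence[of g, OF this] obtain z t
    where zt: "strict_mono (t :: nat \<Rightarrow> nat)" "\<forall>i. 0 \<le> z i \<and> z i \<le> 1" "\<forall>i. (\<lambda>k. g (t k) i) \<longlonglongrightarrow> z i"
    by blast
  have null: "(\<lambda>k. 1 / real (Suc (t k))) \<longlonglongrightarrow> 0"
    using LIMSEQ_subseq_LIMSEQ[OF LIMSEQ_inverse_real_of_nat zt(1)] by (simp add: comp_def inverse_eq_divide)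
  \<comment> \<open>The mesh \<open>1 / real (Suc (t k))\<close> tends to 0, so all vertices of the
    cells have the same limit. Vertices with label 0 and with label 1 then give the two inequalities
    for the fixed point.\<close>
  have near: "(\<lambda>k. sc (Suc (t k)) (x k) j) \<longlonglongrightarrow> z j"
    if x: "\<And>k. q (t k) j \<le> x k j \<and> x k j \<le> q (t k) j + 1" and j: "j < n"
    for x :: "nat \<Rightarrow> nat \<Rightarrow> nat" and j
  proof (rule tendsto_sandwich)
    show "(\<lambda>k. g (t k) j) \<longlonglongrightarrow> z j" using zt(3) by blast
    show "(\<lambda>k. g (t k) j + 1 / real (Suc (t k))) \<longlonglongrightarrow> z j"
      using tendsto_add[OF spec[OF zt(3)] null, of j] by simp
    show "\<forall>\<^sub>F k in sequentially. g (t k) j \<le> sc (Suc (t k)) (x k) j"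
      using x j by (auto simp: g_def sc_def divide_right_mono)
    have "sc (Suc (t k)) (x k) j \<le> g (t k) j + 1 / real (Suc (t k))" for k
    proof -
      have "real (x k j) / real (Suc (t k)) \<le> (real (q (t k) j) + 1) / real (Suc (t k))"
        using x[of k] by (intro divide_right_mono) linarith+
      then show ?thesis using j by (simp add: g_def sc_def add_divide_distrib)
    qed
    then show "\<forall>\<^sub>F k in sequentially. sc (Suc (t k)) (x k) j \<le> g (t k) j + 1 / real (Suc (t k))"
      by simp
  qed
  have "f z i = z i" if i: "i < n" for i
  proof (rule antisym)
    have "\<forall>p. \<exists>r s. nb p r \<and> nb p s \<and> lab (Suc p) r i = 0 \<and> lab (Suc p) s i = 1"
      using ex_rs[OF i] by blast
    then obtain R S where RS: "\<And>p. nb p (R p)" "\<And>p. nb p (S p)"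
      "\<And>p. lab (Suc p) (R p) i = 0" "\<And>p. lab (Suc p) (S p) i = 1"
      by metis
    have R: "\<forall>j<n. (\<lambda>k. sc (Suc (t k)) (R (t k)) j) \<longlonglongrightarrow> z j"
      using near[of _ "\<lambda>k. R (t k)"] RS(1) unfolding nb_def by blast
    have "sc (Suc (t k)) (R (t k)) i \<le> f (sc (Suc (t k)) (R (t k))) i" for k
      using RS(3)[of "t k"] by (auto simp: lab_def split: if_splits)
    then show "z i \<le> f z i"
      using LIMSEQ_le[OF R[rule_format, OF i] cont[OF R i]] by blast
    have S: "\<forall>j<n. (\<lambda>k. sc (Suc (t k)) (S (t k)) j) \<longlonglongrightarrow> z j"
      using near[of _ "\<lambda>k. S (t k)"] RS(2) unfolding nb_def by blast
    have "f (sc (Suc (t k)) (S (t k))) i \<le> sc (Suc (t k)) (S (t k)) i" for k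
    proof (cases "S (t k) i = Suc (t k)")
      \<comment> \<open>Here label 1 was forced by the face and says nothing about \<open>f\<close>,
        but \<open>f\<close> is at most 1 anyway.\<close>
      case True
      have "real (S (t k) j) \<le> 1 + real (t k)" if "j < n" for j
        using RS(2)[of "t k"] q[OF that, of "t k"] that unfolding nb_def by fastforce
      then have "\<forall>j<n. 0 \<le> sc (Suc (t k)) (S (t k)) j \<and> sc (Suc (t k)) (S (t k)) j \<le> 1"
        by (auto simp: sc_def)
      from rng[OF this i] have "f (sc (Suc (t k)) (S (t k))) i \<le> 1" by blast
      moreover have "sc (Suc (t k)) (S (t k)) i = 1" using True by (simp add: sc_def)
      ultimately show ?thesis by simp
    next
      case False
      then show ?thesis using RS(4)[of "t k"] by (auto simp: lab_def split: if_splits)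
    qed
    then show "f z i \<le> z i"
      using LIMSEQ_le[OF cont[OF S i] S[rule_format, OF i]] by blast
  qed
  then show ?thesis using zt(2) by blast
qed

subsection \<open>Equilibria of bi-matrix games\<close>

text \<open>A continuous map of the cube onto the simplex: missing mass is shared equally, excess
  mass is scaled away. It transfers the fixed point theorem from the cube to the simplices.\<close>

definition simplex_retract :: "nat \<Rightarrow> (nat \<Rightarrow> real) \<Rightarrow> nat \<Rightarrow> real" where
  "simplex_retract n p i = (p i + max 0 (1 - (\<Sum>j<n. p j)) / real n) / max 1 (\<Sum>j<n. p j)"

lemma simplex_retract:
  assumes "n \<ge> 1" "\<And>i. i < n \<Longrightarrow> 0 \<le> p i"
  shows "i < n \<Longrightarrow> 0 \<le> simplex_retract n p i" "(\<Sum>i<n. simplex_retract n p i) = 1"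
proof -
  show "i < n \<Longrightarrow> 0 \<le> simplex_retract n p i"
    using assms(2)[of i] unfolding simplex_retract_def by (intro divide_nonneg_nonneg add_nonneg_nonneg) auto
  have "(\<Sum>i<n. simplex_retract n p i) =
      ((\<Sum>j<n. p j) + max 0 (1 - (\<Sum>j<n. p j))) / max 1 (\<Sum>j<n. p j)"
    using assms(1) by (simp add: simplex_retract_def sum.distrib flip: sum_divide_distrib)
  also have "\<dots> = 1" by (auto simp: max_def)
  finally show "(\<Sum>i<n. simplex_retract n p i) = 1" .
qed

lemma simplex_retract_id: "(\<Sum>j<n. p j) = 1 \<Longrightarrow> simplex_retract n p i = p i"
  by (simp add: simplex_retract_def)

lemma tendsto_simplex_retract:
  assumes "\<And>j. j < n \<Longrightarrow> ((\<lambda>k. u k j) \<longlongrightarrow> z j) F" "i < n"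
  shows "((\<lambda>k. simplex_retract n (u k) i) \<longlongrightarrow> simplex_retract n z i) F"
  unfolding simplex_retract_def
  by (intro tendsto_divide tendsto_add tendsto_max tendsto_diff tendsto_sum tendsto_const assms) (use assms in auto)

text \<open>Nash's map for one player, with \<open>u\<close> the payoffs of the pure strategies: the
  gain of each over the current mean is added to its weight, then the weights are
  renormalised.\<close>

definition nash_map :: "nat \<Rightarrow> (nat \<Rightarrow> real) \<Rightarrow> (nat \<Rightarrow> real) \<Rightarrow> nat \<Rightarrow> real" where
  "nash_map n x u i =
    (x i + max 0 (u i - (\<Sum>k<n. x k * u k))) / (1 + (\<Sum>l<n. max 0 (u l - (\<Sum>k<n. x k * u k))))"

lemma nash_map:
  assumes "\<And>i. i < n \<Longrightarrow> 0 \<le> x i" "(\<Sum>i<n. x i) = 1"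
  shows "i < n \<Longrightarrow> 0 \<le> nash_map n x u i" "(\<Sum>i<n. nash_map n x u i) = 1"
proof -
  have pos: "1 + (\<Sum>l<n. max 0 (u l - (\<Sum>k<n. x k * u k))) > 0"
    by (intro add_pos_nonneg sum_nonneg) auto
  show "i < n \<Longrightarrow> 0 \<le> nash_map n x u i"
    using assms(1)[of i] unfolding nash_map_def by (intro divide_nonneg_pos[OF _ pos]) simp
  show "(\<Sum>i<n. nash_map n x u i) = 1"
    unfolding nash_map_def using assms(2) pos
    by (simp add: sum.distrib flip: sum_divide_distrib)
qed

lemma tendsto_nash_map:
  assumes "\<And>j. j < n \<Longrightarrow> ((\<lambda>k. x k j) \<longlongrightarrow> x' j) F" "\<And>j. j < n \<Longrightarrow> ((\<lambda>k. u k j) \<longlongrightarrow> u' j) F" "i < n"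
  shows "((\<lambda>k. nash_map n (x k) (u k) i) \<longlongrightarrow> nash_map n x' u' i) F"
proof -
  have "1 + (\<Sum>l<n. max 0 (u' l - (\<Sum>k<n. x' k * u' k))) > 0"
    by (intro add_pos_nonneg sum_nonneg) auto
  then show ?thesis
    unfolding nash_map_def
    by (intro tendsto_divide tendsto_add tendsto_max tendsto_diff tendsto_sum tendsto_mult tendsto_const assms)
       (use assms in auto)
qed

text \<open>The deviations from the mean average to 0 under \<open>x\<close>, so some strategy in
  use gains nothing. The fixed point equation there forces the total gain to be 0; hence no strategy
  beats the mean, and those in use must attain it.\<close>

lemma nash_map_fixed_point:
  assumes x: "\<And>i. i < n \<Longrightarrow> 0 \<le> x i" "(\<Sum>i<n. x i) = 1"
    and fp: "\<And>i. i < n \<Longrightarrow> nash_map n x u i = x i"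
    and i: "i < n" "x i > 0" and k: "k < n"
  shows "u k \<le> u i"
proof -
  define m where "m = (\<Sum>k<n. x k * u k)"
  define g where "g i = max 0 (u i - m)" for i
  define G where "G = (\<Sum>l<n. g l)"
  have G0: "0 \<le> G" unfolding G_def g_def by (intro sum_nonneg) auto
  have xG: "x l * G = g l" if "l < n" for l
  proof -
    have "(x l + g l) / (1 + G) = x l"
      using fp[OF that] by (simp add: nash_map_def m_def g_def G_def)
    then have "x l + g l = x l * (1 + G)" using G0 by (simp add: field_simps)
    then show ?thesis by (simp add: algebra_simps)
  qed
  have dev: "(\<Sum>l<n. x l * (u l - m)) = 0"
  proof -
    have "(\<Sum>l<n. x l * (u l - m)) = (\<Sum>l<n. x l * u l) - (\<Sum>l<n. x l) * m"
      by (simp add: right_diff_distrib sum_subtractf sum_distrib_right)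
    then show ?thesis using x(2) by (simp add: m_def)
  qed
  have "\<exists>l<n. x l > 0 \<and> u l \<le> m"
  proof (rule ccontr)
    assume no: "\<not> (\<exists>l<n. x l > 0 \<and> u l \<le> m)"
    have "0 < (\<Sum>l<n. x l * (u l - m))"
    proof (rule sum_pos2[of _ i])
      show "0 < x i * (u i - m)" using i no by force
      show "0 \<le> x l * (u l - m)" if "l \<in> {..<n}" for l
        using no x(1)[of l] that by (cases "x l = 0") force+
    qed (use i in auto)
    with dev show False by simp
  qed
  then obtain l where "l < n" "x l > 0" "u l \<le> m" by blast
  then have "G = 0" using xG[of l] by (simp add: g_def)
  then have "g l = 0" if "l < n" for l using xG[OF that] by simp
  then have le: "u l \<le> m" if "l < n" for l
    using \<open>\<And>l. l < n \<Longrightarrow> g l = 0\<close>[OF that] by (simp add: g_def max_def split: if_splits)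
  have "(\<Sum>l<n. x l * (m - u l)) = 0"
    using dev by (simp add: algebra_simps sum_subtractf)
  moreover have "\<And>l. l \<in> {..<n} \<Longrightarrow> 0 \<le> x l * (m - u l)" using x(1) le by simp
  ultimately have "x i * (m - u i) = 0" using i(1) by (subst (asm) sum_nonneg_eq_0_iff) auto
  then show ?thesis using i(2) le[OF k] by simp
qed

lemma ex_equilibrium:
  fixes a b :: "nat \<Rightarrow> nat \<Rightarrow> real"
  assumes n: "n \<ge> 1" and m: "m \<ge> 1"
  shows "\<exists>x y. (\<forall>i<n. 0 \<le> x i) \<and> (\<Sum>i<n. x i) = 1 \<and> (\<forall>j<m. 0 \<le> y j) \<and> (\<Sum>j<m. y j) = 1 \<and>
    (\<forall>i<n. 0 < x i \<longrightarrow> (\<forall>k<n. (\<Sum>j<m. a k j * y j) \<le> (\<Sum>j<m. a i j * y j))) \<and>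
    (\<forall>j<m. 0 < y j \<longrightarrow> (\<forall>k<m. (\<Sum>i<n. b i k * x i) \<le> (\<Sum>i<n. b i j * x i)))"
proof -
  define X where "X z = simplex_retract n z" for z
  define Y where "Y z = simplex_retract m (\<lambda>j. z (n + j))" for z :: "nat \<Rightarrow> real"
  define U where "U z k = (\<Sum>j<m. a k j * Y z j)" for z k
  define W where "W z k = (\<Sum>i<n. b i k * X z i)" for z k
  define f where "f z i = (if i < n then nash_map n (X z) (U z) i else nash_map m (Y z) (W z) (i - n))"
    for z i
  have XY: "\<And>i. i < n \<Longrightarrow> 0 \<le> X z i" "(\<Sum>i<n. X z i) = 1" "\<And>j. j < m \<Longrightarrow> 0 \<le> Y z j" "(\<Sum>j<m. Y z j) = 1"
    if "\<forall>j<n + m. 0 \<le> z j \<and> z j \<le> 1" for z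
    unfolding X_def Y_def using that n m by (intro simplex_retract; simp)+
  have le1: "t i \<le> 1" if "\<And>i. i < k \<Longrightarrow> 0 \<le> t i" "(\<Sum>i<k. t i) = 1" "i < k" for t :: "nat \<Rightarrow> real" and i k
    using member_le_sum[of i "{..<k}" t] that by auto
  have "\<exists>z. (\<forall>j<n + m. 0 \<le> z j \<and> z j \<le> 1) \<and> (\<forall>i<n + m. f z i = z i)"
  proof (rule brouwer_cube_nat)
    fix z :: "nat \<Rightarrow> real" and i
    assume z: "\<forall>j<n + m. 0 \<le> z j \<and> z j \<le> 1" and i: "i < n + m"
    note xy = XY[OF z]
    note N1 = nash_map[of n "X z", OF xy(1,2)] and N2 = nash_map[of m "Y z", OF xy(3,4)]
    show "0 \<le> f z i \<and> f z i \<le> 1"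
      unfolding f_def using i N1(1) N2(1) le1[OF N1] le1[OF N2] by auto
  next
    fix u :: "nat \<Rightarrow> nat \<Rightarrow> real" and z i
    assume u: "\<forall>j<n + m. (\<lambda>k. u k j) \<longlonglongrightarrow> z j" and i: "i < n + m"
    have X: "(\<lambda>k. X (u k) j) \<longlonglongrightarrow> X z j" if "j < n" for j
      unfolding X_def by (rule tendsto_simplex_retract) (use u that in auto)
    have Y: "(\<lambda>k. Y (u k) j) \<longlonglongrightarrow> Y z j" if "j < m" for j
      unfolding Y_def by (rule tendsto_simplex_retract) (use u that in auto)
    have U: "(\<lambda>k. U (u k) j) \<longlonglongrightarrow> U z j" for j
      unfolding U_def by (intro tendsto_sum tendsto_mult tendsto_const Y) auto
    have W: "(\<lambda>k. W (u k) j) \<longlonglongrightarrow> W z j" for j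
      unfolding W_def by (intro tendsto_sum tendsto_mult tendsto_const X) auto
    show "(\<lambda>k. f (u k) i) \<longlonglongrightarrow> f z i"
    proof (cases "i < n")
      case True
      then show ?thesis using tendsto_nash_map[OF X U True] by (simp add: f_def)
    next
      case False
      then have "i - n < m" using i by simp
      from tendsto_nash_map[OF Y W this] show ?thesis using False by (simp add: f_def)
    qed
  qed
  then obtain z where z: "\<forall>j<n + m. 0 \<le> z j \<and> z j \<le> 1" "\<And>i. i < n + m \<Longrightarrow> f z i = z i" by blast
  note xy = XY[OF z(1)]
  note N1 = nash_map[of n "X z", OF xy(1,2)] and N2 = nash_map[of m "Y z", OF xy(3,4)]
  have fx: "nash_map n (X z) (U z) i = z i" if "i < n" for i using z(2)[of i] that by (simp add: f_def)
  have fy: "nash_map m (Y z) (W z) j = z (n + j)" if "j < m" for j using z(2)[of "n + j"] that by (simp add: f_def)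
  \<comment> \<open>The retractions do not move a fixed point, since its coordinates are values of
    \<open>nash_map\<close> and these sum to 1.\<close>
  have "(\<Sum>i<n. z i) = 1" using N1(2)[of "U z"] fx by simp
  then have X: "X z i = z i" for i unfolding X_def by (rule simplex_retract_id)
  have "(\<Sum>j<m. z (n + j)) = 1" using N2(2)[of "W z"] fy by simp
  then have Y: "Y z j = z (n + j)" for j unfolding Y_def by (rule simplex_retract_id)
  have fX: "nash_map n (X z) (U z) i = X z i" if "i < n" for i
    using that by (rule trans[OF fx X[symmetric]])
  have fY: "nash_map m (Y z) (W z) j = Y z j" if "j < m" for j
    using that by (rule trans[OF fy Y[symmetric]])
  have 1: "\<forall>i<n. 0 < X z i \<longrightarrow> (\<forall>k<n. U z k \<le> U z i)"
    using nash_map_fixed_point[OF xy(1,2) fX] by blast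
  have 2: "\<forall>j<m. 0 < Y z j \<longrightarrow> (\<forall>k<m. W z k \<le> W z j)"
    using nash_map_fixed_point[OF xy(3,4) fY] by blast
  show ?thesis
    by (intro exI[of _ "X z"] exI[of _ "Y z"] conjI 1[unfolded U_def] 2[unfolded W_def])
       (simp_all add: xy)
qed

subsection \<open>Convex hulls of finite families\<close>

text \<open>The generators form an indexed family, so that the index set stays fixed while they move
  and possibly collide.\<close>

definition fhull :: "'i set \<Rightarrow> ('i \<Rightarrow> nat \<Rightarrow> real) \<Rightarrow> (nat \<Rightarrow> real) set" where
  "fhull I V = {z. \<exists>l. (\<forall>i\<in>I. 0 \<le> l i) \<and> sum l I = 1 \<and> z = (\<lambda>c. \<Sum>i\<in>I. l i * V i c)}"

lemma fhull_reindex: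
  assumes "inj_on f I"
  shows "fhull (f ` I) V = fhull I (\<lambda>i. V (f i))"
proof (intro equalityI subsetI)
  fix z assume "z \<in> fhull (f ` I) V"
  then obtain l where "\<forall>i\<in>f ` I. 0 \<le> l i" "sum l (f ` I) = 1" "z = (\<lambda>c. \<Sum>i\<in>f ` I. l i * V i c)"
    by (auto simp: fhull_def)
  then show "z \<in> fhull I (\<lambda>i. V (f i))"
    unfolding fhull_def using assms
    by (intro CollectI exI[of _ "\<lambda>i. l (f i)"]) (auto simp: sum.reindex comp_def)
next
  fix z assume "z \<in> fhull I (\<lambda>i. V (f i))"
  then obtain l where l: "\<forall>i\<in>I. 0 \<le> l i" "sum l I = 1" "z = (\<lambda>c. \<Sum>i\<in>I. l i * V (f i) c)"
    by (auto simp: fhull_def)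
  then show "z \<in> fhull (f ` I) V"
    unfolding fhull_def using assms
    by (intro CollectI exI[of _ "\<lambda>k. l (inv_into I f k)"])
       (auto simp: sum.reindex comp_def inv_into_f_f intro!: sum.cong)
qed

lemma fhull_vertex:
  assumes "finite I" "i \<in> I"
  shows "V i \<in> fhull I V"
  unfolding fhull_def using assms
  by (intro CollectI exI[of _ "\<lambda>j. if j = i then 1 else 0"])
     (auto simp: if_distrib[of "\<lambda>x. x * _"] cong: if_cong)

lemma fhull_subset:
  assumes I: "finite I" and W: "\<And>k. k \<in> K \<Longrightarrow> W k \<in> fhull I V"
  shows "fhull K W \<subseteq> fhull I V"
proof
  fix z assume "z \<in> fhull K W"
  then obtain l where l: "\<forall>k\<in>K. 0 \<le> l k" "sum l K = 1" "z = (\<lambda>c. \<Sum>k\<in>K. l k * W k c)"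
    by (auto simp: fhull_def)
  have "\<forall>k\<in>K. \<exists>m. (\<forall>i\<in>I. 0 \<le> m i) \<and> sum m I = 1 \<and> W k = (\<lambda>c. \<Sum>i\<in>I. m i * V i c)"
    using W by (auto simp: fhull_def)
  then obtain m where m: "\<And>k i. k \<in> K \<Longrightarrow> i \<in> I \<Longrightarrow> 0 \<le> m k i" "\<And>k. k \<in> K \<Longrightarrow> sum (m k) I = 1"
    "\<And>k. k \<in> K \<Longrightarrow> W k = (\<lambda>c. \<Sum>i\<in>I. m k i * V i c)"
    by metis
  define n where "n i = (\<Sum>k\<in>K. l k * m k i)" for i
  have "\<forall>i\<in>I. 0 \<le> n i" unfolding n_def using l(1) m(1) by (auto intro!: sum_nonneg)
  moreover have "sum n I = (\<Sum>k\<in>K. l k * sum (m k) I)"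
    unfolding n_def by (subst sum.swap) (simp add: sum_distrib_left)
  then have "sum n I = 1" using m(2) l(2) by simp
  moreover have "z c = (\<Sum>i\<in>I. n i * V i c)" for c
  proof -
    have "z c = (\<Sum>k\<in>K. l k * (\<Sum>i\<in>I. m k i * V i c))" using l(3) m(3) by simp
    also have "\<dots> = (\<Sum>i\<in>I. n i * V i c)"
      unfolding n_def sum_distrib_left sum_distrib_right by (subst sum.swap) (simp add: mult.assoc)
    finally show ?thesis .
  qed
  ultimately show "z \<in> fhull I V" unfolding fhull_def by blast
qed

text \<open>The generators of the intersection with the half-space \<open>h \<le> 0\<close>: crossing points of segments,
  where \<open>h i\<close> is the value at the \<open>i\<close>-th generator and \<open>i0\<close> serves as a placeholder for pairs
  that do not contribute.\<close>

definition cut :: "('i \<Rightarrow> real) \<Rightarrow> 'i \<Rightarrow> ('i \<Rightarrow> real) \<Rightarrow> 'i \<times> 'i \<Rightarrow> real" where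
  "cut h i0 \<phi> = (\<lambda>(i, j). if 0 < h i then \<phi> i0 else if h j \<le> 0 then \<phi> i
     else (h j * \<phi> i - h i * \<phi> j) / (h j - h i))"

text \<open>A transport plan. The outer weights are balanced against inner ones so as to land on the
  hyperplane, which uses up the fraction \<open>p / n\<close> of the inner weights; the rest stays
  in place. The weights do not depend on \<open>\<phi>\<close>, so they serve all coordinates and
  the constant 1 alike.\<close>

lemma cut_weights:
  assumes I: "finite I" and l: "\<And>i. i \<in> I \<Longrightarrow> 0 \<le> l i" and h: "(\<Sum>i\<in>I. l i * h i) \<le> (0::real)"
  shows "\<exists>m. (\<forall>k\<in>I \<times> I. 0 \<le> m k) \<and>
    (\<forall>\<phi>. (\<Sum>k\<in>I \<times> I. m k * cut h i0 \<phi> k) = (\<Sum>i\<in>I. l i * \<phi> i))"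
proof -
  define A where "A = {i \<in> I. h i \<le> 0}"
  define B where "B = {i \<in> I. 0 < h i}"
  have AB: "I = A \<union> B" "A \<inter> B = {}" "finite A" "finite B" using I by (auto simp: A_def B_def)
  define n where "n = (\<Sum>i\<in>A. l i * - h i)"
  define p where "p = (\<Sum>j\<in>B. l j * h j)"
  have n0: "0 \<le> n" unfolding n_def using l by (intro sum_nonneg mult_nonneg_nonneg) (auto simp: A_def)
  have p0: "0 \<le> p" unfolding p_def using l by (intro sum_nonneg mult_nonneg_nonneg) (auto simp: B_def)
  have "(\<Sum>i\<in>I. l i * h i) = p - n"
    unfolding AB(1) p_def n_def using AB by (simp add: sum.union_disjoint sum_negf)
  with h have pn: "p \<le> n" by simp
  \<comment> \<open>The factor \<open>h j - h i\<close> cancels the denominator in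
    \<open>cut\<close>. A pair of inner generators yields the first of them, and the diagonal pair
    carries what remains in place.\<close>
  define m where "m = (\<lambda>(i, j). if 0 < h i then 0 else if 0 < h j then l i * l j * (h j - h i) / n
    else if j = i then (1 - p / n) * l i else 0)"
  have "0 \<le> m k" if k: "k \<in> I \<times> I" for k
  proof -
    have "p / n \<le> 1" using pn n0 by (auto simp: divide_le_eq_1)
    then show ?thesis using k l n0 by (auto simp: m_def intro!: divide_nonneg_nonneg mult_nonneg_nonneg)
  qed
  moreover have "(\<Sum>k\<in>I \<times> I. m k * cut h i0 \<phi> k) = (\<Sum>i\<in>I. l i * \<phi> i)" for \<phi>
  proof -
    have row: "(\<Sum>j\<in>I. m (i, j) * cut h i0 \<phi> (i, j)) =
        (\<Sum>j\<in>B. l j * h j) * (l i * \<phi> i) / n + (l i * - h i) * (\<Sum>j\<in>B. l j * \<phi> j) / n + (1 - p / n) * l i * \<phi> i"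
      if i: "i \<in> A" for i
    proof -
      have hi: "h i \<le> 0" "i \<in> I" using i by (auto simp: A_def)
      have b: "m (i, j) * cut h i0 \<phi> (i, j) =
          (l j * h j) * (l i * \<phi> i) / n + (l i * - h i) * (l j * \<phi> j) / n" if j: "j \<in> B" for j
      proof -
        have "h j - h i \<noteq> 0" "0 < h j" using hi j by (auto simp: B_def)
        then have "m (i, j) * cut h i0 \<phi> (i, j) = l i * l j * (h j * \<phi> i - h i * \<phi> j) / n"
          using hi by (simp add: m_def cut_def)
        then show ?thesis by (simp add: algebra_simps diff_divide_distrib)
      qed
      have a: "m (i, j) * cut h i0 \<phi> (i, j) = (if j = i then (1 - p / n) * l i * \<phi> i else 0)" if j: "j \<in> A" for j
        using hi j by (auto simp: m_def cut_def A_def)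
      have "(\<Sum>j\<in>I. m (i, j) * cut h i0 \<phi> (i, j)) =
          (\<Sum>j\<in>A. if j = i then (1 - p / n) * l i * \<phi> i else 0) +
          (\<Sum>j\<in>B. (l j * h j) * (l i * \<phi> i) / n + (l i * - h i) * (l j * \<phi> j) / n)"
        unfolding AB(1) using AB(2-4) a b by (simp add: sum.union_disjoint)
      then show ?thesis
        using i AB(3) by (simp add: sum_subtractf sum_negf sum_distrib_left sum_distrib_right sum_divide_distrib)
    qed
    have zero: "(\<Sum>j\<in>I. m (i, j) * cut h i0 \<phi> (i, j)) = 0" if "i \<in> B" for i
      using that by (simp add: m_def B_def)
    have "(\<Sum>k\<in>I \<times> I. m k * cut h i0 \<phi> k) = (\<Sum>i\<in>I. \<Sum>j\<in>I. m (i, j) * cut h i0 \<phi> (i, j))"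
      by (simp add: sum.cartesian_product)
    also have "\<dots> = (\<Sum>i\<in>A. \<Sum>j\<in>I. m (i, j) * cut h i0 \<phi> (i, j))"
    proof -
      have "(\<Sum>i\<in>A \<union> B. \<Sum>j\<in>I. m (i, j) * cut h i0 \<phi> (i, j)) =
          (\<Sum>i\<in>A. \<Sum>j\<in>I. m (i, j) * cut h i0 \<phi> (i, j)) + (\<Sum>i\<in>B. \<Sum>j\<in>I. m (i, j) * cut h i0 \<phi> (i, j))"
        using AB(2-4) by (simp add: sum.union_disjoint)
      then show ?thesis using zero AB(1) by simp
    qed
    also have "\<dots> = (\<Sum>i\<in>A. p / n * (l i * \<phi> i) + (l i * - h i) * ((\<Sum>j\<in>B. l j * \<phi> j) / n) + (1 - p / n) * (l i * \<phi> i))"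
      by (intro sum.cong refl) (simp add: row p_def)
    also have "\<dots> = p / n * (\<Sum>i\<in>A. l i * \<phi> i) + n * ((\<Sum>j\<in>B. l j * \<phi> j) / n) + (1 - p / n) * (\<Sum>i\<in>A. l i * \<phi> i)"
      unfolding n_def by (simp only: sum.distrib sum_distrib_left sum_distrib_right)
    \<comment> \<open>For \<open>n = 0\<close> the division makes the left side 0. Then
      \<open>p\<close> is 0 as well, so the outer generators have no weight and the right side
      vanishes, too.\<close>
    also have "n * ((\<Sum>j\<in>B. l j * \<phi> j) / n) = (\<Sum>j\<in>B. l j * \<phi> j)"
    proof (cases "n = 0")
      case True
      then have "p = 0" using pn p0 by simp
      moreover have "\<And>j. j \<in> B \<Longrightarrow> 0 \<le> l j * h j" using l by (simp add: B_def)
      ultimately have "\<forall>j\<in>B. l j * h j = 0" unfolding p_def using AB(4) by (subst (asm) sum_nonneg_eq_0_iff) auto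
      then have "\<forall>j\<in>B. l j = 0" by (auto simp: B_def)
      then show ?thesis by simp
    qed simp
    also have "p / n * (\<Sum>i\<in>A. l i * \<phi> i) + (\<Sum>j\<in>B. l j * \<phi> j) + (1 - p / n) * (\<Sum>i\<in>A. l i * \<phi> i) =
        (\<Sum>i\<in>A. l i * \<phi> i) + (\<Sum>j\<in>B. l j * \<phi> j)"
      by (simp add: left_diff_distrib)
    also have "\<dots> = (\<Sum>i\<in>I. l i * \<phi> i)"
      unfolding AB(1) using AB(2-4) by (simp add: sum.union_disjoint)
    finally show ?thesis .
  qed
  ultimately show ?thesis by blast
qed

definition lin :: "nat \<Rightarrow> (nat \<Rightarrow> real) \<Rightarrow> (nat \<Rightarrow> real) \<Rightarrow> real" where
  "lin N a z = (\<Sum>c<N. a c * z c)"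

lemma lin_sum: "lin N a (\<lambda>c. \<Sum>i\<in>I. l i * V i c) = (\<Sum>i\<in>I. l i * lin N a (V i))"
  unfolding lin_def sum_distrib_left by (subst sum.swap) (simp add: mult_ac)

lemma fhull_halfspace:
  assumes I: "finite I" and i0: "i0 \<in> I" "lin N a (V i0) \<le> 0"
  shows "fhull (I \<times> I) (\<lambda>k c. cut (\<lambda>i. lin N a (V i)) i0 (\<lambda>i. V i c) k) = {z \<in> fhull I V. lin N a z \<le> 0}"
    (is "fhull _ ?W = _")
proof (intro equalityI subsetI)
  let ?h = "\<lambda>i. lin N a (V i)"
  have W: "?W k \<in> fhull I V \<and> lin N a (?W k) \<le> 0" if k: "k \<in> I \<times> I" for k
  proof -
    obtain i j where ij: "k = (i, j)" "i \<in> I" "j \<in> I" using k by auto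
    consider "0 < ?h i" | "?h i \<le> 0" "?h j \<le> 0" | "?h i \<le> 0" "0 < ?h j" by linarith
    then show ?thesis
    proof cases
      case 1
      then have "?W k = V i0" by (simp add: ij(1) cut_def)
      then show ?thesis using fhull_vertex[OF I i0(1)] i0(2) by simp
    next
      case 2
      then have "?W k = V i" by (simp add: ij(1) cut_def)
      then show ?thesis using fhull_vertex[OF I ij(2)] 2 by simp
    next
      case 3
      define t where "t = ?h j / (?h j - ?h i)"
      have d: "?h j - ?h i > 0" using 3 by simp
      have t: "0 \<le> t" "0 \<le> 1 - t" and t1: "1 - t = - ?h i / (?h j - ?h i)" using 3 d by (auto simp: t_def field_simps)
      have ne: "i \<noteq> j" using 3 by auto
      define l where "l x = (if x = i then t else 1 - t)" for x
      have "?W k = (\<lambda>c. \<Sum>x\<in>{i, j}. l x * V x c)"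
        using 3 ne t1 by (auto simp: ij(1) cut_def l_def t_def diff_divide_distrib)
      moreover have "(\<lambda>c. \<Sum>x\<in>{i, j}. l x * V x c) \<in> fhull {i, j} V"
        unfolding fhull_def using t ne by (intro CollectI exI[of _ l]) (auto simp: l_def)
      moreover have "fhull {i, j} V \<subseteq> fhull I V"
        by (rule fhull_subset[OF I]) (use fhull_vertex[OF I] ij in auto)
      moreover have "lin N a (\<lambda>c. \<Sum>x\<in>{i, j}. l x * V x c) = 0"
        unfolding lin_sum using ne t1 by (simp add: l_def t_def)
      ultimately show ?thesis by auto
    qed
  qed
  fix z
  { assume z: "z \<in> fhull (I \<times> I) ?W"
    have zI: "z \<in> fhull I V" using fhull_subset[OF I, of "I \<times> I" ?W V] W z by blast
    obtain m where m: "\<forall>k\<in>I \<times> I. 0 \<le> m k" "z = (\<lambda>c. \<Sum>k\<in>I \<times> I. m k * ?W k c)"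
      using z unfolding fhull_def by blast
    have "lin N a z = (\<Sum>k\<in>I \<times> I. m k * lin N a (?W k))" unfolding m(2) by (rule lin_sum)
    also have "\<dots> \<le> 0" using m(1) W by (intro sum_nonpos mult_nonneg_nonpos) auto
    finally have "lin N a z \<le> 0" .
    with zI show "z \<in> {z \<in> fhull I V. lin N a z \<le> 0}" by simp }
  { assume "z \<in> {z \<in> fhull I V. lin N a z \<le> 0}"
    then obtain l where l: "\<forall>i\<in>I. 0 \<le> l i" "sum l I = 1" "z = (\<lambda>c. \<Sum>i\<in>I. l i * V i c)" and "lin N a z \<le> 0"
      by (auto simp: fhull_def)
    then have "(\<Sum>i\<in>I. l i * ?h i) \<le> 0" by (simp add: lin_sum)
    from cut_weights[OF I _ this] l(1) obtain m where m: "\<forall>k\<in>I \<times> I. 0 \<le> m k"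
      "\<And>\<phi>. (\<Sum>k\<in>I \<times> I. m k * cut ?h i0 \<phi> k) = (\<Sum>i\<in>I. l i * \<phi> i)" by metis
    \<comment> \<open>For \<open>\<phi>\<close> constantly 1 the identity says that the new weights
      sum to 1.\<close>
    have "cut ?h i0 (\<lambda>_. 1) k = 1" for k by (auto simp: cut_def split: prod.split)
    then have "sum m (I \<times> I) = 1" using m(2)[of "\<lambda>_. 1"] l(2) by simp
    then show "z \<in> fhull (I \<times> I) ?W"
      unfolding fhull_def l(3) using m by (intro CollectI exI[of _ m]) auto }
qed

subsection \<open>Stratified families of polytopes\<close>

text \<open>The condition on \<open>lev\<close> says that the sets \<open>lev \<le> l\<close> are closed.\<close>

definition stratification ::
  "'a::topological_space set \<Rightarrow> ('a \<Rightarrow> (nat \<Rightarrow> real) set) \<Rightarrow> nat set \<Rightarrow> nat \<Rightarrow> ('a \<Rightarrow> nat) \<Rightarrow>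
    ('a \<Rightarrow> nat \<Rightarrow> nat \<Rightarrow> real) \<Rightarrow> bool" where
  "stratification X P I D lev V \<longleftrightarrow> finite I \<and> (\<forall>w\<in>X. lev w \<le> D) \<and>
    (\<forall>w\<in>X. eventually (\<lambda>v. lev w \<le> lev v) (at w within X)) \<and>
    (\<forall>i\<in>I. \<forall>c l. continuous_on {w \<in> X. lev w = l} (\<lambda>w. V w i c)) \<and>
    (\<forall>w\<in>X. P w = fhull I (V w))"

definition stratified :: "'a::topological_space set \<Rightarrow> ('a \<Rightarrow> (nat \<Rightarrow> real) set) \<Rightarrow> bool" where
  "stratified X P \<longleftrightarrow> (\<exists>I D lev V. stratification X P I D lev V)"

lemma eventually_at_within_imp:
  "eventually P (at w within {v \<in> X. Q v}) \<longleftrightarrow> eventually (\<lambda>v. Q v \<longrightarrow> P v) (at w within X)"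
  unfolding eventually_at_filter by (simp add: imp_conjL)

text \<open>The new strata record how many of the old generators avoid the hyperplane.\<close>

lemma stratified_halfspace:
  assumes st: "stratified X P" and a: "\<And>c. continuous_on X (\<lambda>w. a w c)"
    and ne: "\<And>w. w \<in> X \<Longrightarrow> {z \<in> P w. lin N (a w) z \<le> 0} \<noteq> {}"
  shows "stratified X (\<lambda>w. {z \<in> P w. lin N (a w) z \<le> 0})"
proof -
  obtain I D lev V where st': "stratification X P I D lev V"
    using st unfolding stratified_def by blast
  have I: "finite I" and D: "\<And>w. w \<in> X \<Longrightarrow> lev w \<le> (D::nat)"
    and lev: "\<And>w. w \<in> X \<Longrightarrow> eventually (\<lambda>v. lev w \<le> lev v) (at w within X)"
    and V: "\<And>i c l. i \<in> I \<Longrightarrow> continuous_on {w \<in> X. lev w = l} (\<lambda>w. V w i c)"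
    and P: "\<And>w. w \<in> X \<Longrightarrow> P w = fhull I (V w)"
    using st' by (simp_all add: stratification_def)
  define h where "h w i = lin N (a w) (V w i)" for w i
  define nz where "nz w = {i \<in> I. h w i \<noteq> 0}" for w
  \<comment> \<open>The old level and the count are digits in base \<open>Suc (card I)\<close>, with
    the old level as the leading one.\<close>
  define lev' where "lev' w = lev w * Suc (card I) + card (nz w)" for w
  \<comment> \<open>The least index depends on the signs alone, so the placeholder is locally
    constant on a new stratum.\<close>
  define base where "base w = (LEAST i. i \<in> I \<and> h w i \<le> 0)" for w
  define V' where "V' w k = (\<lambda>c. cut (h w) (base w) (\<lambda>i. V w i c) (prod_decode k))" for w k
  let ?I' = "prod_encode ` (I \<times> I)"
  have cnt: "card (nz w) < Suc (card I)" for w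
    using I card_mono[of I "nz w"] by (auto simp: nz_def)
  have lev'_div: "lev' w div Suc (card I) = lev w" and lev'_mod: "lev' w mod Suc (card I) = card (nz w)" for w
    using cnt[of w] unfolding lev'_def by (metis div_mult_self3 div_less add.commute add_0 nat.simps(3), metis mod_mult_self3 mod_less)
  have h: "continuous_on {w \<in> X. lev w = l} (\<lambda>w. h w i)" if "i \<in> I" for i l
    unfolding h_def lin_def
    by (intro continuous_on_sum continuous_on_mult V that continuous_on_subset[OF a]) auto
  \<comment> \<open>If all \<open>h w i\<close> were positive, the half-space would miss the hull,
    against \<open>ne\<close>.\<close>
  have base: "base w \<in> I" "h w (base w) \<le> 0" if w: "w \<in> X" for w
  proof -
    have "\<exists>i\<in>I. h w i \<le> 0"
    proof (rule ccontr)
      assume "\<not> ?thesis"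
      then have pos: "\<forall>i\<in>I. 0 < h w i" by force
      obtain z where z: "z \<in> fhull I (V w)" "lin N (a w) z \<le> 0" using ne[OF w] P[OF w] by auto
      then obtain l where l: "\<forall>i\<in>I. 0 \<le> l i" "sum l I = 1" "z = (\<lambda>c. \<Sum>i\<in>I. l i * V w i c)"
        by (auto simp: fhull_def)
      have le: "(\<Sum>i\<in>I. l i * h w i) \<le> 0" using z(2) l(3) by (simp add: lin_sum h_def)
      have nn: "\<And>i. i \<in> I \<Longrightarrow> 0 \<le> l i * h w i" using l(1) pos by (simp add: less_imp_le)
      then have "(\<Sum>i\<in>I. l i * h w i) = 0" using le sum_nonneg[of I "\<lambda>i. l i * h w i"] by force
      then have "\<forall>i\<in>I. l i * h w i = 0" using nn I by (subst (asm) sum_nonneg_eq_0_iff) auto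
      then have "\<forall>i\<in>I. l i = 0" using pos by force
      then show False using l(2) by simp
    qed
    then have "base w \<in> I \<and> h w (base w) \<le> 0"
      unfolding base_def by (metis (mono_tags, lifting) LeastI)
    then show "base w \<in> I" "h w (base w) \<le> 0" by simp_all
  qed
  have lim: "((\<lambda>v. h v i) \<longlongrightarrow> h w i) (at w within {v \<in> X. lev v = lev w})"
    if "w \<in> X" "i \<in> I" for w i
    using h[OF that(2)] that(1) by (auto simp: continuous_on_def)
  \<comment> \<open>Strict signs persist nearby within an old stratum, so nonzero values cannot be
    lost there; this makes the refined level lower semicontinuous.\<close>
  have sign: "eventually (\<lambda>v. lev v = lev w \<longrightarrow> (\<forall>i\<in>I. (0 < h w i \<longrightarrow> 0 < h v i) \<and> (h w i < 0 \<longrightarrow> h v i < 0))) (at w within X)"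
    if w: "w \<in> X" for w
  proof -
    have "eventually (\<lambda>v. lev v = lev w \<longrightarrow> ((0 < h w i \<longrightarrow> 0 < h v i) \<and> (h w i < 0 \<longrightarrow> h v i < 0))) (at w within X)"
      if i: "i \<in> I" for i
    proof -
      consider "h w i > 0" | "h w i < 0" | "h w i = 0" by linarith
      then show ?thesis
      proof cases
        case 1
        have "eventually (\<lambda>v. lev v = lev w \<longrightarrow> h v i > 0) (at w within X)"
          using order_tendstoD(1)[OF lim[OF w i] 1] by (simp add: eventually_at_within_imp)
        then show ?thesis by (rule eventually_mono) (use 1 in auto)
      next
        case 2
        have "eventually (\<lambda>v. lev v = lev w \<longrightarrow> h v i < 0) (at w within X)"
          using order_tendstoD(2)[OF lim[OF w i] 2] by (simp add: eventually_at_within_imp)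
        then show ?thesis by (rule eventually_mono) (use 2 in auto)
      qed simp
    qed
    then have "eventually (\<lambda>v. \<forall>i\<in>I. lev v = lev w \<longrightarrow> ((0 < h w i \<longrightarrow> 0 < h v i) \<and> (h w i < 0 \<longrightarrow> h v i < 0))) (at w within X)"
      by (intro eventually_ball_finite[OF I]) blast
    then show ?thesis by (rule eventually_mono) blast
  qed
  have nz_sub: "nz w \<subseteq> nz v" if "\<forall>i\<in>I. (0 < h w i \<longrightarrow> 0 < h v i) \<and> (h w i < 0 \<longrightarrow> h v i < 0)" for w v
    using that by (fastforce simp: nz_def)
  have fin_nz: "finite (nz w)" for w using I by (simp add: nz_def)
  have "eventually (\<lambda>v. lev' w \<le> lev' v) (at w within X)" if w: "w \<in> X" for w
    using lev[OF w] sign[OF w]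
  proof eventually_elim
    case (elim v)
    show ?case
    proof (cases "lev v = lev w")
      case True
      then have "card (nz w) \<le> card (nz v)" using elim(2) nz_sub fin_nz by (intro card_mono) auto
      then show ?thesis using True by (simp add: lev'_def)
    next
      \<comment> \<open>A strictly larger old level outweighs any loss in the count.\<close>
      case False
      then have "Suc (lev w) * Suc (card I) \<le> lev v * Suc (card I)" using elim(1) by (intro mult_right_mono) auto
      then show ?thesis using cnt[of w] unfolding lev'_def by simp
    qed
  qed
  moreover have "lev' w \<le> D * Suc (card I) + card I" if "w \<in> X" for w
    unfolding lev'_def using D[OF that] cnt[of w] by (intro add_mono mult_right_mono) auto
  moreover have "{z \<in> P w. lin N (a w) z \<le> 0} = fhull ?I' (V' w)" if w: "w \<in> X" for w
  proof -
    have "fhull (I \<times> I) (\<lambda>k c. cut (h w) (base w) (\<lambda>i. V w i c) k) = {z \<in> fhull I (V w). lin N (a w) z \<le> 0}"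
      using fhull_halfspace[OF I, of "base w" N "a w" "V w"] base[OF w] unfolding h_def[abs_def] by simp
    moreover have "fhull ?I' (V' w) = fhull (I \<times> I) (\<lambda>k. V' w (prod_encode k))"
      by (rule fhull_reindex) (rule inj_prod_encode)
    ultimately show ?thesis using P[OF w] by (simp add: V'_def)
  qed
  moreover have "continuous_on {w \<in> X. lev' w = l} (\<lambda>w. V' w k c)" if k: "k \<in> ?I'" for k c l
  proof -
    obtain i j where ij: "prod_decode k = (i, j)" "i \<in> I" "j \<in> I" using k by auto
    let ?S = "{w \<in> X. lev' w = l}"
    have sub: "?S \<subseteq> {w \<in> X. lev w = l div Suc (card I)}" using lev'_div by auto
    have VS: "continuous_on ?S (\<lambda>w. V w i c)" if "i \<in> I" for i by (rule continuous_on_subset[OF V[OF that] sub])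
    have hS: "continuous_on ?S (\<lambda>w. h w i)" if "i \<in> I" for i by (rule continuous_on_subset[OF h[OF that] sub])
    show ?thesis
      unfolding continuous_on_def
    proof
      fix w assume w: "w \<in> ?S"
      then have wX: "w \<in> X" by simp
      \<comment> \<open>On one new stratum the counts agree, so the inclusion of the sets
        \<open>nz\<close> is an equality and the sign pattern is locally constant. Each generator is
        then given by a single branch of \<open>cut\<close>.\<close>
      have "eventually (\<lambda>v. lev' v = l \<longrightarrow> (\<forall>i\<in>I. (0 < h v i \<longleftrightarrow> 0 < h w i) \<and> (h v i \<le> 0 \<longleftrightarrow> h w i \<le> 0))) (at w within X)"
        using sign[OF wX]
      proof eventually_elim
        case (elim v)
        show ?case
        proof
          assume v: "lev' v = l"
          then have eq: "lev' v = lev' w" using w by simp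
          have lev_eq: "lev v = lev w" using lev'_div[of v] lev'_div[of w] unfolding eq by simp
          have "card (nz v) = card (nz w)" using lev'_mod[of v] lev'_mod[of w] unfolding eq by simp
          have s: "\<forall>i\<in>I. (0 < h w i \<longrightarrow> 0 < h v i) \<and> (h w i < 0 \<longrightarrow> h v i < 0)"
            using elim lev_eq by blast
          then have "nz w = nz v"
            using nz_sub fin_nz \<open>card (nz v) = card (nz w)\<close> by (intro card_subset_eq) auto
          then have "h w i = 0 \<longleftrightarrow> h v i = 0" if "i \<in> I" for i using that by (auto simp: nz_def)
          then show "\<forall>i\<in>I. (0 < h v i \<longleftrightarrow> 0 < h w i) \<and> (h v i \<le> 0 \<longleftrightarrow> h w i \<le> 0)"
            using s by (metis less_eq_real_def linorder_less_linear order_less_asym)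
        qed
      qed
      then have ev: "eventually (\<lambda>v. \<forall>i\<in>I. (0 < h v i \<longleftrightarrow> 0 < h w i) \<and> (h v i \<le> 0 \<longleftrightarrow> h w i \<le> 0)) (at w within ?S)"
        by (simp add: eventually_at_within_imp)
      have base_eq: "base v = base w" if "\<forall>i\<in>I. (0 < h v i \<longleftrightarrow> 0 < h w i) \<and> (h v i \<le> 0 \<longleftrightarrow> h w i \<le> 0)" for v
        unfolding base_def by (rule arg_cong[of _ _ Least]) (use that in auto)
      consider "0 < h w i" | "h w i \<le> 0" "h w j \<le> 0" | "h w i \<le> 0" "0 < h w j" by linarith
      then show "((\<lambda>w. V' w k c) \<longlongrightarrow> V' w k c) (at w within ?S)"
      proof cases
        case 1
        have t: "((\<lambda>v. V v (base w) c) \<longlongrightarrow> V w (base w) c) (at w within ?S)"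
          using VS[OF base(1)[OF wX]] w by (simp add: continuous_on_def)
        have e: "eventually (\<lambda>v. V v (base w) c = V' v k c) (at w within ?S)"
        proof (rule eventually_mono[OF ev])
          fix v assume v: "\<forall>i\<in>I. (0 < h v i \<longleftrightarrow> 0 < h w i) \<and> (h v i \<le> 0 \<longleftrightarrow> h w i \<le> 0)"
          then have "0 < h v i" using 1 ij(2,3) by simp_all
          then show "V v (base w) c = V' v k c" using ij(1) base_eq[OF v] by (simp add: V'_def cut_def)
        qed
        have q: "V' w k c = V w (base w) c" using 1 ij(1) by (simp add: V'_def cut_def)
        show ?thesis unfolding q by (rule Lim_transform_eventually[OF t e])
      next
        case 2
        have t: "((\<lambda>v. V v i c) \<longlongrightarrow> V w i c) (at w within ?S)"
          using VS[OF ij(2)] w by (simp add: continuous_on_def)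
        have e: "eventually (\<lambda>v. V v i c = V' v k c) (at w within ?S)"
        proof (rule eventually_mono[OF ev])
          fix v assume v: "\<forall>i\<in>I. (0 < h v i \<longleftrightarrow> 0 < h w i) \<and> (h v i \<le> 0 \<longleftrightarrow> h w i \<le> 0)"
          then have "h v i \<le> 0" "h v j \<le> 0" using 2 ij(2,3) by simp_all
          then show "V v i c = V' v k c" using ij(1) by (simp add: V'_def cut_def)
        qed
        have q: "V' w k c = V w i c" using 2 ij(1) by (simp add: V'_def cut_def)
        show ?thesis unfolding q by (rule Lim_transform_eventually[OF t e])
      next
        case 3
        have t: "((\<lambda>v. (h v j * V v i c - h v i * V v j c) / (h v j - h v i)) \<longlongrightarrow>
            (h w j * V w i c - h w i * V w j c) / (h w j - h w i)) (at w within ?S)"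
          using VS[OF ij(2)] VS[OF ij(3)] hS[OF ij(2)] hS[OF ij(3)] w 3
          by (intro tendsto_divide tendsto_diff tendsto_mult) (auto simp: continuous_on_def)
        have e: "eventually (\<lambda>v. (h v j * V v i c - h v i * V v j c) / (h v j - h v i) = V' v k c) (at w within ?S)"
        proof (rule eventually_mono[OF ev])
          fix v assume v: "\<forall>i\<in>I. (0 < h v i \<longleftrightarrow> 0 < h w i) \<and> (h v i \<le> 0 \<longleftrightarrow> h w i \<le> 0)"
          then have "h v i \<le> 0" "0 < h v j" using 3 ij(2,3) by simp_all
          then show "(h v j * V v i c - h v i * V v j c) / (h v j - h v i) = V' v k c" using ij(1) by (simp add: V'_def cut_def)
        qed
        have q: "V' w k c = (h w j * V w i c - h w i * V w j c) / (h w j - h w i)" using 3 ij(1) by (simp add: V'_def cut_def)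
        show ?thesis unfolding q by (rule Lim_transform_eventually[OF t e])
      qed
    qed
  qed
  ultimately show ?thesis
    unfolding stratified_def stratification_def using I
    by (intro exI[of _ ?I'] exI[of _ "D * Suc (card I) + card I"] exI[of _ lev'] exI[of _ V']) auto
qed

lemma stratified_constraints:
  fixes V :: "nat \<Rightarrow> nat \<Rightarrow> real"
  assumes I: "finite I" and as: "\<And>a c. a \<in> set as \<Longrightarrow> continuous_on X (\<lambda>w. a w c)"
    and ne: "\<And>w. w \<in> X \<Longrightarrow> {z \<in> fhull I V. \<forall>a\<in>set as. lin N (a w) z \<le> 0} \<noteq> {}"
  shows "stratified X (\<lambda>w. {z \<in> fhull I V. \<forall>a\<in>set as. lin N (a w) z \<le> 0})"
  using as ne
proof (induction as)
  case Nil
  show ?case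
    unfolding stratified_def stratification_def using I
    by (intro exI[of _ I] exI[of _ 0] exI[of _ "\<lambda>_. 0"] exI[of _ "\<lambda>_. V"]) auto
next
  case (Cons a as)
  let ?P = "\<lambda>w. {z \<in> fhull I V. \<forall>a\<in>set as. lin N (a w) z \<le> 0}"
  have eq: "{z \<in> fhull I V. \<forall>a\<in>set (a # as). lin N (a w) z \<le> 0} = {z \<in> ?P w. lin N (a w) z \<le> 0}" for w
    by auto
  have "stratified X (\<lambda>w. {z \<in> ?P w. lin N (a w) z \<le> 0})"
  proof (rule stratified_halfspace)
    show "stratified X ?P" by (rule Cons.IH) (use Cons.prems in fastforce)+
    show "continuous_on X (\<lambda>w. a w c)" for c using Cons.prems(1)[of a] by simp
    show "{z \<in> ?P w. lin N (a w) z \<le> 0} \<noteq> {}" if "w \<in> X" for w using Cons.prems(2)[OF that] unfolding eq .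
  qed
  then show ?case unfolding eq .
qed

subsection \<open>Nearest points\<close>

text \<open>Euclidean, because the stability of nearest points rests on the parallelogram
  law.\<close>

definition ndist :: "nat \<Rightarrow> (nat \<Rightarrow> real) \<Rightarrow> (nat \<Rightarrow> real) \<Rightarrow> real" where
  "ndist N p q = L2_set (\<lambda>c. p c - q c) {..<N}"

lemma ndist_nonneg [simp]: "0 \<le> ndist N p q"
  by (simp add: ndist_def)

lemma ndist_commute: "ndist N p q = ndist N q p"
  by (simp add: ndist_def L2_set_def power2_commute)

lemma ndist_triangle: "ndist N p r \<le> ndist N p q + ndist N q r"
proof -
  have "ndist N p r = L2_set (\<lambda>c. (p c - q c) + (q c - r c)) {..<N}" by (simp add: ndist_def)
  also have "\<dots> \<le> ndist N p q + ndist N q r" unfolding ndist_def by (rule L2_set_triangle_ineq)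
  finally show ?thesis .
qed

lemma abs_le_ndist: "c < N \<Longrightarrow> \<bar>p c - q c\<bar> \<le> ndist N p q"
  using member_le_L2_set[of "{..<N}" c "\<lambda>c. \<bar>p c - q c\<bar>"] by (simp add: ndist_def L2_set_def)

lemma ndist_le_sum: "ndist N p q \<le> (\<Sum>c<N. \<bar>p c - q c\<bar>)"
  unfolding ndist_def by (rule L2_set_le_sum_abs)

lemma ndist_le_max: "(\<And>c. c < N \<Longrightarrow> \<bar>p c - q c\<bar> \<le> e) \<Longrightarrow> ndist N p q \<le> real N * e"
  using sum_mono[of "{..<N}" "\<lambda>c. \<bar>p c - q c\<bar>" "\<lambda>_. e"] ndist_le_sum[of N p q] by simp

lemma ndist_square: "(ndist N p q)\<^sup>2 = (\<Sum>c<N. (p c - q c)\<^sup>2)"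
  by (simp add: ndist_def L2_set_def sum_nonneg)

lemma tendsto_ndist:
  assumes "\<And>c. c < N \<Longrightarrow> ((\<lambda>t. p t c) \<longlongrightarrow> p' c) F" "\<And>c. c < N \<Longrightarrow> ((\<lambda>t. q t c) \<longlongrightarrow> q' c) F"
  shows "((\<lambda>t. ndist N (p t) (q t)) \<longlongrightarrow> ndist N p' q') F"
  unfolding ndist_def L2_set_def
  by (intro tendsto_real_sqrt tendsto_sum tendsto_power tendsto_diff assms) auto

text \<open>The minimum is taken over the weights, a compact subset of the countable cube. Weights
  outside \<open>I\<close> are left free there, as they do not affect the point.\<close>

lemma ex_nearest:
  fixes I :: "nat set"
  assumes I: "finite I" "I \<noteq> {}"
  shows "\<exists>a\<in>fhull I V. \<forall>b\<in>fhull I V. ndist N p a \<le> ndist N p b"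
proof -
  let ?C = "(\<Pi>\<^sub>E i\<in>(UNIV :: nat set). {0..1::real})"
  let ?K = "?C \<inter> {l. sum l I = 1}"
  let ?pt = "\<lambda>l c. \<Sum>i\<in>I. l i * V i c"
  have cont: "continuous_on S (\<lambda>l::nat \<Rightarrow> real. l i)" for S i
    by (rule continuous_on_apply) (rule continuous_on_id)
  have "closed {l::nat \<Rightarrow> real. sum l I = 1}"
    by (intro closed_Collect_eq continuous_on_sum cont continuous_on_const)
  then have K: "compact ?K" using compact_unit_cube by (rule compact_Int_closed[rotated])
  obtain i where i: "i \<in> I" using I(2) by blast
  have "(\<lambda>j. if j = i then 1 else 0) \<in> ?K" using i I(1) by auto
  then have Kne: "?K \<noteq> {}" by blast
  have Kcont: "continuous_on ?K (\<lambda>l. ndist N p (?pt l))"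
    unfolding continuous_on_def
  proof
    fix l assume "l \<in> ?K"
    have "((\<lambda>l. l i) \<longlongrightarrow> l i) (at l within ?K)" for i
      using cont[of ?K i] \<open>l \<in> ?K\<close> by (simp add: continuous_on_def)
    then show "((\<lambda>l. ndist N p (?pt l)) \<longlongrightarrow> ndist N p (?pt l)) (at l within ?K)"
      by (intro tendsto_ndist tendsto_const tendsto_sum tendsto_mult)
  qed
  obtain l where l: "l \<in> ?K" and l': "\<forall>m\<in>?K. ndist N p (?pt l) \<le> ndist N p (?pt m)"
    using continuous_attains_inf[OF K Kne Kcont] by (rule bexE)
  have l2: "ndist N p (?pt l) \<le> ndist N p (?pt m)" if "m \<in> ?K" for m by (rule bspec[OF l' that])
  have "?pt l \<in> fhull I V" using l unfolding fhull_def by (auto simp: PiE_iff)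
  moreover have "ndist N p (?pt l) \<le> ndist N p b" if b: "b \<in> fhull I V" for b
  proof -
    obtain m where m: "\<forall>i\<in>I. 0 \<le> m i" "sum m I = 1" "b = ?pt m" using b by (auto simp: fhull_def)
    define m' where "m' i = (if i \<in> I then m i else 0)" for i
    have "m i \<le> 1" if "i \<in> I" for i using member_le_sum[of i I m] that m(1,2) I(1) by auto
    then have "m' \<in> ?K" using m(1,2) by (auto simp: m'_def)
    then have "ndist N p (?pt l) \<le> ndist N p (?pt m')" by (rule l2)
    moreover have "?pt m' = b" unfolding m(3) by (intro ext sum.cong refl) (simp add: m'_def)
    ultimately show ?thesis by (simp only:)
  qed
  ultimately show ?thesis by blast
qed

text \<open>Only the coordinates below \<open>N\<close> are determined, as the others do not enter
  the distance.\<close>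

definition nearest :: "nat set \<Rightarrow> nat \<Rightarrow> (nat \<Rightarrow> nat \<Rightarrow> real) \<Rightarrow> (nat \<Rightarrow> real) \<Rightarrow> nat \<Rightarrow> real" where
  "nearest I N V p = (SOME a. a \<in> fhull I V \<and> (\<forall>b\<in>fhull I V. ndist N p a \<le> ndist N p b))"

lemma nearest:
  assumes "finite I" "I \<noteq> {}"
  shows "nearest I N V p \<in> fhull I V" "b \<in> fhull I V \<Longrightarrow> ndist N p (nearest I N V p) \<le> ndist N p b"
proof -
  have "\<exists>a. a \<in> fhull I V \<and> (\<forall>b\<in>fhull I V. ndist N p a \<le> ndist N p b)"
    using ex_nearest[OF assms] by blast
  from someI_ex[OF this] show "nearest I N V p \<in> fhull I V"
    "b \<in> fhull I V \<Longrightarrow> ndist N p (nearest I N V p) \<le> ndist N p b"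
    unfolding nearest_def[symmetric] by blast+
qed

lemma fhull_midpoint:
  assumes "a \<in> fhull I V" "b \<in> fhull I V"
  shows "(\<lambda>c. (a c + b c) / 2) \<in> fhull I V"
proof -
  obtain l where l: "\<forall>i\<in>I. 0 \<le> l i" "sum l I = 1" "a = (\<lambda>c. \<Sum>i\<in>I. l i * V i c)"
    using assms(1) by (auto simp: fhull_def)
  obtain m where m: "\<forall>i\<in>I. 0 \<le> m i" "sum m I = 1" "b = (\<lambda>c. \<Sum>i\<in>I. m i * V i c)"
    using assms(2) by (auto simp: fhull_def)
  show ?thesis
    unfolding fhull_def using l m
    by (intro CollectI exI[of _ "\<lambda>i. (l i + m i) / 2"])
       (auto simp: sum.distrib distrib_right add_divide_distrib sum_divide_distrib simp flip: sum_divide_distrib)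
qed

text \<open>By the parallelogram law.\<close>

lemma almost_nearest:
  assumes ab: "a \<in> fhull I V" "b \<in> fhull I V" and a: "\<And>x. x \<in> fhull I V \<Longrightarrow> ndist N p a \<le> ndist N p x"
    and b: "ndist N p b \<le> ndist N p a + e"
  shows "ndist N a b \<le> sqrt (4 * ndist N p a * e + 2 * e\<^sup>2)"
proof -
  let ?m = "\<lambda>c. (a c + b c) / 2"
  let ?d = "ndist N p a"
  have "(ndist N a b)\<^sup>2 = 2 * ?d\<^sup>2 + 2 * (ndist N p b)\<^sup>2 - 4 * (ndist N p ?m)\<^sup>2"
    unfolding ndist_square sum_distrib_left
    by (simp flip: sum.distrib sum_subtractf) (intro sum.cong refl, simp add: power2_eq_square field_simps)
  moreover have "?d\<^sup>2 \<le> (ndist N p ?m)\<^sup>2"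
    using a[OF fhull_midpoint[OF ab]] by (intro power_mono) auto
  moreover have "(ndist N p b)\<^sup>2 \<le> (?d + e)\<^sup>2" using b by (intro power_mono) auto
  ultimately have "(ndist N a b)\<^sup>2 \<le> 4 * ?d * e + 2 * e\<^sup>2"
    by (simp add: power2_eq_square algebra_simps)
  then show ?thesis using real_le_rsqrt by blast
qed

text \<open>Equal weights give points of the two hulls at distance at most \<open>e t\<close>. So
  the nearest point of one hull yields an almost nearest point of the other, and by
  \<open>almost_nearest\<close> such a point is close to the nearest one.\<close>

lemma tendsto_nearest:
  fixes V :: "'t \<Rightarrow> nat \<Rightarrow> nat \<Rightarrow> real"
  assumes I: "finite I" "I \<noteq> {}"
    and p: "\<And>c. c < N \<Longrightarrow> ((\<lambda>t. p t c) \<longlongrightarrow> p' c) F"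
    and V: "\<And>i c. i \<in> I \<Longrightarrow> c < N \<Longrightarrow> ((\<lambda>t. V t i c) \<longlongrightarrow> V' i c) F"
    and c: "c < N"
  shows "((\<lambda>t. nearest I N (V t) (p t) c) \<longlongrightarrow> nearest I N V' p' c) F"
proof -
  define e where "e t = ndist N p' (p t) + (\<Sum>c<N. \<Sum>i\<in>I. \<bar>V' i c - V t i c\<bar>)" for t
  define a where "a = nearest I N V' p'"
  define a' where "a' t = nearest I N (V t) (p t)" for t
  define g where "g t = sqrt (4 * ndist N p' a * (4 * e t) + 2 * (4 * e t)\<^sup>2) + e t" for t
  have e0: "0 \<le> e t" for t unfolding e_def by (intro add_nonneg_nonneg sum_nonneg) auto
  have comb: "ndist N (\<lambda>c. \<Sum>i\<in>I. l i * V' i c) (\<lambda>c. \<Sum>i\<in>I. l i * V t i c) \<le> e t"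
    if l: "\<forall>i\<in>I. 0 \<le> l i" "sum l I = 1" for l t
  proof -
    have l1: "l i \<le> 1" if "i \<in> I" for i using member_le_sum[of i I l] that l I(1) by auto
    have "\<bar>(\<Sum>i\<in>I. l i * V' i c) - (\<Sum>i\<in>I. l i * V t i c)\<bar> \<le> (\<Sum>i\<in>I. \<bar>V' i c - V t i c\<bar>)" for c
    proof -
      have "\<bar>(\<Sum>i\<in>I. l i * V' i c) - (\<Sum>i\<in>I. l i * V t i c)\<bar> = \<bar>\<Sum>i\<in>I. l i * (V' i c - V t i c)\<bar>"
        by (simp add: sum_subtractf right_diff_distrib)
      also have "\<dots> \<le> (\<Sum>i\<in>I. \<bar>l i * (V' i c - V t i c)\<bar>)" by (rule sum_abs)
      also have "\<dots> \<le> (\<Sum>i\<in>I. \<bar>V' i c - V t i c\<bar>)"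
        using l l1 by (intro sum_mono) (auto simp: abs_mult mult_left_le_one_le)
      finally show ?thesis .
    qed
    then have "ndist N (\<lambda>c. \<Sum>i\<in>I. l i * V' i c) (\<lambda>c. \<Sum>i\<in>I. l i * V t i c) \<le> (\<Sum>c<N. \<Sum>i\<in>I. \<bar>V' i c - V t i c\<bar>)"
      by (intro order_trans[OF ndist_le_sum] sum_mono)
    then show ?thesis unfolding e_def using ndist_nonneg[of N p' "p t"] by linarith
  qed
  have "ndist N a (a' t) \<le> g t" for t
  proof -
    have a't: "a' t \<in> fhull I (V t)" unfolding a'_def by (rule nearest(1)[OF I])
    obtain l where l: "\<forall>i\<in>I. 0 \<le> l i" "sum l I = 1" "a' t = (\<lambda>c. \<Sum>i\<in>I. l i * V t i c)"
      using a't by (auto simp: fhull_def)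
    define b where "b = (\<lambda>c. \<Sum>i\<in>I. l i * V' i c)"
    have b: "b \<in> fhull I V'" unfolding b_def fhull_def using l by blast
    have aI: "a \<in> fhull I V'" unfolding a_def by (rule nearest(1)[OF I])
    obtain m where m: "\<forall>i\<in>I. 0 \<le> m i" "sum m I = 1" "a = (\<lambda>c. \<Sum>i\<in>I. m i * V' i c)"
      using aI by (auto simp: fhull_def)
    define a2 where "a2 = (\<lambda>c. \<Sum>i\<in>I. m i * V t i c)"
    have a2: "a2 \<in> fhull I (V t)" unfolding a2_def fhull_def using m by blast
    have d1: "ndist N b (a' t) \<le> e t" unfolding b_def l(3) by (rule comb[OF l(1,2)])
    have d2: "ndist N a a2 \<le> e t" unfolding a2_def m(3) by (rule comb[OF m(1,2)])
    have pe: "ndist N p' (p t) \<le> e t" unfolding e_def by (auto intro!: sum_nonneg)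
    \<comment> \<open>Four errors of size \<open>e t\<close> add up: the base point is exchanged
      twice, and each of the two hull points once.\<close>
    have "ndist N p' b \<le> ndist N p' (p t) + ndist N (p t) (a' t) + ndist N (a' t) b"
      using ndist_triangle[of N p' b "p t"] ndist_triangle[of N "p t" b "a' t"] by linarith
    also have "ndist N (p t) (a' t) \<le> ndist N (p t) a2"
      unfolding a'_def by (rule nearest(2)[OF I a2])
    also have "ndist N (p t) a2 \<le> ndist N (p t) p' + ndist N p' a + ndist N a a2"
      using ndist_triangle[of N "p t" a2 p'] ndist_triangle[of N p' a2 a] by linarith
    finally have "ndist N p' b \<le> ndist N p' a + 4 * e t"
      using d1 d2 pe ndist_commute[of N "a' t" b] ndist_commute[of N "p t" p'] by linarith
    from almost_nearest[OF aI b _ this] have "ndist N a b \<le> sqrt (4 * ndist N p' a * (4 * e t) + 2 * (4 * e t)\<^sup>2)"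
      unfolding a_def by (meson nearest(2)[OF I])
    then show ?thesis unfolding g_def using ndist_triangle[of N a "a' t" b] d1 by linarith
  qed
  then have le: "\<bar>a' t c - a c\<bar> \<le> g t" for t
    using abs_le_ndist[OF c, of a "a' t"] by (metis abs_minus_commute order_trans)
  have "(e \<longlongrightarrow> ndist N p' p' + (\<Sum>c<N. \<Sum>i\<in>I. \<bar>V' i c - V' i c\<bar>)) F"
    unfolding e_def by (intro tendsto_add tendsto_ndist tendsto_sum tendsto_rabs tendsto_diff tendsto_const p V) auto
  then have "(e \<longlongrightarrow> 0) F" by (simp add: ndist_def L2_set_def)
  then have "(g \<longlongrightarrow> sqrt (4 * ndist N p' a * (4 * 0) + 2 * (4 * 0)\<^sup>2) + 0) F"
    unfolding g_def by (intro tendsto_add tendsto_real_sqrt tendsto_mult tendsto_power tendsto_const)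
  then have "(g \<longlongrightarrow> 0) F" by simp
  then have "((\<lambda>t. a' t c - a c) \<longlongrightarrow> 0) F"
    by (rule Lim_null_comparison[rotated]) (simp add: le)
  then show ?thesis unfolding a_def a'_def by (rule LIM_zero_cancel)
qed

text \<open>Moves \<open>p\<close> towards the polytope until the distance is at most \<open>\<eta>\<close>; for \<open>p\<close> in the polytope
  the quotient is \<open>\<eta> / 0 = 0\<close>, which does no harm.\<close>

definition pull :: "nat set \<Rightarrow> nat \<Rightarrow> (nat \<Rightarrow> nat \<Rightarrow> real) \<Rightarrow> real \<Rightarrow> (nat \<Rightarrow> real) \<Rightarrow> nat \<Rightarrow> real" where
  "pull I N V \<eta> p c = (let a = nearest I N V p in
    if c < N then p c + max 0 (1 - \<eta> / ndist N p a) * (a c - p c) else 0)"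

lemma fhull_zero: "z \<in> fhull I V \<Longrightarrow> (\<And>i. i \<in> I \<Longrightarrow> V i c = 0) \<Longrightarrow> z c = 0"
  by (auto simp: fhull_def)

text \<open>For tolerance 0 the quotient is 0 at every distance, so the factor is 1 and
  \<open>p\<close> jumps to its nearest point. The generators must vanish from \<open>N\<close> on
  because \<open>pull\<close> does.\<close>

lemma pull_zero:
  assumes "finite I" "I \<noteq> {}" "\<And>i c. i \<in> I \<Longrightarrow> N \<le> c \<Longrightarrow> V i c = 0"
  shows "pull I N V 0 p \<in> fhull I V"
proof -
  have "pull I N V 0 p c = nearest I N V p c" for c
    using fhull_zero[OF nearest(1)[OF assms(1,2)], of V c N p] assms(3) by (auto simp: pull_def Let_def)
  then have "pull I N V 0 p = nearest I N V p" by blast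
  then show ?thesis using nearest(1)[OF assms(1,2)] by simp
qed

lemma pull_id:
  assumes I: "finite I" "I \<noteq> {}" and p: "\<And>c. N \<le> c \<Longrightarrow> p c = 0"
    and near: "ndist N p (nearest I N V p) \<le> \<eta>"
  shows "pull I N V \<eta> p = p"
proof
  fix c
  let ?a = "nearest I N V p"
  show "pull I N V \<eta> p c = p c"
  proof (cases "c < N \<and> ndist N p ?a = 0")
    case True
    then have "?a c = p c" using abs_le_ndist[of c N p ?a] by simp
    then show ?thesis by (simp add: pull_def Let_def p)
  next
    case False
    have "1 - \<eta> / ndist N p ?a \<le> 0" if "ndist N p ?a \<noteq> 0"
    proof -
      have "0 < ndist N p ?a" using that by (simp add: order_less_le)
      then show ?thesis using near by simp
    qed
    then show ?thesis using False by (auto simp: pull_def Let_def p max_def)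
  qed
qed

text \<open>The factor may jump where \<open>p\<close> reaches the hull, but it stays in the unit
  interval and multiplies a displacement that tends to 0.\<close>

lemma tendsto_pull:
  fixes V :: "'t \<Rightarrow> nat \<Rightarrow> nat \<Rightarrow> real"
  assumes I: "finite I" "I \<noteq> {}"
    and p: "\<And>c. c < N \<Longrightarrow> ((\<lambda>t. p t c) \<longlongrightarrow> p' c) F"
    and V: "\<And>i c. i \<in> I \<Longrightarrow> c < N \<Longrightarrow> ((\<lambda>t. V t i c) \<longlongrightarrow> V' i c) F"
    and \<eta>: "(\<eta> \<longlongrightarrow> \<eta>') F" "\<And>t. 0 \<le> \<eta> t"
  shows "((\<lambda>t. pull I N (V t) (\<eta> t) (p t) c) \<longlongrightarrow> pull I N V' \<eta>' p' c) F"
proof (cases "c < N")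
  case c: True
  define a where "a t = nearest I N (V t) (p t)" for t
  define a' where "a' = nearest I N V' p'"
  have a: "((\<lambda>t. a t c) \<longlongrightarrow> a' c) F" if "c < N" for c
    unfolding a_def a'_def by (rule tendsto_nearest[OF I p V that])
  have d: "((\<lambda>t. ndist N (p t) (a t)) \<longlongrightarrow> ndist N p' a') F"
    by (rule tendsto_ndist[OF p a])
  show ?thesis
  proof (cases "ndist N p' a' = 0")
    case False
    have "((\<lambda>t. p t c + max 0 (1 - \<eta> t / ndist N (p t) (a t)) * (a t c - p t c)) \<longlongrightarrow>
        p' c + max 0 (1 - \<eta>' / ndist N p' a') * (a' c - p' c)) F"
      by (intro tendsto_add tendsto_mult tendsto_max tendsto_diff tendsto_divide tendsto_const p a d \<eta> c False)
    then show ?thesis using c by (simp add: pull_def a_def a'_def Let_def)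
  next
    case True
    then have "a' c = p' c" using abs_le_ndist[OF c, of p' a'] by simp
    then have lim: "pull I N V' \<eta>' p' c = p' c" using c by (simp add: pull_def a'_def Let_def)
    have "((\<lambda>t. \<bar>p t c - p' c\<bar> + \<bar>a t c - p t c\<bar>) \<longlongrightarrow> \<bar>p' c - p' c\<bar> + \<bar>a' c - p' c\<bar>) F"
      by (intro tendsto_add tendsto_rabs tendsto_diff tendsto_const p a c)
    then have 0: "((\<lambda>t. \<bar>p t c - p' c\<bar> + \<bar>a t c - p t c\<bar>) \<longlongrightarrow> 0) F"
      using \<open>a' c = p' c\<close> by simp
    have le: "\<bar>pull I N (V t) (\<eta> t) (p t) c - p' c\<bar> \<le> \<bar>p t c - p' c\<bar> + \<bar>a t c - p t c\<bar>" for t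
    proof -
      define s where "s = max 0 (1 - \<eta> t / ndist N (p t) (a t))"
      have "0 \<le> s" "s \<le> 1" using \<eta>(2)[of t] by (auto simp: s_def)
      then have "\<bar>s * (a t c - p t c)\<bar> \<le> \<bar>a t c - p t c\<bar>" by (simp add: abs_mult mult_left_le_one_le)
      moreover have "pull I N (V t) (\<eta> t) (p t) c = p t c + s * (a t c - p t c)"
        using c by (simp add: pull_def a_def s_def Let_def)
      ultimately show ?thesis by linarith
    qed
    have "((\<lambda>t. pull I N (V t) (\<eta> t) (p t) c - p' c) \<longlongrightarrow> 0) F"
      by (rule Lim_null_comparison[OF _ 0]) (simp add: le)
    then show ?thesis unfolding lim by (rule LIM_zero_cancel)
  qed
qed (simp add: pull_def)

subsection \<open>Families of polytopes that are continuous on finitely many strata\<close>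

text \<open>Upper semicontinuity: near \<open>w\<close> the sets may be much smaller than
  \<open>P w\<close>, but they do not reach far beyond it. This makes the tolerance of a stratum
  tend to 0 towards that stratum.\<close>

definition usc :: "nat \<Rightarrow> baire set \<Rightarrow> (baire \<Rightarrow> (nat \<Rightarrow> real) set) \<Rightarrow> bool" where
  "usc N X P \<longleftrightarrow> (\<forall>w\<in>X. \<forall>e>0. \<exists>k. \<forall>v\<in>X. agree k w v \<longrightarrow>
    (\<forall>z\<in>P v. \<exists>z'\<in>P w. \<forall>c<N. \<bar>z c - z' c\<bar> \<le> e))"

definition in_cube :: "nat \<Rightarrow> (nat \<Rightarrow> real) \<Rightarrow> bool" where
  "in_cube N z \<longleftrightarrow> (\<forall>c<N. 0 \<le> z c \<and> z c \<le> 1) \<and> (\<forall>c\<ge>N. z c = 0)"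

lemma openin_agreeI:
  assumes "U \<subseteq> X" "\<And>w. w \<in> U \<Longrightarrow> \<exists>k. \<forall>v\<in>X. agree k w v \<longrightarrow> v \<in> U"
  shows "openin (top_of_set X) U"
proof -
  obtain k where k: "\<And>w v. w \<in> U \<Longrightarrow> v \<in> X \<Longrightarrow> agree (k w) w v \<Longrightarrow> v \<in> U"
    using assms(2) by metis
  have "open (\<Union>w\<in>U. {v. agree (k w) w v})" by (intro open_UN ballI open_agree)
  moreover have "U = X \<inter> (\<Union>w\<in>U. {v. agree (k w) w v})" using assms(1) k by fastforce
  ultimately show ?thesis unfolding openin_open by blast
qed

lemma openin_upper_strata:
  fixes lev :: "baire \<Rightarrow> nat"
  assumes "\<And>w. w \<in> X \<Longrightarrow> eventually (\<lambda>v. lev w \<le> lev v) (at w within X)"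
  shows "openin (top_of_set X) {w \<in> X. l \<le> lev w}"
proof (rule openin_agreeI)
  fix w assume "w \<in> {w \<in> X. l \<le> lev w}"
  then have w: "w \<in> X" "l \<le> lev w" by auto
  obtain k where "\<forall>v\<in>X. agree k w v \<longrightarrow> lev w \<le> lev v"
    using assms[OF w(1)] eventually_at_agree[OF w(1), of "\<lambda>v. lev w \<le> lev v"] by auto
  then show "\<exists>k. \<forall>v\<in>X. agree k w v \<longrightarrow> v \<in> {w \<in> X. l \<le> lev w}"
    using w(2) by (intro exI[of _ k]) auto
qed auto

text \<open>The generators on the stratum \<open>lev = l\<close> are extended to the open set \<open>lev \<ge> l\<close> by a retraction;
  \<open>\<eta>\<close> bounds how far the polytopes of the higher strata leave the extended one.\<close>

lemma ex_stratum_extension: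
  assumes st: "stratification X P I D lev V" and ne: "I \<noteq> {}"
    and cube: "\<And>w z. w \<in> X \<Longrightarrow> z \<in> P w \<Longrightarrow> in_cube N z" and usc: "usc N X P"
  shows "\<exists>W \<eta>. (\<forall>i\<in>I. \<forall>c. continuous_on {w \<in> X. l \<le> lev w} (\<lambda>w. W w i c)) \<and>
    continuous_on {w \<in> X. l \<le> lev w} \<eta> \<and>
    (\<forall>w\<in>X. l \<le> lev w \<longrightarrow> (\<forall>i\<in>I. in_cube N (W w i)) \<and> 0 \<le> \<eta> w \<and> \<eta> w \<le> 1) \<and>
    (\<forall>w\<in>X. lev w = l \<longrightarrow> P w = fhull I (W w) \<and> \<eta> w = 0) \<and>
    (\<forall>w\<in>X. l \<le> lev w \<longrightarrow> (\<forall>z\<in>P w. \<forall>e>\<eta> w. \<exists>b\<in>fhull I (W w). \<forall>c<N. \<bar>z c - b c\<bar> \<le> e))"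
proof -
  let ?U = "{w \<in> X. l \<le> lev w}" and ?L = "{w \<in> X. lev w = l}"
  have I: "finite I" and lev: "\<And>w. w \<in> X \<Longrightarrow> eventually (\<lambda>v. lev w \<le> lev v) (at w within X)"
    and V: "\<And>i c. i \<in> I \<Longrightarrow> continuous_on ?L (\<lambda>w. V w i c)" and P: "\<And>w. w \<in> X \<Longrightarrow> P w = fhull I (V w)"
    using st by (simp_all add: stratification_def)
  have Vcube: "in_cube N (V w i)" if "w \<in> X" "i \<in> I" for w i
    using cube[OF that(1)] P[OF that(1)] fhull_vertex[OF I that(2)] by blast
  show ?thesis
  proof (cases "?L = {}")
    \<comment> \<open>An empty stratum admits no retraction; in the unit cube the origin with
      tolerance 1 will do.\<close>
    case True
    obtain i where "i \<in> I" using ne by blast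
    then have b: "(\<lambda>_. 0) \<in> fhull I (\<lambda>_ _. 0)" using fhull_vertex[OF I, of i "\<lambda>_ _. 0"] by simp
    have le: "\<forall>c<N. \<bar>z c - 0\<bar> \<le> e" if "w \<in> X" "z \<in> P w" "1 < e" for w z and e :: real
      using cube[OF that(1,2)] that(3) unfolding in_cube_def by fastforce
    show ?thesis
    proof (intro exI[of _ "\<lambda>_ _ _. 0"] exI[of _ "\<lambda>_. 1"] conjI)
      show "\<forall>w\<in>X. lev w = l \<longrightarrow> P w = fhull I (\<lambda>_ _. 0) \<and> (1::real) = 0" using True by blast
      show "\<forall>w\<in>X. l \<le> lev w \<longrightarrow> (\<forall>z\<in>P w. \<forall>e>1. \<exists>b\<in>fhull I (\<lambda>_ _. 0). \<forall>c<N. \<bar>z c - b c\<bar> \<le> e)"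
      proof (intro ballI impI allI)
        fix w z and e :: real assume "w \<in> X" "z \<in> P w" "1 < e"
        then show "\<exists>b\<in>fhull I (\<lambda>_ _. 0). \<forall>c<N. \<bar>z c - b c\<bar> \<le> e"
          using le[of w z e] b by (intro bexI[of _ "\<lambda>_. 0"]) auto
      qed
    qed (auto simp: in_cube_def)
  next
    case False
    have U: "openin (top_of_set X) {w \<in> X. k \<le> lev w}" for k by (rule openin_upper_strata[OF lev])
    have "openin (top_of_set ?U) {w \<in> X. Suc l \<le> lev w}"
      by (rule openin_subset_trans[OF U]) auto
    then have "closedin (top_of_set ?U) (?U - {w \<in> X. Suc l \<le> lev w})"
      by (intro closedin_diff) auto
    moreover have "?U - {w \<in> X. Suc l \<le> lev w} = ?L" by auto
    ultimately have L: "closedin (top_of_set ?U) ?L" by simp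
    obtain r \<kappa> where r: "continuous_on ?U r" "\<And>w. w \<in> ?U \<Longrightarrow> r w \<in> ?L" "\<And>a. a \<in> ?L \<Longrightarrow> r a = a"
      and const: "\<And>w v. w \<in> ?U \<Longrightarrow> w \<notin> ?L \<Longrightarrow> v \<in> ?U \<Longrightarrow> agree (\<kappa> w) w v \<Longrightarrow> v \<notin> ?L \<and> r v = r w \<and> \<kappa> v = \<kappa> w"
      and pref: "\<And>w a K. w \<in> ?U \<Longrightarrow> a \<in> ?L \<Longrightarrow> agree K a w \<Longrightarrow> agree K a (r w)"
      and less: "\<And>w a K. w \<in> ?U \<Longrightarrow> w \<notin> ?L \<Longrightarrow> a \<in> ?L \<Longrightarrow> agree K a w \<Longrightarrow> K < \<kappa> w"
      by (rule ex_retraction[OF L False]) (rule that)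
    \<comment> \<open>The bound is required on the whole cylinder around \<open>w\<close>, so that
      its validity is constant there and \<open>\<eta>\<close> is continuous off the
      stratum.\<close>
    define good where "good w e \<longleftrightarrow> (\<forall>v\<in>?U. agree (\<kappa> w) w v \<longrightarrow>
      (\<forall>z\<in>P v. \<exists>b\<in>fhull I (V (r v)). \<forall>c<N. \<bar>z c - b c\<bar> \<le> e))" for w and e :: real
    \<comment> \<open>The infimum need not be attained, hence the final claim is about every
      \<open>e\<close> above \<open>\<eta> w\<close>.\<close>
    define \<eta> where "\<eta> w = (if w \<in> ?L then 0 else Inf {e. 0 \<le> e \<and> good w e})" for w
    have rX: "r w \<in> X" if "w \<in> ?U" for w using r(2)[OF that] by simp
    have good1: "good w 1" for w
      unfolding good_def
    proof (intro ballI impI)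
      fix v z assume v: "v \<in> ?U" and z: "z \<in> P v"
      obtain i where i: "i \<in> I" using ne by blast
      have "in_cube N (V (r v) i)" using Vcube[OF rX[OF v] i] .
      moreover have "in_cube N z" using cube[of v z] v z by simp
      ultimately have "\<forall>c<N. \<bar>z c - V (r v) i c\<bar> \<le> 1" by (auto simp: in_cube_def abs_le_iff) (smt (verit))+
      then show "\<exists>b\<in>fhull I (V (r v)). \<forall>c<N. \<bar>z c - b c\<bar> \<le> 1" using fhull_vertex[OF I i] by blast
    qed
    have bdd: "bdd_below {e. 0 \<le> e \<and> good w e}" for w by (rule bdd_belowI[of _ 0]) auto
    have \<eta>0: "0 \<le> \<eta> w" for w
      unfolding \<eta>_def using good1[of w] by (auto intro!: cInf_greatest)
    have \<eta>le: "\<eta> w \<le> e" if "0 \<le> e" "good w e" for w e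
      unfolding \<eta>_def using cInf_lower[OF _ bdd, of e w] that by auto
    have \<eta>1: "\<eta> w \<le> 1" for w using \<eta>le[OF _ good1] by simp
    have cont\<eta>: "continuous_on ?U \<eta>"
      unfolding continuous_on_agree_real
    proof (intro ballI allI impI)
      fix w and e :: real assume w: "w \<in> ?U" and e: "0 < e"
      show "\<exists>k. \<forall>v\<in>?U. agree k w v \<longrightarrow> \<bar>\<eta> v - \<eta> w\<bar> < e"
      proof (cases "w \<in> ?L")
        case False
        have "\<eta> v = \<eta> w" if v: "v \<in> ?U" "agree (\<kappa> w) w v" for v
        proof -
          have c: "v \<notin> ?L" "\<kappa> v = \<kappa> w" using const[OF w False v] by simp_all
          have "agree (\<kappa> w) w x \<longleftrightarrow> agree (\<kappa> w) v x" for x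
            using v(2) agree_sym agree_trans by blast
          then have "good v = good w" by (simp add: good_def[abs_def] c(2))
          then show ?thesis unfolding \<eta>_def if_not_P[OF False] if_not_P[OF c(1)] by simp
        qed
        then show ?thesis using e by (intro exI[of _ "\<kappa> w"]) simp
      next
        case True
        then have wX: "w \<in> X" by simp
        have "0 < e / 3" using e by simp
        then obtain k1 where k1: "\<forall>v\<in>X. agree k1 w v \<longrightarrow> (\<forall>z\<in>P v. \<exists>z'\<in>P w. \<forall>c<N. \<bar>z c - z' c\<bar> \<le> e / 3)"
          using usc wX unfolding usc_def by blast
        have "\<exists>k. \<forall>v\<in>?L. agree k w v \<longrightarrow> (\<forall>i\<in>I. \<forall>c\<in>{..<N}. \<bar>V v i c - V w i c\<bar> < e / 3)"
        proof -
          have "eventually (\<lambda>v. \<bar>V v i c - V w i c\<bar> < e / 3) (at w within ?L)" if "i \<in> I" for i c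
          proof -
            have "((\<lambda>v. V v i c) \<longlongrightarrow> V w i c) (at w within ?L)"
              using V[OF that] True by (simp add: continuous_on_def)
            then show ?thesis using \<open>0 < e / 3\<close> unfolding tendsto_iff dist_real_def by blast
          qed
          then have "eventually (\<lambda>v. \<forall>i\<in>I. \<forall>c\<in>{..<N}. \<bar>V v i c - V w i c\<bar> < e / 3) (at w within ?L)"
            by (intro eventually_ball_finite I finite_lessThan ballI)
          then show ?thesis
            using \<open>0 < e / 3\<close> by (subst (asm) eventually_at_agree[OF True]) auto
        qed
        then obtain k2 where k2: "\<forall>v\<in>?L. agree k2 w v \<longrightarrow> (\<forall>i\<in>I. \<forall>c\<in>{..<N}. \<bar>V v i c - V w i c\<bar> < e / 3)" ..
        define K where "K = max k1 k2"
        have "\<eta> v \<le> 2 * e / 3" if v: "v \<in> ?U" "agree K w v" for v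
        proof (cases "v \<in> ?L")
          case True
          then show ?thesis using e by (simp add: \<eta>_def)
        next
          case vL: False
          \<comment> \<open>So the cylinder of length \<open>\<kappa> v\<close> around
            \<open>v\<close> lies in that of length \<open>K\<close> around \<open>w\<close>, and
            both estimates hold on all of it: one third of \<open>e\<close> for the polytopes, one
            third for the generators.\<close>
          have K: "K < \<kappa> v" by (rule less[OF v(1) vL True v(2)])
          have "good v (2 * e / 3)"
            unfolding good_def
          proof (intro ballI impI)
            fix x z assume x: "x \<in> ?U" "agree (\<kappa> v) v x" and z: "z \<in> P x"
            have wx: "agree K w x" using v(2) agree_mono[OF x(2), of K] K agree_trans by simp
            then have "agree k1 w x" using agree_mono[OF wx, of k1] by (simp add: K_def)
            then obtain z' where z': "z' \<in> P w" "\<forall>c<N. \<bar>z c - z' c\<bar> \<le> e / 3" using k1 x(1) z by blast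
            obtain l where l: "\<forall>i\<in>I. 0 \<le> l i" "sum l I = 1" "z' = (\<lambda>c. \<Sum>i\<in>I. l i * V w i c)"
              using z'(1) P[OF wX] by (auto simp: fhull_def)
            have wrx: "agree K w (r x)" by (rule pref[OF x(1) True wx])
            then have "agree k2 w (r x)" using agree_mono[OF wrx, of k2] by (simp add: K_def)
            then have Vr: "\<forall>i\<in>I. \<forall>c\<in>{..<N}. \<bar>V (r x) i c - V w i c\<bar> < e / 3" using k2 r(2)[OF x(1)] by blast
            define b where "b = (\<lambda>c. \<Sum>i\<in>I. l i * V (r x) i c)"
            have "b \<in> fhull I (V (r x))" unfolding b_def fhull_def using l by blast
            moreover have "\<bar>z c - b c\<bar> \<le> 2 * e / 3" if c: "c < N" for c
            proof -
              have "\<bar>z' c - b c\<bar> = \<bar>\<Sum>i\<in>I. l i * (V w i c - V (r x) i c)\<bar>"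
                unfolding l(3) b_def by (simp add: sum_subtractf right_diff_distrib)
              also have "\<dots> \<le> (\<Sum>i\<in>I. \<bar>l i * (V w i c - V (r x) i c)\<bar>)" by (rule sum_abs)
              also have "\<dots> \<le> (\<Sum>i\<in>I. l i * (e / 3))"
              proof (rule sum_mono)
                fix i assume i: "i \<in> I"
                have "\<bar>V w i c - V (r x) i c\<bar> \<le> e / 3" using Vr i c by (simp add: abs_minus_commute less_imp_le)
                then have "l i * \<bar>V w i c - V (r x) i c\<bar> \<le> l i * (e / 3)"
                  using l(1) i by (intro mult_left_mono) auto
                moreover have "\<bar>l i * (V w i c - V (r x) i c)\<bar> = l i * \<bar>V w i c - V (r x) i c\<bar>"
                  using l(1) i by (simp add: abs_mult)
                ultimately show "\<bar>l i * (V w i c - V (r x) i c)\<bar> \<le> l i * (e / 3)" by simp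
              qed
              also have "\<dots> = e / 3" by (simp only: sum_distrib_right[symmetric] l(2) mult_1)
              finally have "\<bar>z' c - b c\<bar> \<le> e / 3" .
              moreover have "\<bar>z c - z' c\<bar> \<le> e / 3" using z'(2) c by blast
              ultimately show ?thesis by linarith
            qed
            ultimately show "\<exists>b\<in>fhull I (V (r x)). \<forall>c<N. \<bar>z c - b c\<bar> \<le> 2 * e / 3" by blast
          qed
          then show ?thesis using \<eta>le[of "2 * e / 3" v] e by simp
        qed
        moreover have "\<eta> w = 0" using True by (simp add: \<eta>_def)
        ultimately have "\<bar>\<eta> v - \<eta> w\<bar> < e" if "v \<in> ?U" "agree K w v" for v
          using \<eta>0[of v] that e by fastforce
        then show ?thesis by blast
      qed
    qed
    show ?thesis
    proof (intro exI[of _ "\<lambda>w. V (r w)"] exI[of _ \<eta>] conjI ballI allI impI)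
      fix i c assume i: "i \<in> I"
      show "continuous_on ?U (\<lambda>w. V (r w) i c)"
        by (rule continuous_on_compose2[OF V[OF i] r(1)]) (use r(2) in blast)
    next
      show "continuous_on ?U \<eta>" by (rule cont\<eta>)
    next
      fix w i assume "w \<in> X" "l \<le> lev w" "i \<in> I"
      then show "in_cube N (V (r w) i)" using Vcube[OF rX] by simp
    next
      fix w show "0 \<le> \<eta> w" "\<eta> w \<le> 1" by (rule \<eta>0, rule \<eta>1)
    next
      fix w assume w: "w \<in> X" "lev w = l"
      then have "r w = w" by (intro r(3)) simp
      then show "P w = fhull I (V (r w))" using P[OF w(1)] by simp
      show "\<eta> w = 0" using w by (simp add: \<eta>_def)
    next
      fix w z and e :: real assume w: "w \<in> X" "l \<le> lev w" and z: "z \<in> P w" and e: "\<eta> w < e"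
      show "\<exists>b\<in>fhull I (V (r w)). \<forall>c<N. \<bar>z c - b c\<bar> \<le> e"
      proof (cases "w \<in> ?L")
        case True
        then have "\<eta> w = 0" "r w = w" using r(3) by (simp_all add: \<eta>_def)
        then show ?thesis using z P[OF w(1)] e by (intro bexI[of _ z]) auto
      next
        case False
        have "Inf {e. 0 \<le> e \<and> good w e} < e" using e unfolding \<eta>_def if_not_P[OF False] .
        moreover have "1 \<in> {e. 0 \<le> e \<and> good w e}" using good1 by simp
        ultimately have "\<exists>x\<in>{e. 0 \<le> e \<and> good w e}. x < e" by (intro cInf_lessD) blast+
        then obtain e' where "good w e'" "e' < e" by blast
        moreover have "w \<in> ?U" using w by simp
        ultimately obtain b where "b \<in> fhull I (V (r w))" "\<forall>c<N. \<bar>z c - b c\<bar> \<le> e'"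
          using z agree_refl unfolding good_def by blast
        then show ?thesis using \<open>e' < e\<close> by (intro bexI[of _ b]) force+
      qed
    qed
  qed
qed

text \<open>Starting from an arbitrary point, the polytopes of all strata pull it in turn, the deepest ones
  first. On the stratum \<open>lev = l\<close> the data of the levels above \<open>l\<close> are arbitrary, level \<open>l\<close> moves the
  point into \<open>P w\<close>, and the levels below \<open>l\<close> leave it there.\<close>

primrec pulled :: "nat set \<Rightarrow> nat \<Rightarrow> nat \<Rightarrow> (nat \<Rightarrow> nat \<Rightarrow> nat \<Rightarrow> real) \<Rightarrow> (nat \<Rightarrow> real) \<Rightarrow> nat \<Rightarrow> nat \<Rightarrow> real" where
  "pulled I N D W \<eta> 0 = (\<lambda>_. 0)"
| "pulled I N D W \<eta> (Suc j) = pull I N (W (D - j)) (\<eta> (D - j)) (pulled I N D W \<eta> j)"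

lemma pulled_outside: "N \<le> c \<Longrightarrow> pulled I N D W \<eta> j c = 0"
  by (cases j) (auto simp: pull_def Let_def)

lemma pulled_in:
  assumes I: "finite I" "I \<noteq> {}" and l: "l \<le> D"
    and W0: "\<And>i c. i \<in> I \<Longrightarrow> N \<le> c \<Longrightarrow> W l i c = 0"
    and level: "fhull I (W l) = P" "\<eta> l = 0"
    and below: "\<And>k z e. k < l \<Longrightarrow> z \<in> P \<Longrightarrow> \<eta> k < real N * e \<Longrightarrow> \<exists>b\<in>fhull I (W k). \<forall>c<N. \<bar>z c - b c\<bar> \<le> e"
    and N: "0 < N"
  shows "pulled I N D W \<eta> (Suc D) \<in> P"
proof -
  \<comment> \<open>Level \<open>l\<close> is treated in step \<open>Suc (D - l)\<close>. Its
    tolerance is 0, so nothing need be known about the point that reaches it.\<close>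
  have "pulled I N D W \<eta> (Suc (D - l + j)) \<in> P" if "j \<le> l" for j
    using that
  proof (induction j)
    case 0
    have "D - (D - l) = l" using l by simp
    moreover have "pull I N (W l) 0 p \<in> fhull I (W l)" for p by (rule pull_zero[OF I]) (rule W0)
    ultimately show ?case using level by simp
  next
    case (Suc j)
    define k where "k = D - Suc (D - l + j)"
    have k: "k < l" using Suc.prems l by (simp add: k_def)
    let ?p = "pulled I N D W \<eta> (Suc (D - l + j))"
    have p: "?p \<in> P" using Suc by simp
    \<comment> \<open>\<open>below\<close> speaks only of bounds above the tolerance, hence the
      detour through \<open>e\<close>; the factor \<open>real N\<close> passes from coordinates to
      the distance.\<close>
    have "ndist N ?p (nearest I N (W k) ?p) \<le> \<eta> k"
    proof (rule field_le_epsilon)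
      fix e :: real assume e: "0 < e"
      have "\<eta> k < real N * ((\<eta> k + e) / real N)" using e N by simp
      from below[OF k p this] obtain b where b: "b \<in> fhull I (W k)" "\<forall>c<N. \<bar>?p c - b c\<bar> \<le> (\<eta> k + e) / real N"
        by blast
      have "ndist N ?p (nearest I N (W k) ?p) \<le> ndist N ?p b" by (rule nearest(2)[OF I b(1)])
      also have "\<dots> \<le> real N * ((\<eta> k + e) / real N)" using b(2) by (intro ndist_le_max) blast
      also have "\<dots> = \<eta> k + e" using N by simp
      finally show "ndist N ?p (nearest I N (W k) ?p) \<le> \<eta> k + e" .
    qed
    then have "pull I N (W k) (\<eta> k) ?p = ?p" by (rule pull_id[OF I, rotated]) (rule pulled_outside)
    then show ?case using p unfolding k_def by simp
  qed
  from this[of l] show ?thesis using l by simp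
qed

lemma solvable_stratified:
  assumes st: "stratified X P" and ne: "\<And>w. w \<in> X \<Longrightarrow> P w \<noteq> {}"
    and cube: "\<And>w z. w \<in> X \<Longrightarrow> z \<in> P w \<Longrightarrow> in_cube N z" and usc: "usc N X P" and N: "0 < N"
  shows "solvable \<nu> X P"
proof (cases "X = {}")
  case True
  then show ?thesis by (simp add: solvable_empty)
next
  case False
  obtain I D lev V where st': "stratification X P I D lev V" using st unfolding stratified_def by blast
  have I: "finite I" and lev: "\<And>w. w \<in> X \<Longrightarrow> eventually (\<lambda>v. lev w \<le> lev v) (at w within X)"
    and D: "\<And>w. w \<in> X \<Longrightarrow> lev w \<le> D" and P: "\<And>w. w \<in> X \<Longrightarrow> P w = fhull I (V w)"
    using st' by (simp_all add: stratification_def)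
  have Ine: "I \<noteq> {}"
  proof
    assume "I = {}"
    then have "P w = {}" if "w \<in> X" for w using P[OF that] by (simp add: fhull_def)
    then show False using ne False by blast
  qed
  let ?U = "\<lambda>l. {w \<in> X. l \<le> lev w}"
  define ok where "ok l W \<eta> \<longleftrightarrow> (\<forall>i\<in>I. \<forall>c. continuous_on (?U l) (\<lambda>w. W w i c)) \<and>
    continuous_on (?U l) \<eta> \<and>
    (\<forall>w\<in>X. l \<le> lev w \<longrightarrow> (\<forall>i\<in>I. in_cube N (W w i)) \<and> 0 \<le> \<eta> w \<and> \<eta> w \<le> 1) \<and>
    (\<forall>w\<in>X. lev w = l \<longrightarrow> P w = fhull I (W w) \<and> \<eta> w = 0) \<and>
    (\<forall>w\<in>X. l \<le> lev w \<longrightarrow> (\<forall>z\<in>P w. \<forall>e>\<eta> w. \<exists>b\<in>fhull I (W w). \<forall>c<N. \<bar>z c - b c\<bar> \<le> e))"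
    for l and W :: "baire \<Rightarrow> nat \<Rightarrow> nat \<Rightarrow> real" and \<eta> :: "baire \<Rightarrow> real"
  have "\<forall>l. \<exists>W \<eta>. ok l W \<eta>"
    unfolding ok_def by (rule allI, rule ex_stratum_extension[OF st' Ine _ usc], erule (1) cube)
  then obtain W where "\<forall>l. \<exists>\<eta>. ok l (W l) \<eta>" by metis
  then obtain \<eta> where ok: "\<And>l. ok l (W l) (\<eta> l)" by metis
  \<comment> \<open>For each level, one query for the tolerance, under \<open>None\<close>, and one
    for each coordinate of each generator.\<close>
  define K where "K = {..D} \<times> ({None} \<union> Some ` (I \<times> {..<N}))"
  define U where "U k = ?U (fst k)" for k :: "nat \<times> (nat \<times> nat) option"
  define s where "s k w = (case snd k of None \<Rightarrow> \<eta> (fst k) w | Some (i, c) \<Rightarrow> W (fst k) w i c)"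
    for k :: "nat \<times> (nat \<times> nat) option" and w
  let ?Y = "answers \<nu> X K U s"
  have K: "finite K" using I by (simp add: K_def)
  have adv: "advice X K U s"
    unfolding advice_def
  proof
    fix k assume k: "k \<in> K"
    obtain l where l: "l = fst k" by blast
    have "openin (top_of_set X) (U k)" unfolding U_def by (rule openin_upper_strata[OF lev])
    moreover consider "snd k = None" | i c where "snd k = Some (i, c)" "i \<in> I" "c < N"
      using k by (auto simp: K_def)
    then have "continuous_on (U k) (s k) \<and> s k ` U k \<subseteq> {0..1}"
    proof cases
      case 1
      then have "s k = \<eta> l" by (simp add: s_def[abs_def] l)
      then show ?thesis using ok[of l] unfolding ok_def U_def l by auto
    next
      case 2
      then have "s k = (\<lambda>w. W l w i c)" by (simp add: s_def[abs_def] l)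
      then show ?thesis using ok[of l] 2(2,3) unfolding ok_def U_def l in_cube_def by auto
    qed
    ultimately show "openin (top_of_set X) (U k) \<and> continuous_on (U k) (s k) \<and> s k ` U k \<subseteq> {0..1}" by blast
  qed
  \<comment> \<open>Arbitrary answers are clamped to the unit interval. This keeps the tolerances
    nonnegative, as continuity of \<open>pull\<close> demands, and leaves the correct answers
    unchanged.\<close>
  define cl :: "real \<Rightarrow> real" where "cl q = max 0 (min 1 q)" for q
  define R where "R p k = cl (named_real \<nu> (snd p k))"
    for p :: "baire \<times> (nat \<times> (nat \<times> nat) option \<Rightarrow> baire)" and k
  define Wh where "Wh p l i c = (if c < N then R p (l, Some (i, c)) else 0)" for p l i c
  \<comment> \<open>\<open>\<eta>\<close> bounds the single coordinates; the distance is at most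
    \<open>N\<close> times as large.\<close>
  define \<eta>h where "\<eta>h p l = real N * R p (l, None)" for p l
  define H where "H p = pulled I N D (Wh p) (\<eta>h p) (Suc D)" for p
  have Rcont: "continuous_on ?Y (\<lambda>p. R p k)" if k: "k \<in> K" for k
  proof -
    have "continuous_on ?Y (\<lambda>p. snd p k)"
      by (rule continuous_on_apply) (intro continuous_on_snd continuous_on_id)
    then have "continuous_on ?Y (\<lambda>p. named_real \<nu> (snd p k))"
    proof (rule continuous_on_compose2[OF continuous_on_named_real])
      have "\<exists>q. rho_name \<nu> (snd p k) q" if "p \<in> ?Y" for p
      proof -
        have "\<forall>k\<in>K. \<exists>q. rho_name \<nu> (snd p k) q \<and> (fst p \<in> U k \<longrightarrow> q = s k (fst p))"
          using that by (auto simp: answers_def)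
        then show ?thesis using k by blast
      qed
      then show "(\<lambda>p. snd p k) ` ?Y \<subseteq> {w. \<exists>x. rho_name \<nu> w x}" by blast
    qed
    then show ?thesis unfolding R_def cl_def
      by (intro continuous_on_max continuous_on_min continuous_on_const)
  qed
  have Rval: "R p k = s k (fst p)" if p: "p \<in> ?Y" and k: "k \<in> K" and U: "fst p \<in> U k" for p k
  proof -
    have "rho_name \<nu> (snd p k) (s k (fst p))" using p k U unfolding answers_def by auto
    then have "named_real \<nu> (snd p k) = s k (fst p)" by (rule named_real_eq)
    moreover have "0 \<le> s k (fst p) \<and> s k (fst p) \<le> 1" using adv k U unfolding advice_def by force
    ultimately show ?thesis by (simp add: R_def cl_def)
  qed
  have cont: "continuous_on ?Y (\<lambda>p. pulled I N D (Wh p) (\<eta>h p) j c)" for j c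
  proof (induction j arbitrary: c)
    case 0
    show ?case by simp
  next
    case (Suc j)
    show ?case
      unfolding continuous_on_def pulled.simps
    proof
      fix p assume p: "p \<in> ?Y"
      show "((\<lambda>p. pull I N (Wh p (D - j)) (\<eta>h p (D - j)) (pulled I N D (Wh p) (\<eta>h p) j) c) \<longlongrightarrow>
        pull I N (Wh p (D - j)) (\<eta>h p (D - j)) (pulled I N D (Wh p) (\<eta>h p) j) c) (at p within ?Y)"
      proof (rule tendsto_pull[OF I Ine])
        show "((\<lambda>p. pulled I N D (Wh p) (\<eta>h p) j c) \<longlongrightarrow> pulled I N D (Wh p) (\<eta>h p) j c) (at p within ?Y)" for c
          using Suc.IH p by (simp add: continuous_on_def)
        show "((\<lambda>p. Wh p (D - j) i c) \<longlongrightarrow> Wh p (D - j) i c) (at p within ?Y)" if "i \<in> I" "c < N" for i c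
          using Rcont[of "(D - j, Some (i, c))"] p that by (simp add: continuous_on_def Wh_def K_def)
        show "((\<lambda>p. \<eta>h p (D - j)) \<longlongrightarrow> \<eta>h p (D - j)) (at p within ?Y)"
          unfolding \<eta>h_def using Rcont[of "(D - j, None)"] p
          by (intro tendsto_mult tendsto_const) (simp add: continuous_on_def K_def)
        show "0 \<le> \<eta>h p (D - j)" for p by (simp add: \<eta>h_def R_def cl_def)
      qed
    qed
  qed
  have "H p \<in> P (fst p)" if p: "p \<in> ?Y" for p
  proof -
    let ?w = "fst p"
    let ?l = "lev ?w"
    have w: "?w \<in> X" using p by (auto simp: answers_def)
    have Wh: "Wh p k i = W k ?w i" if "k \<le> ?l" "i \<in> I" for k i
    proof
      fix c
      have "k \<le> D" using that(1) D[OF w] by simp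
      moreover have "in_cube N (W k ?w i)" using ok[of k] w that unfolding ok_def by blast
      ultimately show "Wh p k i c = W k ?w i c"
        using Rval[OF p, of "(k, Some (i, c))"] w that by (auto simp: Wh_def K_def U_def s_def in_cube_def)
    qed
    have \<eta>h: "\<eta>h p k = real N * \<eta> k ?w" if "k \<le> ?l" for k
    proof -
      have "k \<le> D" using that D[OF w] by simp
      then show ?thesis using Rval[OF p, of "(k, None)"] w that by (auto simp: \<eta>h_def K_def U_def s_def)
    qed
    have hull: "fhull I (Wh p k) = fhull I (W k ?w)" if "k \<le> ?l" for k
      unfolding fhull_def using Wh[OF that] by simp
    show ?thesis
      unfolding H_def
    proof (rule pulled_in[OF I Ine D[OF w] _ _ _ _ N])
      show "Wh p ?l i c = 0" if "N \<le> c" for i c using that by (simp add: Wh_def)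
      show "fhull I (Wh p ?l) = P ?w" using hull[of ?l] ok[of ?l] w unfolding ok_def by simp
      show "\<eta>h p ?l = 0" using \<eta>h[of ?l] ok[of ?l] w unfolding ok_def by simp
      fix k z and e :: real assume k: "k < ?l" and z: "z \<in> P ?w" and e: "\<eta>h p k < real N * e"
      have "\<eta> k ?w < e" using e \<eta>h[of k] k N by simp
      then show "\<exists>b\<in>fhull I (Wh p k). \<forall>c<N. \<bar>z c - b c\<bar> \<le> e"
        using ok[of k] w k z hull[of k] unfolding ok_def by simp
    qed
  qed
  then have "solves H ?Y P" unfolding solves_def H_def using cont by blast
  then show ?thesis by (rule solvableI[OF K adv])
qed

lemma solvable_mono:
  assumes "solvable \<nu> X P" "\<And>w. w \<in> X \<Longrightarrow> P w \<subseteq> \<Phi> w"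
  shows "solvable \<nu> X \<Phi>"
proof -
  obtain z :: nat and U s H where H: "advice X {..<z} U s" "solves H (answers \<nu> X {..<z} U s) P"
    using assms(1) unfolding solvable_def by blast
  have "fst p \<in> X" if "p \<in> answers \<nu> X {..<z} U s" for p using that by (auto simp: answers_def)
  then have "solves H (answers \<nu> X {..<z} U s) \<Phi>"
    using H(2) assms(2) unfolding solves_def by blast
  then show ?thesis using H(1) unfolding solvable_def by blast
qed

section \<open>Strategy pairs as a polytope\<close>

definition strategy_pair :: "nat \<Rightarrow> nat \<Rightarrow> (nat \<Rightarrow> real) \<Rightarrow> bool" where
  "strategy_pair n m z \<longleftrightarrow> (\<forall>i<n. 0 \<le> z i) \<and> (\<Sum>i<n. z i) = 1 \<and>
    (\<forall>j<m. 0 \<le> z (n + j)) \<and> (\<Sum>j<m. z (n + j)) = 1 \<and> (\<forall>c\<ge>n + m. z c = 0)"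

definition pure_pair :: "nat \<Rightarrow> nat \<times> nat \<Rightarrow> nat \<Rightarrow> real" where
  "pure_pair n = (\<lambda>(i, j) c. if c = i \<or> c = n + j then 1 else 0)"

text \<open>The marginals of a joint distribution on the pure pairs form a strategy pair;
  conversely, the product distribution has the given marginals.\<close>

lemma strategy_pair_hull: "fhull ({..<n} \<times> {..<m}) (pure_pair n) = {z. strategy_pair n m z}"
proof (intro equalityI subsetI)
  fix z assume "z \<in> fhull ({..<n} \<times> {..<m}) (pure_pair n)"
  then obtain l where l: "\<forall>k\<in>{..<n} \<times> {..<m}. 0 \<le> l k" "sum l ({..<n} \<times> {..<m}) = 1"
    "z = (\<lambda>c. \<Sum>k\<in>{..<n} \<times> {..<m}. l k * pure_pair n k c)" by (auto simp: fhull_def)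
  have z: "z c = (\<Sum>i<n. \<Sum>j<m. l (i, j) * pure_pair n (i, j) c)" for c
    unfolding l(3) by (simp add: sum.cartesian_product)
  have x: "z i = (\<Sum>j<m. l (i, j))" if "i < n" for i
  proof -
    have "(\<Sum>j<m. l (k, j) * pure_pair n (k, j) i) = (if k = i then (\<Sum>j<m. l (i, j)) else 0)" for k
      using that by (auto simp: pure_pair_def)
    then show ?thesis using that unfolding z by simp
  qed
  have y: "z (n + j) = (\<Sum>i<n. l (i, j))" if "j < m" for j
    unfolding z
  proof (rule sum.cong[OF refl])
    fix i assume "i \<in> {..<n}"
    then have "(\<Sum>k<m. l (i, k) * pure_pair n (i, k) (n + j)) = (\<Sum>k<m. if k = j then l (i, j) else 0)"
      by (intro sum.cong refl) (auto simp: pure_pair_def)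
    then show "(\<Sum>k<m. l (i, k) * pure_pair n (i, k) (n + j)) = l (i, j)" using that by simp
  qed
  have tot: "(\<Sum>i<n. \<Sum>j<m. l (i, j)) = 1" using l(2) by (simp add: sum.cartesian_product)
  have "(\<Sum>i<n. z i) = 1" using x tot by simp
  moreover have "(\<Sum>j<m. z (n + j)) = 1" using y tot by (simp add: sum.swap[of _ "{..<m}"])
  moreover have "z c = 0" if "n + m \<le> c" for c
    unfolding z using that by (intro sum.neutral ballI) (auto simp: pure_pair_def)
  ultimately show "z \<in> {z. strategy_pair n m z}"
    using l(1) x y by (auto simp: strategy_pair_def intro!: sum_nonneg)
next
  fix z assume "z \<in> {z. strategy_pair n m z}"
  then have z: "\<forall>i<n. 0 \<le> z i" "(\<Sum>i<n. z i) = 1" "\<forall>j<m. 0 \<le> z (n + j)" "(\<Sum>j<m. z (n + j)) = 1"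
    "\<forall>c\<ge>n + m. z c = 0" by (auto simp: strategy_pair_def)
  define l where "l = (\<lambda>(i, j). z i * z (n + j))"
  have dist: "(\<Sum>k\<in>{..<n} \<times> {..<m}. l k * \<phi> k) = (\<Sum>i<n. \<Sum>j<m. z i * z (n + j) * \<phi> (i, j))" for \<phi> :: "nat \<times> nat \<Rightarrow> real"
    by (simp add: sum.cartesian_product l_def case_prod_unfold)
  have tot: "sum l ({..<n} \<times> {..<m}) = 1"
    using dist[of "\<lambda>_. 1"] z(2,4) by (simp flip: sum_distrib_left sum_distrib_right)
  have zc: "z c = (\<Sum>k\<in>{..<n} \<times> {..<m}. l k * pure_pair n k c)" for c
  proof -
    consider "c < n" | j where "c = n + j" "j < m" | "n + m \<le> c"
    proof -
      assume *: "c < n \<Longrightarrow> thesis" "\<And>j. c = n + j \<Longrightarrow> j < m \<Longrightarrow> thesis" "n + m \<le> c \<Longrightarrow> thesis"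
      have "c = n + (c - n)" "c - n < m" if "\<not> c < n" "\<not> n + m \<le> c" using that by auto
      then show thesis using * by metis
    qed
    then show ?thesis
    proof cases
      case 1
      have "(\<Sum>j<m. z i * z (n + j) * pure_pair n (i, j) c) = (if i = c then z c else 0)" for i
        using 1 z(4) by (auto simp: pure_pair_def simp flip: sum_distrib_left)
      then show ?thesis using 1 unfolding dist by simp
    next
      case 2
      have "(\<Sum>k<m. z i * z (n + k) * pure_pair n (i, k) c) = z i * z (n + j)" if "i < n" for i
      proof -
        have "(\<Sum>k<m. z i * z (n + k) * pure_pair n (i, k) c) = (\<Sum>k<m. if k = j then z i * z (n + j) else 0)"
          using 2 that by (intro sum.cong refl) (auto simp: pure_pair_def)
        then show ?thesis using 2 by simp
      qed
      then have "(\<Sum>k\<in>{..<n} \<times> {..<m}. l k * pure_pair n k c) = (\<Sum>i<n. z i * z (n + j))" unfolding dist by simp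
      then show ?thesis using z(2) 2 by (simp flip: sum_distrib_right)
    next
      case 3
      then have "(\<Sum>i<n. \<Sum>j<m. z i * z (n + j) * pure_pair n (i, j) c) = 0"
        by (intro sum.neutral ballI) (auto simp: pure_pair_def)
      then show ?thesis using 3 z(5) unfolding dist by simp
    qed
  qed
  have "\<forall>k\<in>{..<n} \<times> {..<m}. 0 \<le> l k" using z(1,3) by (auto simp: l_def)
  then show "z \<in> fhull ({..<n} \<times> {..<m}) (pure_pair n)"
    unfolding fhull_def by (intro CollectI exI[of _ l] conjI tot ext zc)
qed

lemma strategy_pair_in_cube:
  assumes "strategy_pair n m z"
  shows "in_cube (n + m) z"
proof -
  have z: "\<forall>i<n. 0 \<le> z i" "(\<Sum>i<n. z i) = 1" "\<forall>j<m. 0 \<le> z (n + j)" "(\<Sum>j<m. z (n + j)) = 1"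
    "\<forall>c\<ge>n + m. z c = 0" using assms by (auto simp: strategy_pair_def)
  have "0 \<le> z c \<and> z c \<le> 1" if "c < n + m" for c
  proof (cases "c < n")
    case True
    then show ?thesis using member_le_sum[of c "{..<n}" z] z by auto
  next
    case False
    then have "c - n \<in> {..<m}" "n + (c - n) = c" using that by auto
    then show ?thesis using member_le_sum[of "c - n" "{..<m}" "\<lambda>j. z (n + j)"] z by auto
  qed
  then show ?thesis using z(5) by (simp add: in_cube_def)
qed

lemma strategy_pair_limit:
  assumes u: "\<And>k. strategy_pair n m (u k)" and lim: "\<And>c. (\<lambda>k. u k c) \<longlonglongrightarrow> z c"
  shows "strategy_pair n m z"
proof -
  have "0 \<le> z i" if "i < n" for i
    using u that by (intro LIMSEQ_le_const[OF lim]) (auto simp: strategy_pair_def)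
  moreover have "0 \<le> z (n + j)" if "j < m" for j
    using u that by (intro LIMSEQ_le_const[OF lim]) (auto simp: strategy_pair_def)
  moreover have "z c = 0" if "n + m \<le> c" for c
  proof -
    have "(\<lambda>k. u k c) = (\<lambda>_. 0)" using u that by (auto simp: strategy_pair_def)
    then show ?thesis using lim[of c] LIMSEQ_unique tendsto_const by metis
  qed
  moreover have "(\<Sum>i<n. z i) = 1"
  proof -
    have "(\<lambda>k. \<Sum>i<n. u k i) \<longlonglongrightarrow> (\<Sum>i<n. z i)" by (intro tendsto_sum lim)
    moreover have "(\<lambda>k. \<Sum>i<n. u k i) = (\<lambda>_. 1)" using u by (auto simp: strategy_pair_def)
    ultimately show ?thesis using LIMSEQ_unique tendsto_const by metis
  qed
  moreover have "(\<Sum>j<m. z (n + j)) = 1"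
  proof -
    have "(\<lambda>k. \<Sum>j<m. u k (n + j)) \<longlonglongrightarrow> (\<Sum>j<m. z (n + j))" by (intro tendsto_sum lim)
    moreover have "(\<lambda>k. \<Sum>j<m. u k (n + j)) = (\<lambda>_. 1)" using u by (auto simp: strategy_pair_def)
    ultimately show ?thesis using LIMSEQ_unique tendsto_const by metis
  qed
  ultimately show ?thesis by (simp add: strategy_pair_def)
qed

subsection \<open>Strategy pairs subject to linear constraints\<close>

definition constrained :: "nat \<Rightarrow> nat \<Rightarrow> (baire \<Rightarrow> nat \<Rightarrow> real) set \<Rightarrow> baire \<Rightarrow> (nat \<Rightarrow> real) set" where
  "constrained n m S w = {z. strategy_pair n m z \<and> (\<forall>a\<in>S. lin (n + m) (a w) z \<le> 0)}"

text \<open>Closed graph and compactness in sequential form, the common source of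
  \<open>closedin_constrained\<close> and \<open>usc_constrained\<close>.\<close>

lemma constrained_limit:
  assumes a: "\<forall>a\<in>S. \<forall>c. continuous_on X (\<lambda>w. a w c)" and w: "w \<in> X"
    and u: "\<And>k. u k \<in> X" "\<And>k. agree k w (u k)" and z: "\<And>k. z k \<in> constrained n m S (u k)"
  shows "\<exists>l r. strict_mono (r :: nat \<Rightarrow> nat) \<and> l \<in> constrained n m S w \<and> (\<forall>c. (\<lambda>k. z (r k) c) \<longlonglongrightarrow> l c)"
proof -
  have sp: "strategy_pair n m (z k)" for k using z[of k] by (simp add: constrained_def)
  have "0 \<le> z k c \<and> z k c \<le> 1" for k c
    using strategy_pair_in_cube[OF sp[of k]] by (cases "c < n + m") (auto simp: in_cube_def)
  from cube_subsequence[of z, OF this] obtain l r where r: "strict_mono (r :: nat \<Rightarrow> nat)"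
    and l: "\<And>c. (\<lambda>k. z (r k) c) \<longlonglongrightarrow> l c" by blast
  have "lin (n + m) (a w) l \<le> 0" if aS: "a \<in> S" for a
  proof -
    have "(\<lambda>k. a (u k) c) \<longlonglongrightarrow> a w c" for c
    proof (rule LIMSEQ_I)
      fix e :: real assume e: "0 < e"
      have "\<forall>w\<in>X. \<forall>e>0. \<exists>k. \<forall>v\<in>X. agree k w v \<longrightarrow> \<bar>a v c - a w c\<bar> < e"
        proof -
        have "continuous_on X (\<lambda>w. a w c)" using a aS by blast
        then show ?thesis unfolding continuous_on_agree_real .
      qed
      then obtain K where K: "\<forall>v\<in>X. agree K w v \<longrightarrow> \<bar>a v c - a w c\<bar> < e" using w e by blast
      show "\<exists>K. \<forall>k\<ge>K. norm (a (u k) c - a w c) < e"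
        using K u agree_mono[OF u(2)] by (intro exI[of _ K]) auto
    qed
    then have "(\<lambda>k. a (u (r k)) c) \<longlonglongrightarrow> a w c" for c
      using LIMSEQ_subseq_LIMSEQ[OF _ r] by (fastforce simp: comp_def)
    then have "(\<lambda>k. lin (n + m) (a (u (r k))) (z (r k))) \<longlonglongrightarrow> lin (n + m) (a w) l"
      unfolding lin_def by (intro tendsto_sum tendsto_mult l)
    moreover have "lin (n + m) (a (u (r k))) (z (r k)) \<le> 0" for k
      using z[of "r k"] aS by (simp add: constrained_def)
    ultimately show ?thesis by (intro LIMSEQ_le_const2) auto
  qed
  moreover have "strategy_pair n m l" by (rule strategy_pair_limit[OF sp l])
  ultimately show ?thesis using r l unfolding constrained_def by blast
qed

lemma closedin_constrained:
  assumes a: "\<forall>a\<in>S. \<forall>c. continuous_on X (\<lambda>w. a w c)"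
  shows "closedin (top_of_set X) {w \<in> X. constrained n m S w \<noteq> {}}"
proof -
  let ?A = "{w \<in> X. constrained n m S w \<noteq> {}}"
  have "openin (top_of_set X) (X - ?A)"
  proof (rule openin_agreeI)
    fix w assume w: "w \<in> X - ?A"
    show "\<exists>k. \<forall>v\<in>X. agree k w v \<longrightarrow> v \<in> X - ?A"
    proof (rule ccontr)
      assume "\<not> ?thesis"
      then have "\<forall>k. \<exists>v z. v \<in> X \<and> agree k w v \<and> z \<in> constrained n m S v" by blast
      then obtain u z where "\<And>k. u k \<in> X" "\<And>k. agree k w (u k)" "\<And>k. z k \<in> constrained n m S (u k)" by metis
      from constrained_limit[OF a _ this] w show False by blast
    qed
  qed auto
  then have "closedin (top_of_set X) (X - (X - ?A))" by (intro closedin_diff) auto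
  moreover have "X - (X - ?A) = ?A" by auto
  ultimately show ?thesis by simp
qed

lemma usc_constrained:
  assumes a: "\<forall>a\<in>S. \<forall>c. continuous_on X (\<lambda>w. a w c)"
  shows "usc (n + m) X (constrained n m S)"
  unfolding usc_def
proof (intro ballI allI impI)
  fix w and e :: real assume w: "w \<in> X" and e: "0 < e"
  let ?near = "\<lambda>z z'. \<forall>c<n + m. \<bar>z c - z' c\<bar> \<le> e"
  show "\<exists>k. \<forall>v\<in>X. agree k w v \<longrightarrow> (\<forall>z\<in>constrained n m S v. \<exists>z'\<in>constrained n m S w. ?near z z')"
  proof (rule ccontr)
    assume "\<not> ?thesis"
    then have "\<forall>k. \<exists>v z. v \<in> X \<and> agree k w v \<and> z \<in> constrained n m S v \<and> (\<forall>z'\<in>constrained n m S w. \<not> ?near z z')"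
      by blast
    then obtain u z where u: "\<And>k. u k \<in> X" "\<And>k. agree k w (u k)" "\<And>k. z k \<in> constrained n m S (u k)"
      and far: "\<And>k z'. z' \<in> constrained n m S w \<Longrightarrow> \<not> ?near (z k) z'" by metis
    from constrained_limit[OF a w u] obtain l r where l: "l \<in> constrained n m S w" "\<And>c. (\<lambda>k. z (r k) c) \<longlonglongrightarrow> l c"
      by blast
    have "eventually (\<lambda>k. \<bar>z (r k) c - l c\<bar> < e) sequentially" for c
      using l(2)[of c] e unfolding tendsto_iff dist_real_def by blast
    then have "eventually (\<lambda>k. \<forall>c\<in>{..<n + m}. \<bar>z (r k) c - l c\<bar> < e) sequentially"
      by (intro eventually_ball_finite) auto
    then obtain k where "\<forall>c\<in>{..<n + m}. \<bar>z (r k) c - l c\<bar> < e" by (auto simp: eventually_sequentially)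
    then have "?near (z (r k)) l" by (auto intro: less_imp_le)
    then show False using far[OF l(1)] by blast
  qed
qed

lemma solvable_constrained:
  assumes S: "finite S" and a: "\<forall>a\<in>S. \<forall>c. continuous_on X (\<lambda>w. a w c)"
    and ne: "\<And>w. w \<in> X \<Longrightarrow> constrained n m S w \<noteq> {}" and nm: "0 < n + m"
  shows "solvable \<nu> X (constrained n m S)"
proof (rule solvable_stratified)
  obtain as where as: "set as = S" using finite_list[OF S] by blast
  let ?I = "prod_encode ` ({..<n} \<times> {..<m})" and ?V = "\<lambda>k. pure_pair n (prod_decode k)"
  have "fhull ?I ?V = fhull ({..<n} \<times> {..<m}) (\<lambda>k. ?V (prod_encode k))"
    by (rule fhull_reindex) (rule inj_prod_encode)
  then have hull: "fhull ?I ?V = {z. strategy_pair n m z}" by (simp add: strategy_pair_hull)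
  have eq: "{z \<in> fhull ?I ?V. \<forall>a\<in>set as. lin (n + m) (a w) z \<le> 0} = constrained n m S w" for w
    unfolding hull as by (auto simp: constrained_def)
  have "stratified X (\<lambda>w. {z \<in> fhull ?I ?V. \<forall>a\<in>set as. lin (n + m) (a w) z \<le> 0})"
  proof (rule stratified_constraints)
    show "finite ?I" by simp
    show "continuous_on X (\<lambda>w. a w c)" if "a \<in> set as" for a c using a that as by blast
    show "{z \<in> fhull ?I ?V. \<forall>a\<in>set as. lin (n + m) (a w) z \<le> 0} \<noteq> {}" if "w \<in> X" for w
      using ne[OF that] unfolding eq .
  qed
  then show "stratified X (constrained n m S)" unfolding eq .
  show "in_cube (n + m) z" if "z \<in> constrained n m S w" for w z
    using that strategy_pair_in_cube by (simp add: constrained_def)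
qed (use ne nm usc_constrained[OF a] in auto)

subsection \<open>Equilibria with prescribed supports\<close>

text \<open>The complementarity form of equilibrium: every pure strategy in use is a best reply. It
  compares pure strategies only.\<close>

definition equilibria ::
  "nat \<Rightarrow> nat \<Rightarrow> (nat \<Rightarrow> nat \<Rightarrow> real) \<Rightarrow> (nat \<Rightarrow> nat \<Rightarrow> real) \<Rightarrow> (nat \<Rightarrow> real) set" where
  "equilibria n m a b = {z. strategy_pair n m z \<and>
    (\<forall>i<n. 0 < z i \<longrightarrow> (\<forall>k<n. (\<Sum>j<m. a k j * z (n + j)) \<le> (\<Sum>j<m. a i j * z (n + j)))) \<and>
    (\<forall>j<m. 0 < z (n + j) \<longrightarrow> (\<forall>k<m. (\<Sum>i<n. b i k * z i) \<le> (\<Sum>i<n. b i j * z i)))}"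

lemma equilibria_nonempty:
  assumes "n \<ge> 1" "m \<ge> 1"
  shows "equilibria n m a b \<noteq> {}"
proof -
  obtain x y where xy: "\<forall>i<n. 0 \<le> x i" "(\<Sum>i<n. x i) = 1" "\<forall>j<m. 0 \<le> y j" "(\<Sum>j<m. y j) = 1"
    "\<forall>i<n. 0 < x i \<longrightarrow> (\<forall>k<n. (\<Sum>j<m. a k j * y j) \<le> (\<Sum>j<m. a i j * y j))"
    "\<forall>j<m. 0 < y j \<longrightarrow> (\<forall>k<m. (\<Sum>i<n. b i k * x i) \<le> (\<Sum>i<n. b i j * x i))"
    using ex_equilibrium[OF assms, of a b] by (elim exE conjE)
  define z where "z c = (if c < n then x c else if c < n + m then y (c - n) else 0)" for c
  have "z i = x i" if "i < n" for i using that by (simp add: z_def)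
  moreover have "z (n + j) = y j" if "j < m" for j using that by (simp add: z_def)
  moreover have "z c = 0" if "n + m \<le> c" for c using that by (simp add: z_def)
  ultimately have "z \<in> equilibria n m a b"
    unfolding equilibria_def strategy_pair_def using xy by simp
  then show ?thesis by blast
qed

definition support_constraints :: "nat \<Rightarrow> nat \<Rightarrow> (baire \<Rightarrow> nat \<Rightarrow> nat \<Rightarrow> real) \<Rightarrow>
    (baire \<Rightarrow> nat \<Rightarrow> nat \<Rightarrow> real) \<Rightarrow> nat set \<Rightarrow> nat set \<Rightarrow> (baire \<Rightarrow> nat \<Rightarrow> real) set" where
  "support_constraints n m a b I J =
    (\<lambda>i w c. if c = i then 1 else 0) ` ({..<n} - I) \<union>
    (\<lambda>j w c. if c = n + j then 1 else 0) ` ({..<m} - J) \<union>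
    (\<lambda>(i, k) w c. if n \<le> c then a w k (c - n) - a w i (c - n) else 0) ` (I \<times> {..<n}) \<union>
    (\<lambda>(j, k) w c. if c < n then b w c k - b w c j else 0) ` (J \<times> {..<m})"

lemma sum_lessThan_add:
  fixes f :: "nat \<Rightarrow> real"
  shows "(\<Sum>c<n + m. f c) = (\<Sum>c<n. f c) + (\<Sum>j<m. f (n + j))"
  by (induction m) (simp_all add: add.assoc)

lemma lin_unit: "k < N \<Longrightarrow> lin N (\<lambda>c. if c = k then 1 else 0) z = z k"
  by (simp add: lin_def if_distrib[of "\<lambda>x. x * _"] cong: if_cong)

lemma lin_second: "lin (n + m) (\<lambda>c. if n \<le> c then f (c - n) - g (c - n) else 0) z =
    (\<Sum>j<m. f j * z (n + j)) - (\<Sum>j<m. g j * z (n + j))"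
  by (simp add: lin_def sum_lessThan_add left_diff_distrib sum_subtractf)

lemma lin_first: "lin (n + m) (\<lambda>c. if c < n then f c - g c else 0) z =
    (\<Sum>i<n. f i * z i) - (\<Sum>i<n. g i * z i)"
  by (simp add: lin_def sum_lessThan_add left_diff_distrib sum_subtractf)

lemma constrained_support:
  assumes "I \<subseteq> {..<n}" "J \<subseteq> {..<m}"
  shows "z \<in> constrained n m (support_constraints n m a b I J) w \<longleftrightarrow> strategy_pair n m z \<and>
    (\<forall>i<n. i \<notin> I \<longrightarrow> z i \<le> 0) \<and> (\<forall>j<m. j \<notin> J \<longrightarrow> z (n + j) \<le> 0) \<and>
    (\<forall>i\<in>I. \<forall>k<n. (\<Sum>j<m. a w k j * z (n + j)) \<le> (\<Sum>j<m. a w i j * z (n + j))) \<and>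
    (\<forall>j\<in>J. \<forall>k<m. (\<Sum>i<n. b w i k * z i) \<le> (\<Sum>i<n. b w i j * z i))"
proof -
  have 1: "(\<forall>s\<in>(\<lambda>i w c. if c = i then 1 else 0) ` ({..<n} - I). lin (n + m) (s w) z \<le> 0) \<longleftrightarrow>
      (\<forall>i<n. i \<notin> I \<longrightarrow> z i \<le> 0)" for w :: baire
    by (auto simp: lin_unit)
  have 2: "(\<forall>s\<in>(\<lambda>j w c. if c = n + j then 1 else 0) ` ({..<m} - J). lin (n + m) (s w) z \<le> 0) \<longleftrightarrow>
      (\<forall>j<m. j \<notin> J \<longrightarrow> z (n + j) \<le> 0)" for w :: baire
    by (auto simp: lin_unit)
  have 3: "(\<forall>s\<in>(\<lambda>(i, k) w c. if n \<le> c then a w k (c - n) - a w i (c - n) else 0) ` (I \<times> {..<n}).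
        lin (n + m) (s w) z \<le> 0) \<longleftrightarrow>
      (\<forall>i\<in>I. \<forall>k<n. (\<Sum>j<m. a w k j * z (n + j)) \<le> (\<Sum>j<m. a w i j * z (n + j)))"
    by (auto simp: lin_second)
  have 4: "(\<forall>s\<in>(\<lambda>(j, k) w c. if c < n then b w c k - b w c j else 0) ` (J \<times> {..<m}).
        lin (n + m) (s w) z \<le> 0) \<longleftrightarrow>
      (\<forall>j\<in>J. \<forall>k<m. (\<Sum>i<n. b w i k * z i) \<le> (\<Sum>i<n. b w i j * z i))"
    by (auto simp: lin_first)
  show ?thesis
    unfolding constrained_def support_constraints_def mem_Collect_eq ball_Un 1 2 3 4
    by (simp only: conj_assoc)
qed

lemma solvable_equilibria:
  assumes nm: "n \<ge> 1" "m \<ge> 1"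
    and a: "\<And>i j. i < n \<Longrightarrow> j < m \<Longrightarrow> continuous_on X (\<lambda>w. a w i j)"
    and b: "\<And>i j. i < n \<Longrightarrow> j < m \<Longrightarrow> continuous_on X (\<lambda>w. b w i j)"
  shows "solvable \<nu> X (\<lambda>w. equilibria n m (a w) (b w))"
proof -
  \<comment> \<open>Payoffs are set to 0 outside the range, so that every coordinate of every
    constraint is continuous.\<close>
  define a' where "a' w i j = (if i < n \<and> j < m then a w i j else 0)" for w i j
  define b' where "b' w i j = (if i < n \<and> j < m then b w i j else 0)" for w i j
  have a': "continuous_on X (\<lambda>w. a' w i j)" for i j
    unfolding a'_def using a by (cases "i < n"; cases "j < m") simp_all
  have b': "continuous_on X (\<lambda>w. b' w i j)" for i j
    unfolding b'_def using b by (cases "i < n"; cases "j < m") simp_all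
  have eq: "equilibria n m (a' w) (b' w) = equilibria n m (a w) (b w)" for w
    by (simp add: equilibria_def a'_def b'_def)
  define S where "S = (\<lambda>(I, J). support_constraints n m a' b' I J)"
  let ?K = "Pow {..<n} \<times> Pow {..<m}"
  let ?X = "\<lambda>k. {w \<in> X. constrained n m (S k) w \<noteq> {}}"
  have if_const: "continuous_on X (\<lambda>w. if Q then f w else 0)" if "continuous_on X f"
    for Q and f :: "baire \<Rightarrow> real" using that by (cases Q) simp_all
  have S: "\<forall>s\<in>S k. \<forall>c. continuous_on X (\<lambda>w. s w c)" for k
  proof (intro ballI allI)
    fix s c assume s: "s \<in> S k"
    show "continuous_on X (\<lambda>w. s w c)"
      using s a' b' unfolding S_def support_constraints_def
      by (auto split: prod.splits intro!: if_const continuous_on_diff)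
  qed
  have fin: "finite (S k)" if "k \<in> ?K" for k
    using that finite_subset[of _ "{..<n}"] finite_subset[of _ "{..<m}"]
    by (auto simp: S_def support_constraints_def)
  have sub: "constrained n m (S k) w \<subseteq> equilibria n m (a' w) (b' w)" if k: "k \<in> ?K" for k w
  proof
    fix z assume z: "z \<in> constrained n m (S k) w"
    obtain I J where IJ: "k = (I, J)" "I \<subseteq> {..<n}" "J \<subseteq> {..<m}" using k by blast
    from z have "strategy_pair n m z \<and>
      (\<forall>i<n. i \<notin> I \<longrightarrow> z i \<le> 0) \<and> (\<forall>j<m. j \<notin> J \<longrightarrow> z (n + j) \<le> 0) \<and>
      (\<forall>i\<in>I. \<forall>k<n. (\<Sum>j<m. a' w k j * z (n + j)) \<le> (\<Sum>j<m. a' w i j * z (n + j))) \<and>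
      (\<forall>j\<in>J. \<forall>k<m. (\<Sum>i<n. b' w i k * z i) \<le> (\<Sum>i<n. b' w i j * z i))"
      unfolding IJ(1) S_def prod.case constrained_support[OF IJ(2,3)] .
    then show "z \<in> equilibria n m (a' w) (b' w)"
      unfolding equilibria_def by (auto simp: not_le[symmetric])
  qed
  \<comment> \<open>An equilibrium satisfies the constraints of its own supports, so finitely many
    closed sets cover \<open>X\<close>.\<close>
  have cover: "\<exists>k\<in>?K. constrained n m (S k) w \<noteq> {}" for w
  proof -
    obtain z where z: "z \<in> equilibria n m (a' w) (b' w)" using equilibria_nonempty[OF nm] by blast
    let ?I = "{i. i < n \<and> 0 < z i}" and ?J = "{j. j < m \<and> 0 < z (n + j)}"
    have IJ: "?I \<subseteq> {..<n}" "?J \<subseteq> {..<m}" by auto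
    have "z \<in> constrained n m (S (?I, ?J)) w"
      unfolding S_def prod.case constrained_support[OF IJ]
      using z unfolding equilibria_def by auto
    then show ?thesis using IJ by blast
  qed
  have "solvable \<nu> (\<Union>k\<in>?K. ?X k) (\<lambda>w. equilibria n m (a' w) (b' w))"
  proof (rule solvable_UN)
    show "finite ?K" by simp
    show "closedin (top_of_set X) (?X k)" for k by (rule closedin_constrained[OF S])
    fix k assume k: "k \<in> ?K"
    have "\<forall>s\<in>S k. \<forall>c. continuous_on (?X k) (\<lambda>w. s w c)"
      using S[of k] by (auto intro: continuous_on_subset)
    then have "solvable \<nu> (?X k) (constrained n m (S k))"
      by (rule solvable_constrained[OF fin[OF k]]) (use nm in auto)
    then show "solvable \<nu> (?X k) (\<lambda>w. equilibria n m (a' w) (b' w))"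
      by (rule solvable_mono) (rule sub[OF k])
  qed
  moreover have "(\<Union>k\<in>?K. ?X k) = X"
  proof (rule equalityI)
    show "(\<Union>k\<in>?K. ?X k) \<subseteq> X" by (rule UN_least) simp
    show "X \<subseteq> (\<Union>k\<in>?K. ?X k)"
    proof
      fix w assume "w \<in> X"
      moreover obtain k where k: "k \<in> ?K" "constrained n m (S k) w \<noteq> {}" using cover[of w] by (rule bexE)
      ultimately have "w \<in> ?X k" by simp
      with k(1) show "w \<in> (\<Union>k\<in>?K. ?X k)" by (rule UN_I)
    qed
  qed
  ultimately show ?thesis by (simp only: eq)
qed

section \<open>Equilibria in matrix form\<close>

lemma best_response:
  fixes x :: "nat \<Rightarrow> real"
  assumes x: "\<And>i. i < n \<Longrightarrow> 0 \<le> x i" "(\<Sum>i<n. x i) = 1"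
    and best: "\<And>i k. i < n \<Longrightarrow> 0 < x i \<Longrightarrow> k < n \<Longrightarrow> u k \<le> u i"
    and x': "\<And>i. i < n \<Longrightarrow> 0 \<le> x' i" "(\<Sum>i<n. x' i) = 1"
  shows "(\<Sum>i<n. x' i * u i) \<le> (\<Sum>i<n. x i * u i)"
proof -
  have "\<exists>i<n. 0 < x i"
  proof (rule ccontr)
    assume "\<not> ?thesis"
    then have "\<forall>i<n. x i = 0" using x(1) by force
    then show False using x(2) by simp
  qed
  then obtain i where i: "i < n" "0 < x i" by blast
  \<comment> \<open>Any two strategies in use are each at least as good as the other, so all of them
    have the payoff of \<open>i\<close>, which is the maximum.\<close>
  have eq: "x k * u k = x k * u i" if "k < n" for k
  proof (cases "x k = 0")
    case False
    then have "0 < x k" using x(1)[OF that] by simp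
    then show ?thesis using best[OF that _ i(1)] best[OF i that] by (simp add: antisym)
  qed simp
  have "(\<Sum>k<n. x k * u k) = (\<Sum>k<n. x k * u i)" by (intro sum.cong refl eq) simp
  then have "(\<Sum>k<n. x k * u k) = u i" using x(2) by (simp flip: sum_distrib_right)
  moreover have "(\<Sum>k<n. x' k * u k) \<le> (\<Sum>k<n. x' k * u i)"
    using x'(1) best[OF i] by (intro sum_mono mult_left_mono) auto
  moreover have "(\<Sum>k<n. x' k * u i) = u i" using x'(2) by (simp flip: sum_distrib_right)
  ultimately show ?thesis by simp
qed

lemma scalar_prod_mat_vec:
  fixes A :: "real mat"
  assumes "A \<in> carrier_mat n m" "x \<in> carrier_vec n" "y \<in> carrier_vec m"
  shows "scalar_prod x (A *\<^sub>v y) = (\<Sum>i<n. vec_index x i * (\<Sum>j<m. A $$ (i, j) * vec_index y j))"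
  using assms unfolding scalar_prod_def lessThan_atLeast0
  by (auto simp: scalar_prod_def intro!: sum.cong)

lemma equilibria_nash:
  assumes AB: "A \<in> carrier_mat n m" "B \<in> carrier_mat n m"
    and z: "z \<in> equilibria n m (\<lambda>i j. A $$ (i, j)) (\<lambda>i j. B $$ (i, j))"
  shows "nash_equilibrium n m A B (Matrix.vec n z) (Matrix.vec m (\<lambda>j. z (n + j)))"
proof -
  have sp: "\<And>i. i < n \<Longrightarrow> 0 \<le> z i" "(\<Sum>i<n. z i) = 1" "\<And>j. j < m \<Longrightarrow> 0 \<le> z (n + j)" "(\<Sum>j<m. z (n + j)) = 1"
    using z by (auto simp: equilibria_def strategy_pair_def)
  let ?x = "Matrix.vec n z" and ?y = "Matrix.vec m (\<lambda>j. z (n + j))"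
  have xy: "?x \<in> mixed_strategies n" "?y \<in> mixed_strategies m"
    using sp by (auto simp: mixed_strategies_def)
  have "scalar_prod x' (A *\<^sub>v ?y) \<le> scalar_prod ?x (A *\<^sub>v ?y)" if x': "x' \<in> mixed_strategies n" for x'
  proof -
    have "(\<Sum>i<n. vec_index x' i * (\<Sum>j<m. A $$ (i, j) * z (n + j))) \<le> (\<Sum>i<n. z i * (\<Sum>j<m. A $$ (i, j) * z (n + j)))"
      by (rule best_response[OF sp(1,2)]) (use z x' in \<open>auto simp: equilibria_def mixed_strategies_def\<close>)
    moreover have "x' \<in> carrier_vec n" using x' by (simp add: mixed_strategies_def)
    ultimately show ?thesis using AB(1) by (simp add: scalar_prod_mat_vec[of A n m])
  qed
  moreover have "scalar_prod ?x (B *\<^sub>v y') \<le> scalar_prod ?x (B *\<^sub>v ?y)" if y': "y' \<in> mixed_strategies m" for y'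
  proof -
    \<comment> \<open>Exchanging the sums brings the claim for the second player into the form of
      \<open>best_response\<close>.\<close>
    have swap: "(\<Sum>i<n. z i * (\<Sum>j<m. B $$ (i, j) * y j)) = (\<Sum>j<m. y j * (\<Sum>i<n. B $$ (i, j) * z i))" for y :: "nat \<Rightarrow> real"
      unfolding sum_distrib_left by (subst sum.swap) (simp add: mult_ac)
    have "(\<Sum>j<m. vec_index y' j * (\<Sum>i<n. B $$ (i, j) * z i)) \<le> (\<Sum>j<m. z (n + j) * (\<Sum>i<n. B $$ (i, j) * z i))"
      by (rule best_response[OF sp(3,4)]) (use z y' in \<open>auto simp: equilibria_def mixed_strategies_def\<close>)
    moreover have "y' \<in> carrier_vec m" using y' by (simp add: mixed_strategies_def)
    ultimately show ?thesis using AB(2) by (simp add: scalar_prod_mat_vec[of B n m] swap)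
  qed
  ultimately show ?thesis using xy unfolding nash_equilibrium_def by blast
qed

section \<open>Reading the payoffs off the name of a game\<close>

lemma length_concat_map: "length (concat (map (\<lambda>i. map (f i) [0..<m]) [0..<n])) = n * m"
  by (induction n) auto

lemma nth_concat_map:
  "i < n \<Longrightarrow> j < m \<Longrightarrow> concat (map (\<lambda>i. map (f i) [0..<m]) [0..<n]) ! (i * m + j) = f i j"
proof (induction n)
  case (Suc n)
  show ?case
  proof (cases "i < n")
    case True
    then have "Suc i * m \<le> n * m" by (intro mult_le_mono1) simp
    then have "i * m + j < n * m" using Suc.prems(2) by simp
    then show ?thesis using Suc.IH[OF True Suc.prems(2)] by (simp add: nth_append length_concat_map)
  next
    case False
    then have "i = n" using Suc.prems(1) by simp
    then show ?thesis using Suc.prems(2) by (simp add: nth_append length_concat_map)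
  qed
qed simp

lemma concat_mat_to_list:
  assumes "A \<in> carrier_mat n m"
  shows "length (concat (mat_to_list A)) = n * m"
    "i < n \<Longrightarrow> j < m \<Longrightarrow> concat (mat_to_list A) ! (i * m + j) = A $$ (i, j)"
  using assms length_concat_map[of "\<lambda>i j. A $$ (i, j)" m n] nth_concat_map[of i n j m "\<lambda>i j. A $$ (i, j)"]
  by (auto simp: mat_to_list_def)

text \<open>The first two digits hold the size; the rest is a tuple of the entries of both matrices,
  row by row.\<close>

definition entry_name :: "nat \<Rightarrow> nat \<Rightarrow> nat \<Rightarrow> baire \<Rightarrow> baire" where
  "entry_name n m k w = btuple_nth (n * m + n * m) k (\<lambda>i. w (Suc (Suc i)))"

lemma rho_name_entry:
  assumes "game_name \<nu> n m w A B" "k < n * m + n * m"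
  shows "rho_name \<nu> (entry_name n m k w) ((concat (mat_to_list A) @ concat (mat_to_list B)) ! k)"
proof -
  let ?xs = "concat (mat_to_list A) @ concat (mat_to_list B)"
  obtain ws where ws: "list_all2 (rho_name \<nu>) ws ?xs" "w = n ## m ## btuple ws"
    using assms(1) by (auto simp: game_name_def rho_names_def)
  have len: "length ws = n * m + n * m"
  proof -
    have "A \<in> carrier_mat n m" "B \<in> carrier_mat n m" using assms(1) by (auto simp: game_name_def)
    then show ?thesis using list_all2_lengthD[OF ws(1)] by (simp add: concat_mat_to_list(1)[of _ n m])
  qed
  have "entry_name n m k w = ws ! k"
    unfolding entry_name_def ws(2) using btuple_nth_btuple[of k ws] len assms(2) by simp
  then show ?thesis using list_all2_nthD[OF ws(1)] len assms(2) by simp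
qed

definition payoff1 :: "(nat \<Rightarrow> rat) \<Rightarrow> nat \<Rightarrow> nat \<Rightarrow> baire \<Rightarrow> nat \<Rightarrow> nat \<Rightarrow> real" where
  "payoff1 \<nu> n m w i j = named_real \<nu> (entry_name n m (i * m + j) w)"

definition payoff2 :: "(nat \<Rightarrow> rat) \<Rightarrow> nat \<Rightarrow> nat \<Rightarrow> baire \<Rightarrow> nat \<Rightarrow> nat \<Rightarrow> real" where
  "payoff2 \<nu> n m w i j = named_real \<nu> (entry_name n m (n * m + (i * m + j)) w)"

lemma index_less: "i < n \<Longrightarrow> j < m \<Longrightarrow> i * m + j < n * (m::nat)"
proof -
  assume "i < n" "j < m"
  then have "Suc i * m \<le> n * m" by (intro mult_le_mono1) simp
  then show ?thesis using \<open>j < m\<close> by simp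
qed

lemma payoff_eq:
  assumes g: "game_name \<nu> n m w A B" and ij: "i < n" "j < m"
  shows "payoff1 \<nu> n m w i j = A $$ (i, j)" "payoff2 \<nu> n m w i j = B $$ (i, j)"
proof -
  have AB: "A \<in> carrier_mat n m" "B \<in> carrier_mat n m" using g by (auto simp: game_name_def)
  have l: "i * m + j < n * m" by (rule index_less[OF ij])
  note A = concat_mat_to_list[OF AB(1)] and B = concat_mat_to_list[OF AB(2)]
  show "payoff1 \<nu> n m w i j = A $$ (i, j)"
    unfolding payoff1_def using named_real_eq[OF rho_name_entry[OF g, of "i * m + j"]] l A(1) A(2)[OF ij]
    by (simp add: nth_append)
  show "payoff2 \<nu> n m w i j = B $$ (i, j)"
    unfolding payoff2_def using named_real_eq[OF rho_name_entry[OF g, of "n * m + (i * m + j)"]] l A(1) B(2)[OF ij]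
    by (simp add: nth_append)
qed

lemma continuous_on_named_entry:
  assumes "k < n * m + n * m"
  shows "continuous_on (inputs (Nash_nm \<nu> n m)) (\<lambda>w. named_real \<nu> (entry_name n m k w))"
proof (rule continuous_on_compose2[OF continuous_on_named_real])
  let ?X = "inputs (Nash_nm \<nu> n m)"
  have "continuous_on ?X (\<lambda>w i. w (Suc (Suc i)))"
    by (rule continuous_on_coordinatewise_then_product, rule continuous_on_apply) (rule continuous_on_id)
  then show "continuous_on ?X (entry_name n m k)"
    unfolding entry_name_def[abs_def] by (rule continuous_on_btuple_nth)
  show "entry_name n m k ` ?X \<subseteq> {w. \<exists>x. rho_name \<nu> w x}"
  proof
    fix u assume "u \<in> entry_name n m k ` ?X"
    then obtain w A B where "u = entry_name n m k w" "game_name \<nu> n m w A B" by (auto simp: Nash_nm_def)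
    then show "u \<in> {w. \<exists>x. rho_name \<nu> w x}" using rho_name_entry[OF _ assms] by blast
  qed
qed

section \<open>The reduction for each size and its gluing\<close>

lemma Nash_nm_reducible:
  assumes \<nu>: "surj \<nu>" and nm: "n \<ge> 1" "m \<ge> 1"
  shows "Nash_nm \<nu> n m \<le>\<^sub>2 sup_problem {1..} (\<lambda>z::nat. power_problem (rDiv \<nu>) z)"
proof (rule solvable_imp_reducible[OF \<nu>])
  let ?X = "inputs (Nash_nm \<nu> n m)"
  let ?E = "\<lambda>w. equilibria n m (payoff1 \<nu> n m w) (payoff2 \<nu> n m w)"
  show "solvable \<nu> ?X ?E"
  proof (rule solvable_equilibria[OF nm])
    show "continuous_on ?X (\<lambda>w. payoff1 \<nu> n m w i j)" if "i < n" "j < m" for i j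
      unfolding payoff1_def by (rule continuous_on_named_entry) (use index_less[OF that] in simp)
    show "continuous_on ?X (\<lambda>w. payoff2 \<nu> n m w i j)" if "i < n" "j < m" for i j
      unfolding payoff2_def by (rule continuous_on_named_entry) (use index_less[OF that] in simp)
  qed
  fix w z v assume w: "w \<in> ?X" and z: "z \<in> ?E w" and v: "rho_names \<nu> v (map z [0..<n + m])"
  obtain A B where g: "game_name \<nu> n m w A B" using w by (auto simp: Nash_nm_def)
  then have AB: "A \<in> carrier_mat n m" "B \<in> carrier_mat n m" by (auto simp: game_name_def)
  have "?E w = equilibria n m (\<lambda>i j. A $$ (i, j)) (\<lambda>i j. B $$ (i, j))"
    unfolding equilibria_def using payoff_eq[OF g] by simp
  then have "nash_equilibrium n m A B (Matrix.vec n z) (Matrix.vec m (\<lambda>j. z (n + j)))"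
    using equilibria_nash[OF AB] z by simp
  moreover have eq: "map z [0..<n + m] = list_of_vec (Matrix.vec n z) @ list_of_vec (Matrix.vec m (\<lambda>j. z (n + j)))"
    by (rule nth_equalityI) (auto simp: nth_append)
  ultimately show "v \<in> outputs (Nash_nm \<nu> n m) w"
    unfolding Nash_nm_def problem.simps mem_Collect_eq using g v[unfolded eq] by blast
qed

theorem theorem32:
  fixes \<nu> :: "nat \<Rightarrow> rat"
  assumes "computable_numbering \<nu>"
  shows "Nash \<nu> \<le>\<^sub>2 sup_problem {1..} (\<lambda>z::nat. power_problem (rDiv \<nu>) z)"
proof -
  have "surj \<nu>" using assms by (simp add: computable_numbering_def bij_is_surj)
  from Nash_nm_reducible[OF this] show ?thesis
    unfolding Nash_def by (intro sup_problem_reducible) (clarsimp simp del: One_nat_def)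
qed

end
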